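(* Let $(X,d)$ be a compact metric space and $f:X\to X$ a homeomorphism with the specification property. Let $\rho:X\to(0,\infty)$ be continuous and let $(X_\rho,\Psi)$ be the corresponding suspension flow over $X$, $\Psi=\{g_t\}$. Assume that $\Phi:X_\rho\to\mathbb{R}$ is continuous and satisfies $\inf_{\mu\in\mathcal{M}_\Psi(X_\rho)}\int\Phi\,d\mu<\sup_{\mu\in\mathcal{M}_\Psi(X_\rho)}\int\Phi\,d\mu$. Let $$\widehat X_\rho=\left\{(x,s)\in X_\rho:\lim_{T\to\infty}\frac1T\int_0^T\Phi(g_t(x,s))\,dt\text{ does not exist}\right\}.$$ Then $h_{top}(\widehat X_\rho,\Psi)=h_{top}(\Psi)$.
   Context: Specification property: a continuous map $f:X\to X$ has the specification property if for all $\epsilon>0$ there is an integer $m=m(\epsilon)$ such that for any finite collection of finite integer intervals $I_j=[a_j,b_j]\subset\mathbb{N}$, $j=1,\dots,k$, with $a_{j+1}-b_j\ge m(\epsilon)$ for $j=1,\dots,k-1$, and any $x_1,\dots,x_k\in X$, there is a point $x\in X$ with $d(f^{p+a_j}x,f^px_j)<\epsilon$ for all $p=0,\dots,b_j-a_j$ and every $j=1,\dots,k$. Suspension flow: $X_\rho=\{(x,s)\in X\times\mathbb{R}:0\le s\le\rho(x)\}$ with $(x,\rho(x))$ identified with $(f(x),0)$ for all $x$; equivalently, $X_\rho$ is the quotient of $X\times[0,\infty)$ under the equivalence relation generated by $(x,t+\rho(x))\sim(f(x),t)$, with quotient map $\pi$. The flow $\Psi=\{g_t\}$ is $g_t(x,s)=\pi(x,s+t)$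 for $t\ge0$ (and $g_{-t}=g_t^{-1}$). $\mathcal{M}_\Psi(X_\rho)$ is the set of Borel probability measures on $X_\rho$ invariant under all $g_t$. $h_{top}(\Psi)$ is the usual topological entropy of the flow $\Psi$ on the compact space $X_\rho$; it equals $\sup\{h_\mu:\mu\in\mathcal{M}_\Psi(X_\rho)\}$. Entropy of a (not necessarily compact or invariant) Borel set $Z\subset X_\rho$ with respect to $\Psi$: equip $X_\rho$ with a metric $d$ compatible with its (compact metrizable) quotient topology (the natural choice is the Bowen–Walters metric; the entropy does not depend on this choice), and let $B_t(x,\epsilon)=\{y\in X_\rho:d(g_s(x),g_s(y))<\epsilon\text{ for all }s\in[0,t)\}$. For $\alpha\in\mathbb{R}$ and a finite or countable collection $\Gamma=\{B_{t_i}(x_i,\epsilon)\}_i$ with $t_i\in(0,\infty)$, $x_i\in X_\rho$, put $Q(Z,\alpha,\Gamma)=\sum_{B_{t_i}(x_i,\epsilon)\in\Gamma}\exp(-\alpha t_i)$. Let $M(Z,\alpha,\epsilon,T)=\inf_\Gamma Q(Z,\alpha,\Gamma)$ over all such $\Gamma$ covering $Z$ with $t_i\ge T$ for all $i$, let $m(Z,\alpha,\epsilon)=\lim_{T\to\infty}M(Z,\alpha,\epsilon,T)$, $h_{top}(Z,\epsilon)=\inf\{\alpha:m(Z,\alpha,\epsilon)=0\}=\sup\{\alpha:m(Z,\alpha,\epsilon)=\infty\}$, and $h_{top}(Z,\Psi)=\lim_{\epsilon\to0}h_{top}(Z,\epsilon)$. *)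

theory Defs
  imports "HOL-Probability.Probability"
begin

section \<open>The specification property\<close>

text \<open>
  The intervals are \<open>{a j..b j}\<close> for \<open>j = 1, \<dots>, k\<close>; \<open>b j - a j\<close> is a natural-number
  difference, which is the true one because of \<open>a j \<le> b j\<close>.
\<close>

definition specification_property :: "('a::metric_space \<Rightarrow> 'a) \<Rightarrow> bool" where
  "specification_property f \<longleftrightarrow>
    (\<forall>\<epsilon>>0. \<exists>m::int. \<forall>(k::nat) (a::nat \<Rightarrow> nat) (b::nat \<Rightarrow> nat) (x::nat \<Rightarrow> 'a).
       (\<forall>j\<in>{1..k}. a j \<le> b j) \<longrightarrow>
       (\<forall>j. 1 \<le> j \<and> j < k \<longrightarrow> int (a (Suc j)) - int (b j) \<ge> m) \<longrightarrow>
       (\<exists>z. \<forall>j\<in>{1..k}. \<forall>p\<le>b j - a j.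
          dist ((f ^^ (p + a j)) z) ((f ^^ p) (x j)) < \<epsilon>))"


section \<open>The suspension flow\<close>

definition susp_step :: "('a \<Rightarrow> 'a) \<Rightarrow> ('a \<Rightarrow> real) \<Rightarrow> 'a \<times> real \<Rightarrow> 'a \<times> real \<Rightarrow> bool" where
  "susp_step f \<rho> p q \<longleftrightarrow> (\<exists>x t. 0 \<le> t \<and> p = (x, t + \<rho> x) \<and> q = (f x, t))"

definition susp_proj :: "('a \<Rightarrow> 'a) \<Rightarrow> ('a \<Rightarrow> real) \<Rightarrow> 'a \<times> real \<Rightarrow> ('a \<times> real) set" where
  "susp_proj f \<rho> p = {q. equivclp (susp_step f \<rho>) p q}"

definition susp_space :: "('a \<Rightarrow> 'a) \<Rightarrow> ('a \<Rightarrow> real) \<Rightarrow> ('a \<times> real) set set" where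
  "susp_space f \<rho> = susp_proj f \<rho> ` (UNIV \<times> {0..})"

definition susp_open ::
  "('a::topological_space \<Rightarrow> 'a) \<Rightarrow> ('a \<Rightarrow> real) \<Rightarrow> ('a \<times> real) set set \<Rightarrow> bool" where
  "susp_open f \<rho> U \<longleftrightarrow> U \<subseteq> susp_space f \<rho> \<and>
     openin (top_of_set (UNIV \<times> {0..})) {p \<in> UNIV \<times> {0..}. susp_proj f \<rho> p \<in> U}"

definition susp_topology ::
  "('a::topological_space \<Rightarrow> 'a) \<Rightarrow> ('a \<Rightarrow> real) \<Rightarrow> ('a \<times> real) set topology" where
  "susp_topology f \<rho> = topology (susp_open f \<rho>)"

text \<open>
  The union below is over the representatives of the class \<open>c\<close>. All of them give the same class,
  so that for \<open>t \<ge> 0\<close> it is \<open>\<pi> (x, s + t)\<close> for any representative \<open>(x, s)\<close>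
  (see \<open>susp_flow_proj\<close>).
\<close>

definition susp_shift ::
  "('a \<Rightarrow> 'a) \<Rightarrow> ('a \<Rightarrow> real) \<Rightarrow> real \<Rightarrow> ('a \<times> real) set \<Rightarrow> ('a \<times> real) set" where
  "susp_shift f \<rho> t c = (\<Union>(x, s)\<in>c. susp_proj f \<rho> (x, s + t))"

definition susp_flow ::
  "('a \<Rightarrow> 'a) \<Rightarrow> ('a \<Rightarrow> real) \<Rightarrow> real \<Rightarrow> ('a \<times> real) set \<Rightarrow> ('a \<times> real) set" where
  "susp_flow f \<rho> t =
    (if 0 \<le> t then susp_shift f \<rho> t else inv_into (susp_space f \<rho>) (susp_shift f \<rho> (- t)))"


section \<open>Invariant measures and entropy\<close>

definition invariant_prob_measures ::
  "'b topology \<Rightarrow> (real \<Rightarrow> 'b \<Rightarrow> 'b) \<Rightarrow> 'b measure set" where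
  "invariant_prob_measures X g =
    {\<mu>. prob_space \<mu> \<and> space \<mu> = topspace X \<and>
        sets \<mu> = sigma_sets (topspace X) {U. openin X U} \<and>
        (\<forall>t. g t \<in> measurable \<mu> \<mu> \<and> distr \<mu> \<mu> (g t) = \<mu>)}"

definition bowen_ball ::
  "'b set \<Rightarrow> ('b \<Rightarrow> 'b \<Rightarrow> real) \<Rightarrow> (real \<Rightarrow> 'b \<Rightarrow> 'b) \<Rightarrow> real \<Rightarrow> 'b \<Rightarrow> real \<Rightarrow> 'b set" where
  "bowen_ball S d g t x \<epsilon> = {y\<in>S. \<forall>s\<in>{0..<t}. d (g s x) (g s y) < \<epsilon>}"

text \<open>
  Topological entropy of the flow on the whole space:
  \<open>lim\<^bsub>\<epsilon>\<rightarrow>0\<^esub> limsup\<^bsub>t\<rightarrow>\<infinity>\<^esub> (1/t) log N(t, \<epsilon>)\<close>, where \<open>N(t, \<epsilon>)\<close> is the least cardinality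
  of a \<open>(t, \<epsilon>)\<close>-spanning set (finite when the space is compact and the flow continuous).
\<close>

definition spanning_number ::
  "'b set \<Rightarrow> ('b \<Rightarrow> 'b \<Rightarrow> real) \<Rightarrow> (real \<Rightarrow> 'b \<Rightarrow> 'b) \<Rightarrow> real \<Rightarrow> real \<Rightarrow> nat" where
  "spanning_number S d g t \<epsilon> =
    (INF E\<in>{E. finite E \<and> E \<subseteq> S \<and> S \<subseteq> (\<Union>x\<in>E. bowen_ball S d g t x \<epsilon>)}. card E)"

definition flow_entropy ::
  "'b set \<Rightarrow> ('b \<Rightarrow> 'b \<Rightarrow> real) \<Rightarrow> (real \<Rightarrow> 'b \<Rightarrow> 'b) \<Rightarrow> ereal" where
  "flow_entropy S d g =
    Lim (at_right 0) (\<lambda>\<epsilon>. Limsup at_top (\<lambda>t. ereal (ln (real (spanning_number S d g t \<epsilon>)) / t)))"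

text \<open>
  Entropy of a subset \<open>Z\<close> of the space. A countable collection of balls
  \<open>B\<^bsub>t\<^esub>(x, \<epsilon>)\<close> is given by the set \<open>\<Gamma>\<close> of the pairs \<open>(x, t)\<close>. All values are extended:
  infinite sums and infima in \<open>[0, \<infinity>]\<close>, and the infimum of the empty set of exponents
  is \<open>\<infinity>\<close>.
\<close>

definition bowen_covers ::
  "'b set \<Rightarrow> ('b \<Rightarrow> 'b \<Rightarrow> real) \<Rightarrow> (real \<Rightarrow> 'b \<Rightarrow> 'b) \<Rightarrow> 'b set \<Rightarrow> real \<Rightarrow> real \<Rightarrow> ('b \<times> real) set set" where
  "bowen_covers S d g Z \<epsilon> T =
    {\<Gamma>. countable \<Gamma> \<and> \<Gamma> \<subseteq> S \<times> {0<..} \<and> (\<forall>(x, t)\<in>\<Gamma>. T \<le> t) \<and>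
        Z \<subseteq> (\<Union>(x, t)\<in>\<Gamma>. bowen_ball S d g t x \<epsilon>)}"

definition entropy_Q :: "real \<Rightarrow> ('b \<times> real) set \<Rightarrow> ennreal" where
  "entropy_Q \<alpha> \<Gamma> = (\<Sum>\<^sub>\<infinity>(x, t)\<in>\<Gamma>. ennreal (exp (- \<alpha> * t)))"

definition entropy_M ::
  "'b set \<Rightarrow> ('b \<Rightarrow> 'b \<Rightarrow> real) \<Rightarrow> (real \<Rightarrow> 'b \<Rightarrow> 'b) \<Rightarrow> 'b set \<Rightarrow> real \<Rightarrow> real \<Rightarrow> real \<Rightarrow> ennreal" where
  "entropy_M S d g Z \<alpha> \<epsilon> T = (INF \<Gamma>\<in>bowen_covers S d g Z \<epsilon> T. entropy_Q \<alpha> \<Gamma>)"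

definition entropy_m ::
  "'b set \<Rightarrow> ('b \<Rightarrow> 'b \<Rightarrow> real) \<Rightarrow> (real \<Rightarrow> 'b \<Rightarrow> 'b) \<Rightarrow> 'b set \<Rightarrow> real \<Rightarrow> real \<Rightarrow> ennreal" where
  "entropy_m S d g Z \<alpha> \<epsilon> = Lim at_top (\<lambda>T. entropy_M S d g Z \<alpha> \<epsilon> T)"

definition set_entropy_eps ::
  "'b set \<Rightarrow> ('b \<Rightarrow> 'b \<Rightarrow> real) \<Rightarrow> (real \<Rightarrow> 'b \<Rightarrow> 'b) \<Rightarrow> 'b set \<Rightarrow> real \<Rightarrow> ereal" where
  "set_entropy_eps S d g Z \<epsilon> = Inf (ereal ` {\<alpha>. entropy_m S d g Z \<alpha> \<epsilon> = 0})"

definition set_entropy ::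
  "'b set \<Rightarrow> ('b \<Rightarrow> 'b \<Rightarrow> real) \<Rightarrow> (real \<Rightarrow> 'b \<Rightarrow> 'b) \<Rightarrow> 'b set \<Rightarrow> ereal" where
  "set_entropy S d g Z = Lim (at_right 0) (\<lambda>\<epsilon>. set_entropy_eps S d g Z \<epsilon>)"

definition irregular_set :: "'b set \<Rightarrow> (real \<Rightarrow> 'b \<Rightarrow> 'b) \<Rightarrow> ('b \<Rightarrow> real) \<Rightarrow> 'b set" where
  "irregular_set S g \<Phi> =
    {p\<in>S. \<not> (\<exists>L. ((\<lambda>T. (1 / T) * integral {0..T} (\<lambda>t. \<Phi> (g t p))) \<longlongrightarrow> L) at_top)}"


section \<open>Basic facts\<close>

lemma istopology_susp_open: "istopology (susp_open f \<rho>)"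
proof -
  let ?X = "top_of_set (UNIV \<times> {0..})" and ?C = "UNIV \<times> {0..}"
  have "openin ?X {p \<in> ?C. susp_proj f \<rho> p \<in> U \<inter> V}"
    if "openin ?X {p \<in> ?C. susp_proj f \<rho> p \<in> U}" "openin ?X {p \<in> ?C. susp_proj f \<rho> p \<in> V}" for U V
  proof -
    have "{p \<in> ?C. susp_proj f \<rho> p \<in> U \<inter> V} =
      {p \<in> ?C. susp_proj f \<rho> p \<in> U} \<inter> {p \<in> ?C. susp_proj f \<rho> p \<in> V}" by blast
    then show ?thesis using openin_Int[OF that] by simp
  qed
  moreover have "openin ?X {p \<in> ?C. susp_proj f \<rho> p \<in> \<Union>\<K>}"
    if "\<And>K. K \<in> \<K> \<Longrightarrow> openin ?X {p \<in> ?C. susp_proj f \<rho> p \<in> K}" for \<K>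
  proof -
    have "{p \<in> ?C. susp_proj f \<rho> p \<in> \<Union>\<K>} = (\<Union>K\<in>\<K>. {p \<in> ?C. susp_proj f \<rho> p \<in> K})" by blast
    then show ?thesis using that by (metis (no_types, lifting) openin_clauses(3) imageE)
  qed
  ultimately show ?thesis
    unfolding istopology_def susp_open_def by (auto simp: Sup_le_iff)
qed

lemma openin_susp_topology: "openin (susp_topology f \<rho>) U \<longleftrightarrow> susp_open f \<rho> U"
  by (simp add: susp_topology_def istopology_susp_open topology_inverse')

lemma topspace_susp_topology [simp]: "topspace (susp_topology f \<rho>) = susp_space f \<rho>"
proof -
  have "{p \<in> UNIV \<times> {0..}. susp_proj f \<rho> p \<in> susp_space f \<rho>} = UNIV \<times> {0..}"
    by (auto simp: susp_space_def)
  then have "susp_open f \<rho> (susp_space f \<rho>)"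
    unfolding susp_open_def by (metis order_refl openin_topspace topspace_euclidean_subtopology)
  then show ?thesis
    by (metis openin_subset openin_susp_topology openin_topspace subset_antisym susp_open_def)
qed

lemma quotient_map_susp_proj:
  "quotient_map (top_of_set (UNIV \<times> {0..})) (susp_topology f \<rho>) (susp_proj f \<rho>)"
  unfolding quotient_map_def openin_susp_topology topspace_susp_topology susp_open_def
  by (simp add: susp_space_def)

lemma susp_proj_shift_cong:
  assumes "equivclp (susp_step f \<rho>) (x, s) (y, r)" "0 \<le> t"
  shows "susp_proj f \<rho> (x, s + t) = susp_proj f \<rho> (y, r + t)"
proof -
  have step1: "susp_step f \<rho> (fst p, snd p + t) (fst q, snd q + t)" if "susp_step f \<rho> p q" for p q
  proof -
    from that obtain z u where "0 \<le> u" "p = (z, u + \<rho> z)" "q = (f z, u)"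
      unfolding susp_step_def by blast
    then show ?thesis
      unfolding susp_step_def using \<open>0 \<le> t\<close> by (intro exI[of _ z] exI[of _ "u + t"]) simp
  qed
  then have sym_step: "symclp (susp_step f \<rho>) (fst p, snd p + t) (fst q, snd q + t)"
    if "symclp (susp_step f \<rho>) p q" for p q
    using that unfolding symclp_def by blast
  have "equivclp (susp_step f \<rho>) (fst (x, s), snd (x, s) + t) (fst (y, r), snd (y, r) + t)"
    using assms(1) unfolding equivclp_def
  proof (induction rule: rtranclp_induct)
    case base
    show ?case by (rule rtranclp.rtrancl_refl)
  next
    case (step p q)
    show ?case by (rule rtranclp.rtrancl_into_rtrancl[OF step.IH sym_step[OF step.hyps(2)]])
  qed
  then have *: "equivclp (susp_step f \<rho>) (x, s + t) (y, r + t)"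
    by (simp only: fst_conv snd_conv)
  show ?thesis
    unfolding susp_proj_def using equivclp_trans[OF *] equivclp_trans[OF equivclp_sym[OF *]] by blast
qed

lemma susp_flow_proj:
  assumes "0 \<le> t"
  shows "susp_flow f \<rho> t (susp_proj f \<rho> (x, s)) = susp_proj f \<rho> (x, s + t)"
proof -
  have "(x, s) \<in> susp_proj f \<rho> (x, s)"
    by (simp add: susp_proj_def)
  moreover have "susp_proj f \<rho> (y, r + t) = susp_proj f \<rho> (x, s + t)"
    if "(y, r) \<in> susp_proj f \<rho> (x, s)" for y r
    using susp_proj_shift_cong[of f \<rho> x s y r t] that assms by (simp add: susp_proj_def)
  ultimately have "(\<Union>(y, r)\<in>susp_proj f \<rho> (x, s). susp_proj f \<rho> (y, r + t)) = susp_proj f \<rho> (x, s + t)"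
    by blast
  then show ?thesis
    using assms by (simp only: susp_flow_def susp_shift_def if_True)
qed

end

theory Submission
  imports Defs "HOL-Real_Asymp.Real_Asymp"
begin

text \<open>
  The upper bound holds for every subset, because spanning sets are covers. For the lower bound fix
  \<open>\<alpha> < h < h\<^bsub>top\<^esub>(\<Psi>)\<close>. A spanning set of the flow can be built from maximal separated sets of
  base orbits together with a record of the relative drift of the return times, which has
  subexponential complexity; hence there are \<open>(n, \<epsilon>)\<close>-separated sets \<open>E\<close> in the base
  whose roof sums are at most \<open>t\<close> and which have at least \<open>exp (h t)\<close> elements. By the pigeonhole
  principle we may take the Birkhoff sums of \<open>\<phi>(x) = \<integral> \<Phi>(\<pi>(x, s)) ds\<close> (over \<open>0 \<le> s \<le> \<rho>(x)\<close>) and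
  of \<open>\<rho>\<close> to be nearly constant on \<open>E\<close>. Integrating time averages against two invariant measures with
  different integrals of \<open>\<Phi>\<close> gives orbit segments of the same length \<open>n\<close> with two different
  average ratios, and one of them, starting at \<open>c\<close> say, differs from the ratio on \<open>E\<close>. With the specification
  property we shadow all sequences of blocks from \<open>E\<close>, except that every \<open>K\<close>-th block
  is prescribed: it is a fixed \<open>e0 \<in> E\<close> or \<open>c\<close>, alternating over dyadically growing stages. The time
  average then oscillates, while the remaining blocks are free and carry entropy greater than
  \<open>\<alpha>\<close> if \<open>K\<close> is large. A Bowen ball of the flow determines the
  free blocks that are completed in its time span, so it pulls back into a cylinder, and the uniform product
  measure on the sequences of blocks bounds the sums over covers from below. No variational
  principle is needed.
\<close>

section \<open>The suspension space\<close>

definition birkhoff_sum :: "('a \<Rightarrow> 'a) \<Rightarrow> ('a \<Rightarrow> real) \<Rightarrow> nat \<Rightarrow> 'a \<Rightarrow> real" where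
  "birkhoff_sum f g n x = (\<Sum>i<n. g ((f ^^ i) x))"

lemma birkhoff_sum_0 [simp]: "birkhoff_sum f g 0 x = 0"
  by (simp add: birkhoff_sum_def)

lemma birkhoff_sum_Suc: "birkhoff_sum f g (Suc n) x = birkhoff_sum f g n x + g ((f ^^ n) x)"
  by (simp add: birkhoff_sum_def)

lemma birkhoff_sum_1 [simp]: "birkhoff_sum f g (Suc 0) x = g x"
  by (simp add: birkhoff_sum_def)

lemma birkhoff_sum_add:
  "birkhoff_sum f g (m + n) x = birkhoff_sum f g m x + birkhoff_sum f g n ((f ^^ m) x)"
proof (induction n)
  case (Suc n)
  have "(f ^^ n) ((f ^^ m) x) = (f ^^ (m + n)) x"
    by (metis add.commute comp_apply funpow_add)
  with Suc show ?case by (simp add: birkhoff_sum_Suc)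
qed simp

lemma birkhoff_sum_linear:
  "birkhoff_sum f (\<lambda>x. g x - c * h x) n x = birkhoff_sum f g n x - c * birkhoff_sum f h n x"
  by (simp add: birkhoff_sum_def sum_subtractf sum_distrib_left)

lemma birkhoff_sum_diff_le:
  assumes "\<And>i. i < n \<Longrightarrow> \<bar>g ((f ^^ i) x) - g ((f ^^ i) y)\<bar> \<le> e"
  shows "\<bar>birkhoff_sum f g n x - birkhoff_sum f g n y\<bar> \<le> real n * e"
proof -
  have "\<bar>birkhoff_sum f g n x - birkhoff_sum f g n y\<bar>
      \<le> (\<Sum>i<n. \<bar>g ((f ^^ i) x) - g ((f ^^ i) y)\<bar>)"
    unfolding birkhoff_sum_def by (simp flip: sum_subtractf)
  also have "\<dots> \<le> real (card {..<n}) * e"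
    by (rule sum_bounded_above) (use assms in auto)
  finally show ?thesis by simp
qed

lemma birkhoff_sum_bounded:
  assumes "\<And>x. \<bar>g x\<bar> \<le> e"
  shows "\<bar>birkhoff_sum f g n x\<bar> \<le> real n * e"
proof -
  have "\<bar>birkhoff_sum f g n x\<bar> \<le> (\<Sum>i<n. \<bar>g ((f ^^ i) x)\<bar>)"
    unfolding birkhoff_sum_def by simp
  also have "\<dots> \<le> real (card {..<n}) * e"
    by (rule sum_bounded_above) (use assms in auto)
  finally show ?thesis by simp
qed

section \<open>Return times of the suspension flow and canonical representatives of its
  points\<close>

locale suspension =
  fixes f :: "'a::metric_space \<Rightarrow> 'a" and \<rho> :: "'a \<Rightarrow> real"
  assumes compact_base: "compact (UNIV :: 'a set)"
    and cont_f: "continuous_on UNIV f"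
    and cont_roof: "continuous_on UNIV \<rho>"
    and roof_pos: "0 < \<rho> x"
begin

abbreviation "bsum \<equiv> birkhoff_sum f"
abbreviation "proj \<equiv> susp_proj f \<rho>"
abbreviation "S \<equiv> susp_space f \<rho>"
abbreviation "g \<equiv> susp_flow f \<rho>"

definition "rmin = Inf (range \<rho>)"
definition "rmax = Sup (range \<rho>)"

lemma rmin_le: "rmin \<le> \<rho> x" and le_rmax: "\<rho> x \<le> rmax" and rmin_pos: "0 < rmin"
proof -
  have c: "compact (range \<rho>)"
    using compact_continuous_image[OF cont_roof compact_base] .
  then have b: "bdd_below (range \<rho>)" "bdd_above (range \<rho>)"
    by (auto intro: bounded_imp_bdd_below bounded_imp_bdd_above compact_imp_bounded)
  show "rmin \<le> \<rho> x" "\<rho> x \<le> rmax"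
    unfolding rmin_def rmax_def using b by (auto intro: cInf_lower cSup_upper)
  have "Inf (range \<rho>) \<in> range \<rho>"
    using closed_contains_Inf[OF _ b(1)] c compact_imp_closed by blast
  then show "0 < rmin" unfolding rmin_def using roof_pos by auto
qed

lemma rmax_pos: "0 < rmax"
  using rmin_pos rmin_le[of undefined] le_rmax[of undefined] by linarith

lemma rmin_le_rmax: "rmin \<le> rmax"
  using rmin_le[of undefined] le_rmax[of undefined] by linarith

lemma bsum_roof_ge: "real n * rmin \<le> bsum \<rho> n x"
  unfolding birkhoff_sum_def using sum_bounded_below[of "{..<n}" rmin "\<lambda>i. \<rho> ((f ^^ i) x)"]
  by (simp add: rmin_le)

lemma bsum_roof_le: "bsum \<rho> n x \<le> real n * rmax"
  unfolding birkhoff_sum_def using sum_bounded_above[of "{..<n}" "\<lambda>i. \<rho> ((f ^^ i) x)" rmax]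
  by (simp add: le_rmax)

lemma bsum_roof_nonneg: "0 \<le> bsum \<rho> n x"
  using bsum_roof_ge[of n x] rmin_pos by (meson less_eq_real_def mult_nonneg_nonneg of_nat_0_le_iff order_trans)

lemma bsum_roof_strict_mono: "m < n \<Longrightarrow> bsum \<rho> m x < bsum \<rho> n x"
  by (rule lift_Suc_mono_less[of "\<lambda>k. bsum \<rho> k x"]) (auto simp: birkhoff_sum_Suc roof_pos)

lemma bsum_roof_mono: "m \<le> n \<Longrightarrow> bsum \<rho> m x \<le> bsum \<rho> n x"
  using bsum_roof_strict_mono[of m n x] by (cases "m = n") auto

lemma ex_bsum_roof_gt: "\<exists>n. s < bsum \<rho> n x"
proof -
  obtain n where "s < real n * rmin"
    using rmin_pos reals_Archimedean3 by blast
  then show ?thesis using bsum_roof_ge[of n x] by (intro exI[of _ n]) linarith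
qed

text \<open>\<open>k\<close> counts the returns to the base completed by time \<open>s\<close>. It
  is one less than the first index whose roof sum exceeds \<open>s\<close>; that index is positive
  because the empty roof sum is 0.\<close>

lemma ex_return:
  assumes "0 \<le> s"
  obtains k where "bsum \<rho> k x \<le> s" "s < bsum \<rho> (Suc k) x"
proof -
  define n where "n = (LEAST n. s < bsum \<rho> n x)"
  have n: "s < bsum \<rho> n x" unfolding n_def by (rule LeastI_ex[OF ex_bsum_roof_gt])
  then obtain k where k: "n = Suc k" using assms by (cases n) auto
  have "k < (LEAST n. s < bsum \<rho> n x)" using k by (simp flip: n_def)
  then have "\<not> s < bsum \<rho> k x" by (rule not_less_Least)
  then show ?thesis using that[of k] n k by simp
qed

lemma proj_eqI: "equivclp (susp_step f \<rho>) p q \<Longrightarrow> proj p = proj q"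
  unfolding susp_proj_def
  by (rule Collect_cong) (iprover intro: equivclp_trans equivclp_sym)

lemma proj_step: "0 \<le> t \<Longrightarrow> proj (x, t + \<rho> x) = proj (f x, t)"
  by (rule proj_eqI) (auto simp: susp_step_def intro!: r_into_equivclp)

text \<open>The orbit of \<open>proj (x, 0)\<close> meets the base at the times
  \<open>bsum \<rho> k x\<close>, so a height can be reduced by a roof sum, one generating
  identification per return.\<close>

lemma proj_iterate: "bsum \<rho> k x \<le> s \<Longrightarrow> proj (x, s) = proj ((f ^^ k) x, s - bsum \<rho> k x)"
proof (induction k arbitrary: s)
  case (Suc k)
  have "proj (x, s) = proj ((f ^^ k) x, s - bsum \<rho> k x)"
    using Suc bsum_roof_mono[of k "Suc k" x] by auto
  also have "s - bsum \<rho> k x = s - bsum \<rho> (Suc k) x + \<rho> ((f ^^ k) x)"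
    by (simp add: birkhoff_sum_Suc)
  also have "proj ((f ^^ k) x, \<dots>) = proj ((f ^^ Suc k) x, s - bsum \<rho> (Suc k) x)"
    using Suc.prems by (subst proj_step) auto
  finally show ?case .
qed simp

text \<open>The representative in the half-open fundamental domain below the roof. As a relation
  between pairs, its invariance can be checked on one generating step at a time. Forward iterates
  are enough, since a point of nonnegative height gets below the roof by going down.\<close>

definition normal_form :: "'a \<times> real \<Rightarrow> 'a \<times> real \<Rightarrow> bool" where
  "normal_form p q \<longleftrightarrow>
    (\<exists>k. q = ((f ^^ k) (fst p), snd p - bsum \<rho> k (fst p)) \<and> 0 \<le> snd q \<and> snd q < \<rho> (fst q))"

text \<open>Passing from \<open>p\<close> to \<open>p'\<close> lowers the iterate count
  \<open>k\<close> by one. The count cannot be 0 for \<open>p\<close>, whose height is not below the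
  roof.\<close>

lemma normal_form_step:
  assumes "susp_step f \<rho> p p'"
  shows "normal_form p q \<longleftrightarrow> normal_form p' q"
proof -
  obtain x t where t: "0 \<le> t" and p: "p = (x, t + \<rho> x)" "p' = (f x, t)"
    using assms by (auto simp: susp_step_def)
  have s: "(f ^^ Suc k) x = (f ^^ k) (f x)" "bsum \<rho> (Suc k) x = \<rho> x + bsum \<rho> k (f x)" for k
    using birkhoff_sum_add[of f \<rho> 1 k x] by (simp_all add: funpow_swap1)
  have "normal_form p q" if nf: "normal_form p' q"
  proof -
    obtain k where k: "q = ((f ^^ k) (f x), t - bsum \<rho> k (f x))" "0 \<le> snd q" "snd q < \<rho> (fst q)"
      using nf unfolding normal_form_def p by auto
    then show ?thesis unfolding normal_form_def p fst_conv snd_conv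
      by (intro exI[of _ "Suc k"]) (simp add: s del: funpow.simps)
  qed
  moreover have "normal_form p' q" if nf: "normal_form p q"
  proof -
    obtain k where k: "q = ((f ^^ k) x, t + \<rho> x - bsum \<rho> k x)" "0 \<le> snd q" "snd q < \<rho> (fst q)"
      using nf unfolding normal_form_def p by auto
    then obtain j where "k = Suc j" using t by (cases k) auto
    then show ?thesis using k s unfolding normal_form_def p by (auto intro!: exI[of _ j])
  qed
  ultimately show ?thesis by blast
qed

lemma normal_form_equiv:
  "equivclp (susp_step f \<rho>) p p' \<Longrightarrow> normal_form p q \<longleftrightarrow> normal_form p' q"
  unfolding equivclp_def
  by (induction rule: rtranclp_induct) (auto simp: symclp_def dest: normal_form_step)

text \<open>\<open>(x, 0)\<close> is its own normal form, hence also that of \<open>(y, v)\<close>;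
  as \<open>v\<close> lies below the roof of \<open>y\<close>, no return can have been
  subtracted.\<close>

lemma normal_form_base:
  assumes "proj (x, 0) = proj (y, v)" "0 \<le> v" "v < \<rho> y"
  shows "v = 0 \<and> x = y"
proof -
  have "(y, v) \<in> proj (y, v)" by (simp add: susp_proj_def)
  then have "(y, v) \<in> proj (x, 0)" by (simp only: assms(1))
  then have e: "equivclp (susp_step f \<rho>) (x, 0) (y, v)"
    by (simp add: susp_proj_def)
  have "normal_form (x, 0) (x, 0)"
    unfolding normal_form_def by (auto intro!: exI[of _ 0] simp: roof_pos)
  then have "normal_form (y, v) (x, 0)" using normal_form_equiv[OF e] by simp
  then obtain k where k: "x = (f ^^ k) y" "0 = v - bsum \<rho> k y" by (auto simp: normal_form_def)
  then have "k = 0" using assms bsum_roof_mono[of 1 k y] by (cases k) auto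
  then show ?thesis using k by simp
qed

text \<open>Closing the fibre at the top adds one coincidence only, the one given by the gluing of
  the roof.\<close>

lemma proj_eq_base:
  assumes "proj (x, 0) = proj (y, v)" "0 \<le> v" "v \<le> \<rho> y"
  shows "v = 0 \<and> x = y \<or> v = \<rho> y \<and> x = f y"
proof (cases "v < \<rho> y")
  case False
  then have "v = \<rho> y" using assms by simp
  then have "proj (x, 0) = proj (f y, 0)" using assms proj_step[of 0 y] by simp
  then show ?thesis using normal_form_base[of x "f y" 0] roof_pos \<open>v = \<rho> y\<close> by auto
qed (use normal_form_base assms in blast)

lemma proj_in_S [simp]: "0 \<le> s \<Longrightarrow> proj (x, s) \<in> S"
  by (auto simp: susp_space_def)

lemma S_cases:
  assumes "p \<in> S"
  obtains x s where "0 \<le> s" "s \<le> \<rho> x" "p = proj (x, s)"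
proof -
  obtain x s where s: "0 \<le> s" "p = proj (x, s)" using assms by (auto simp: susp_space_def)
  obtain k where k: "bsum \<rho> k x \<le> s" "s < bsum \<rho> (Suc k) x" using ex_return[OF s(1)] .
  show ?thesis
    by (rule that[of "s - bsum \<rho> k x" "(f ^^ k) x"])
      (use k s proj_iterate[OF k(1)] in \<open>auto simp: birkhoff_sum_Suc\<close>)
qed

lemma flow_proj: "0 \<le> t \<Longrightarrow> g t (proj (x, s)) = proj (x, s + t)"
  by (rule susp_flow_proj)

lemma flow_in_S: "0 \<le> t \<Longrightarrow> p \<in> S \<Longrightarrow> g t p \<in> S"
  by (erule S_cases) (simp add: flow_proj)

lemma continuous_on_iterate: "continuous_on UNIV (f ^^ n)"
proof (induction n)
  case (Suc n)
  then show ?case using continuous_on_compose[of UNIV "f ^^ n" f] continuous_on_subset[OF cont_f]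
    by (auto simp: o_def)
qed simp

lemma continuous_map_proj: "continuous_map (top_of_set (UNIV \<times> {0..})) (susp_topology f \<rho>) proj"
  by (rule quotient_imp_continuous_map[OF quotient_map_susp_proj])

lemma uniformly_close:
  assumes "continuous_on UNIV (h :: 'a \<Rightarrow> 'b::metric_space)" "0 < e"
  obtains \<delta> where "0 < \<delta>" "\<And>x y. dist x y < \<delta> \<Longrightarrow> dist (h x) (h y) < e"
  using compact_uniformly_continuous[OF assms(1) compact_base] assms(2)
  unfolding uniformly_continuous_on_def by (metis UNIV_I)

end

section \<open>Compatible metrics: closeness in the suspension against closeness in the base\<close>

locale metric_suspension = suspension f \<rho>
  for f :: "'a::metric_space \<Rightarrow> 'a" and \<rho> +
  fixes d :: "('a \<times> real) set \<Rightarrow> ('a \<times> real) set \<Rightarrow> real"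
  assumes metric_d: "Metric_space (susp_space f \<rho>) d"
    and topology_d: "Metric_space.mtopology (susp_space f \<rho>) d = susp_topology f \<rho>"
begin

interpretation Metric_space "susp_space f \<rho>" d by (rule metric_d)

lemma d_self: "p \<in> S \<Longrightarrow> d p p = 0" by simp

lemma d_sym: "d p q = d q p" by (rule commute)

lemma d_triangle: "p \<in> S \<Longrightarrow> q \<in> S \<Longrightarrow> r \<in> S \<Longrightarrow> d p r \<le> d p q + d q r"
  by (rule triangle)

lemma d_eq_0D: "p \<in> S \<Longrightarrow> q \<in> S \<Longrightarrow> d p q = 0 \<Longrightarrow> p = q" by simp

text \<open>Pulled back to pairs of representatives, the metric becomes a continuous function on a
  subset of a metric type, where compactness arguments apply. This is how compatibility of
  \<open>d\<close> with the quotient topology enters.\<close>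

lemma continuous_on_d_proj:
  "continuous_on ((UNIV \<times> {0..}) \<times> (UNIV \<times> {0..})) (\<lambda>(p, q). d (proj p) (proj q))"
proof -
  let ?T = "top_of_set (UNIV \<times> {0..} :: ('a \<times> real) set)"
  have top: "mtopology_of (metric (S, d)) = susp_topology f \<rho>"
    using topology_d by (simp add: mtopology_of)
  have "continuous_map (prod_topology ?T ?T) euclidean (\<lambda>z. mdist (metric (S, d)) (proj (fst z)) (proj (snd z)))"
    by (intro continuous_map_mdist; unfold top)
      (auto intro!: continuous_map_compose[OF _ continuous_map_proj, unfolded o_def]
        continuous_on_fst continuous_on_snd continuous_on_id simp: continuous_map_fst continuous_map_snd)
  then show ?thesis
    by (simp add: case_prod_unfold subtopology_Times[symmetric] flip: euclidean_product_topology)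
qed

text \<open>Heine-Cantor for the pulled-back metric over heights in \<open>{0..B}\<close>; the pair
  of points is compared with a pair on the diagonal, where the metric vanishes.\<close>

lemma proj_uniformly_close:
  assumes "0 < e"
  obtains \<delta> where "0 < \<delta>" "\<And>x y v w. \<lbrakk>0 \<le> v; v \<le> B; 0 \<le> w; w \<le> B; dist x y < \<delta>; \<bar>v - w\<bar> < \<delta>\<rbrakk>
    \<Longrightarrow> d (proj (x, v)) (proj (y, w)) < e"
proof -
  let ?K = "(UNIV :: 'a set) \<times> {0..B}"
  have K: "compact (?K \<times> ?K)" by (intro compact_Times compact_base compact_Icc)
  have "uniformly_continuous_on (?K \<times> ?K) (\<lambda>(p, q). d (proj p) (proj q))"
    by (rule compact_uniformly_continuous[OF continuous_on_subset[OF continuous_on_d_proj] K]) auto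
  then obtain \<delta> where \<delta>: "0 < \<delta>" "\<And>z z'. \<lbrakk>z \<in> ?K \<times> ?K; z' \<in> ?K \<times> ?K; dist z' z < \<delta>\<rbrakk> \<Longrightarrow>
     dist ((\<lambda>(p, q). d (proj p) (proj q)) z') ((\<lambda>(p, q). d (proj p) (proj q)) z) < e"
    using assms unfolding uniformly_continuous_on_def by metis
  show ?thesis
  proof (rule that[of "\<delta> / 2"])
    fix x y :: 'a and v w :: real
    assume a: "0 \<le> v" "v \<le> B" "0 \<le> w" "w \<le> B" "dist x y < \<delta> / 2" "\<bar>v - w\<bar> < \<delta> / 2"
    have "dist (x, v) (y, w) \<le> dist x y + dist v w"
      using sqrt_sum_squares_le_sum_abs[of "dist x y" "dist v w"] by (simp add: dist_Pair_Pair)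
    then have "dist (x, v) (y, w) < \<delta>" using a by (simp add: dist_real_def)
    then have "dist ((x, v), (y, w)) ((x, v), (x, v)) < \<delta>"
      by (simp add: dist_Pair_Pair[of "(x, v)"] dist_commute)
    from \<delta>(2)[OF _ _ this] a have "\<bar>d (proj (x, v)) (proj (y, w)) - d (proj (x, v)) (proj (x, v))\<bar> < e"
      by (auto simp: dist_real_def)
    then show "d (proj (x, v)) (proj (y, w)) < e" using a d_self[of "proj (x, v)"] by auto
  qed (use \<delta> in simp)
qed

text \<open>A compactness converse to \<open>proj_eq_base\<close>: near-coincidence of a base point
  with a point of a closed fibre happens only near the bottom or near the glued top.\<close>

lemma proj_close_base:
  assumes "0 < \<delta>"
  obtains e where "0 < e" "\<And>x y v. \<lbrakk>0 \<le> v; v \<le> \<rho> y; d (proj (x, 0)) (proj (y, v)) < e\<rbrakk>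
    \<Longrightarrow> dist x y < \<delta> \<and> v < \<delta> \<or> dist x (f y) < \<delta> \<and> \<rho> y - \<delta> < v"
proof -
  let ?D = "UNIV \<times> UNIV \<times> {0..rmax} :: ('a \<times> 'a \<times> real) set"
  \<comment> \<open>\<open>K\<close> consists of the triples that violate both alternatives. It is
    compact and contains no coincidence, so the distance has a positive minimum on it unless it is
    empty.\<close>
  define K where "K = ?D \<inter> {(x, y, v). v \<le> \<rho> y} \<inter> {(x, y, v). \<delta> \<le> max (dist x y) v}
     \<inter> {(x, y, v). \<delta> \<le> max (dist x (f y)) (\<rho> y - v)}"
  have cr: "continuous_on UNIV (\<lambda>z::'a \<times> 'a \<times> real. \<rho> (fst (snd z)))"
    by (rule continuous_on_compose2[OF cont_roof]) (auto intro!: continuous_intros)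
  have cf: "continuous_on UNIV (\<lambda>z::'a \<times> 'a \<times> real. f (fst (snd z)))"
    by (rule continuous_on_compose2[OF cont_f]) (auto intro!: continuous_intros)
  have "compact K"
    unfolding K_def case_prod_unfold
    by (intro compact_Int_closed compact_Times compact_base compact_Icc closed_Collect_le
        continuous_intros cr cf)
  have ct: "continuous_on K (\<lambda>(x, y, v). d (proj (x, 0)) (proj (y, v)))"
    unfolding case_prod_unfold
    by (rule continuous_on_compose2[OF continuous_on_d_proj, of _ "\<lambda>z. ((fst z, 0), (fst (snd z), snd (snd z)))",
          unfolded case_prod_unfold fst_conv snd_conv])
      (auto simp: K_def intro!: continuous_intros)
  have pos: "0 < d (proj (x, 0)) (proj (y, v))" if "(x, y, v) \<in> K" for x y v
  proof -
    have v: "0 \<le> v" "v \<le> \<rho> y" "\<delta> \<le> max (dist x y) v" "\<delta> \<le> max (dist x (f y)) (\<rho> y - v)"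
      using that by (auto simp: K_def)
    have "proj (x, 0) \<noteq> proj (y, v)"
      using proj_eq_base[of x y v] v assms by auto
    then have "d (proj (x, 0)) (proj (y, v)) \<noteq> 0" using d_eq_0D v by fastforce
    then show ?thesis using nonneg[of "proj (x, 0)" "proj (y, v)"] by linarith
  qed
  have "\<exists>e>0. \<forall>(x, y, v)\<in>K. e \<le> d (proj (x, 0)) (proj (y, v))"
  proof (cases "K = {}")
    case False
    obtain z where "z \<in> K" "\<forall>w\<in>K. (\<lambda>(x, y, v). d (proj (x, 0)) (proj (y, v))) z \<le>
        (\<lambda>(x, y, v). d (proj (x, 0)) (proj (y, v))) w"
      using continuous_attains_inf[OF \<open>compact K\<close> False ct] by blast
    then show ?thesis using pos by (cases z) (auto intro!: exI[of _ "(\<lambda>(x, y, v). d (proj (x, 0)) (proj (y, v))) z"])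
  qed (auto intro: exI[of _ 1])
  then obtain e where e: "0 < e" "\<And>x y v. (x, y, v) \<in> K \<Longrightarrow> e \<le> d (proj (x, 0)) (proj (y, v))"
    by blast
  show ?thesis
  proof (rule that[OF e(1)])
    fix x y v assume a: "0 \<le> v" "v \<le> \<rho> y" "d (proj (x, 0)) (proj (y, v)) < e"
    then have "(x, y, v) \<notin> K" using e(2)[of x y v] by auto
    then show "dist x y < \<delta> \<and> v < \<delta> \<or> dist x (f y) < \<delta> \<and> \<rho> y - \<delta> < v"
      using a le_rmax[of y] by (auto simp: K_def)
  qed
qed

text \<open>Closeness of two flow orbits keeps their return times within \<open>\<eta>\<close> of each other, so that the
  drift does not accumulate and the returns can be matched one by one.\<close>
lemma flow_close_imp_base_close:
  assumes "0 < \<delta>"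
  obtains e where "0 < e" "\<And>x y t k. \<lbrakk>\<And>u. 0 \<le> u \<Longrightarrow> u < t \<Longrightarrow> d (proj (x, u)) (proj (y, u)) < e;
      bsum \<rho> k x < t\<rbrakk> \<Longrightarrow> dist ((f ^^ k) x) ((f ^^ k) y) < \<delta>"
proof -
  obtain \<eta>0 where \<eta>0: "0 < \<eta>0" "\<And>x y. dist x y < \<eta>0 \<Longrightarrow> dist (\<rho> x) (\<rho> y) < rmin / 4"
    using uniformly_close[OF cont_roof, of "rmin / 4"] rmin_pos by auto
  \<comment> \<open>The bound \<open>rmin / 4\<close> keeps the bottom and the top alternative
    apart: time lag and roof difference together stay below \<open>rmin / 2\<close>.\<close>
  define \<eta> where "\<eta> = min \<delta> (min \<eta>0 (rmin / 4))"
  have \<eta>: "0 < \<eta>" "\<eta> \<le> \<delta>" "\<eta> \<le> \<eta>0" "\<eta> \<le> rmin / 4" using assms \<eta>0 rmin_pos by (auto simp: \<eta>_def)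
  obtain e where e: "0 < e" "\<And>x y v. \<lbrakk>0 \<le> v; v \<le> \<rho> y; d (proj (x, 0)) (proj (y, v)) < e\<rbrakk>
    \<Longrightarrow> dist x y < \<eta> \<and> v < \<eta> \<or> dist x (f y) < \<eta> \<and> \<rho> y - \<eta> < v"
    using proj_close_base[OF \<eta>(1)] by blast
  have main: "dist ((f ^^ k) x) ((f ^^ k) y) < \<eta> \<and> \<bar>bsum \<rho> k y - bsum \<rho> k x\<bar> < \<eta>"
    if cl: "\<And>u. 0 \<le> u \<Longrightarrow> u < t \<Longrightarrow> d (proj (x, u)) (proj (y, u)) < e" and "bsum \<rho> k x < t"
    for x y t k
    using that(2)
  proof (induction k)
    case 0
    then show ?case using cl[of 0] e(2)[of 0 y x] rmin_le[of y] roof_pos[of y] \<eta> rmin_pos by auto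
  next
    case (Suc k)
    define u where "u = bsum \<rho> (Suc k) x"
    have IH: "dist ((f ^^ k) x) ((f ^^ k) y) < \<eta>" "\<bar>bsum \<rho> k y - bsum \<rho> k x\<bar> < \<eta>"
      using Suc bsum_roof_strict_mono[of k "Suc k" x] by auto
    let ?y = "(f ^^ k) y"
    have "\<bar>\<rho> ((f ^^ k) x) - \<rho> ?y\<bar> < rmin / 4"
      using \<eta>0(2)[of "(f ^^ k) x" ?y] IH \<eta> by (auto simp: dist_real_def)
    moreover have "u = bsum \<rho> k x + \<rho> ((f ^^ k) x)" by (simp add: u_def birkhoff_sum_Suc)
    ultimately have w: "\<bar>u - bsum \<rho> k y - \<rho> ?y\<bar> < rmin / 2"
      using IH(2) \<eta>(4) by linarith
    have px: "proj (x, u) = proj ((f ^^ Suc k) x, 0)"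
      using proj_iterate[of "Suc k" x u] by (simp add: u_def)
    have ry: "rmin \<le> \<rho> ?y" "rmin \<le> \<rho> ((f ^^ Suc k) y)" by (rule rmin_le)+
    have du: "d (proj (x, u)) (proj (y, u)) < e"
      using cl[of u] Suc.prems bsum_roof_nonneg by (simp add: u_def)
    \<comment> \<open>At the time \<open>u\<close> of the next return of \<open>x\<close>, the orbit
      of \<open>y\<close> is either still below its own next return or just past it. In the first
      case its height is at least \<open>rmin / 2\<close>, so it must be near the top; in the second
      it is less than \<open>rmin / 2\<close>, so it must be near the bottom. Either way the new lag
      is below \<open>\<eta>\<close> again.\<close>
    show ?case
    proof (cases "u - bsum \<rho> k y \<le> \<rho> ?y")
      case True
      have "proj (y, u) = proj (?y, u - bsum \<rho> k y)"
        by (rule proj_iterate) (use w ry rmin_pos in linarith)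
      then have "d (proj ((f ^^ Suc k) x, 0)) (proj (?y, u - bsum \<rho> k y)) < e"
        using du px by simp
      moreover have "0 \<le> u - bsum \<rho> k y" "\<not> u - bsum \<rho> k y < \<eta>"
        using w ry rmin_pos \<eta> by linarith+
      ultimately have "dist ((f ^^ Suc k) x) (f ?y) < \<eta> \<and> \<rho> ?y - \<eta> < u - bsum \<rho> k y"
        using e(2)[OF _ True] by blast
      then show ?thesis using True by (auto simp: birkhoff_sum_Suc[of f \<rho> k y] simp flip: u_def)
    next
      case False
      have s: "bsum \<rho> (Suc k) y = bsum \<rho> k y + \<rho> ?y" by (simp add: birkhoff_sum_Suc)
      have le: "bsum \<rho> (Suc k) y \<le> u" "u - bsum \<rho> (Suc k) y < rmin / 2"
        using False w s by auto
      have "proj (y, u) = proj ((f ^^ Suc k) y, u - bsum \<rho> (Suc k) y)"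
        by (rule proj_iterate[OF le(1)])
      then have "d (proj ((f ^^ Suc k) x, 0)) (proj ((f ^^ Suc k) y, u - bsum \<rho> (Suc k) y)) < e"
        using du px by simp
      moreover have "0 \<le> u - bsum \<rho> (Suc k) y" "u - bsum \<rho> (Suc k) y \<le> \<rho> ((f ^^ Suc k) y)"
        "\<not> \<rho> ((f ^^ Suc k) y) - \<eta> < u - bsum \<rho> (Suc k) y"
        using le ry rmin_pos \<eta> by linarith+
      ultimately have "dist ((f ^^ Suc k) x) ((f ^^ Suc k) y) < \<eta> \<and> u - bsum \<rho> (Suc k) y < \<eta>"
        using e(2) by blast
      then show ?thesis using le by (auto simp flip: u_def)
    qed
  qed
  show ?thesis
    by (rule that[OF e(1)]) (use main \<eta>(2) in fastforce)
qed

end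

section \<open>Orbit separation in the base\<close>

lemma abs_floor_diff_le_1:
  fixes x y :: real
  assumes "\<bar>x - y\<bar> \<le> 1"
  shows "\<lfloor>x\<rfloor> - \<lfloor>y\<rfloor> \<in> {-1, 0, 1}"
proof -
  have "\<lfloor>x\<rfloor> \<le> \<lfloor>y\<rfloor> + 1" "\<lfloor>y\<rfloor> \<le> \<lfloor>x\<rfloor> + 1"
    using assms floor_correct[of x] floor_correct[of y] by linarith+
  then show ?thesis by auto
qed

lemma floor_eq_imp_abs_diff_less:
  fixes x y :: real
  assumes "\<lfloor>x / c\<rfloor> = \<lfloor>y / c\<rfloor>" "0 < c"
  shows "\<bar>x - y\<bar> < c"
proof -
  have "\<bar>x / c - y / c\<bar> < 1"
    using floor_correct[of "x / c"] floor_correct[of "y / c"] assms(1) by linarith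
  moreover have "x / c - y / c = (x - y) / c" by (simp add: diff_divide_distrib)
  ultimately show ?thesis using assms(2) by (simp add: abs_divide)
qed

text \<open>Absorbs the number of possible return counts, which is linear in the time, into an
  arbitrarily small exponential rate.\<close>

lemma eventually_linear_le_exp:
  fixes a b \<kappa> :: real
  assumes "0 < \<kappa>"
  shows "eventually (\<lambda>t. a * t + b \<le> exp (\<kappa> * t)) at_top"
proof -
  have "((\<lambda>t. (a * t + b) * exp (- \<kappa> * t)) \<longlongrightarrow> 0) at_top"
    using assms by real_asymp
  then have "eventually (\<lambda>t. (a * t + b) * exp (- \<kappa> * t) < 1) at_top"
    by (rule order_tendstoD) simp
  then show ?thesis
    by eventually_elim (simp add: exp_minus field_simps)
qed

text \<open>\<open>Lim\<close> has a known value only once convergence is proved; monotonicity in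
  the scale gives it, and turns the limits in both entropy definitions into suprema.\<close>

lemma Lim_at_right_antimono:
  fixes F :: "real \<Rightarrow> ereal"
  assumes "\<And>a b. 0 < a \<Longrightarrow> a \<le> b \<Longrightarrow> F b \<le> F a"
  shows "Lim (at_right 0) F = (SUP e\<in>{0<..}. F e)"
proof (rule tendsto_Lim)
  show "(F \<longlongrightarrow> (SUP e\<in>{0<..}. F e)) (at_right 0)"
  proof (rule order_tendstoI)
    fix a assume "a < (SUP e\<in>{0<..}. F e)"
    then obtain e where "0 < e" "a < F e" by (auto simp: less_SUP_iff)
    then show "eventually (\<lambda>x. a < F x) (at_right 0)"
      unfolding eventually_at_right_field using assms by (intro exI[of _ e]) (auto intro: less_le_trans)
  next
    fix a assume "(SUP e\<in>{0<..}. F e) < a"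
    moreover have "F x \<le> (SUP e\<in>{0<..}. F e)" if "0 < x" for x using that by (intro SUP_upper) auto
    ultimately show "eventually (\<lambda>x. F x < a) (at_right 0)"
      unfolding eventually_at_right_field by (intro exI[of _ 1]) (auto intro: le_less_trans)
  qed
qed simp

section \<open>Separated orbit segments of the base map and return counts\<close>

context suspension
begin

definition separated :: "nat \<Rightarrow> real \<Rightarrow> 'a set \<Rightarrow> bool" where
  "separated n e E \<longleftrightarrow>
    (\<forall>x\<in>E. \<forall>y\<in>E. x \<noteq> y \<longrightarrow> (\<exists>k<n. e \<le> dist ((f ^^ k) x) ((f ^^ k) y)))"

lemma ex_close_orbits:
  assumes "0 < e"
  shows "\<exists>\<delta>>0. \<forall>x y. dist x y < \<delta> \<longrightarrow> (\<forall>k<n. dist ((f ^^ k) x) ((f ^^ k) y) < e)"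
proof (induction n)
  case (Suc n)
  then obtain \<delta> where \<delta>: "0 < \<delta>" "\<And>x y k. dist x y < \<delta> \<Longrightarrow> k < n \<Longrightarrow> dist ((f ^^ k) x) ((f ^^ k) y) < e"
    by blast
  obtain \<delta>' where \<delta>': "0 < \<delta>'" "\<And>x y. dist x y < \<delta>' \<Longrightarrow> dist ((f ^^ n) x) ((f ^^ n) y) < e"
    using uniformly_close[OF continuous_on_iterate assms] by blast
  show ?case
    by (intro exI[of _ "min \<delta> \<delta>'"]) (use \<delta> \<delta>' in \<open>auto simp: less_Suc_eq\<close>)
qed (auto intro: exI[of _ 1])

text \<open>Points in one small ball stay close for \<open>n\<close> steps, so a finite cover by
  such balls bounds the size of separated sets. One of maximal size therefore exists, and every
  point of \<open>A\<close> is shadowed by it, since otherwise it could be enlarged.\<close>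

lemma ex_maximal_separated:
  assumes "0 < e"
  obtains E where "E \<subseteq> A" "finite E" "separated n e E"
    "\<And>x. x \<in> A \<Longrightarrow> \<exists>y\<in>E. \<forall>k<n. dist ((f ^^ k) x) ((f ^^ k) y) < e"
proof -
  obtain \<delta> where \<delta>: "0 < \<delta>" "\<And>x y k. dist x y < \<delta> \<Longrightarrow> k < n \<Longrightarrow> dist ((f ^^ k) x) ((f ^^ k) y) < e / 2"
    using ex_close_orbits[of "e / 2" n] assms by auto
  have "\<exists>C::'a set. finite C \<and> C \<subseteq> UNIV \<and> UNIV \<subseteq> (\<Union>c\<in>C. ball c \<delta>)"
    using compact_base \<delta>(1) unfolding compact_eq_totally_bounded by blast
  then obtain C :: "'a set" where C: "finite C" "UNIV \<subseteq> (\<Union>c\<in>C. ball c \<delta>)" by blast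
  have bound: "finite E \<and> card E \<le> card C" if "separated n e E" for E
  proof -
    have "\<forall>x. \<exists>c. c \<in> C \<and> x \<in> ball c \<delta>" using C(2) by blast
    then obtain c where c: "\<And>x. c x \<in> C" "\<And>x. x \<in> ball (c x) \<delta>" by metis
    have "inj_on c E"
    proof (rule inj_onI, rule ccontr)
      fix x y assume xy: "x \<in> E" "y \<in> E" "c x = c y" "x \<noteq> y"
      then obtain k where k: "k < n" "e \<le> dist ((f ^^ k) x) ((f ^^ k) y)"
        using \<open>separated n e E\<close> by (auto simp: separated_def)
      have "dist ((f ^^ k) (c x)) ((f ^^ k) x) < e / 2" "dist ((f ^^ k) (c x)) ((f ^^ k) y) < e / 2"
        using \<delta>(2)[OF _ k(1)] c(2)[of x] c(2)[of y] xy(3) by auto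
      then show False using k(2) dist_triangle_half_r by fastforce
    qed
    then show ?thesis using c(1) C(1) by (auto intro: inj_on_finite card_inj_on_le)
  qed
  have "\<exists>E. (E \<subseteq> A \<and> separated n e E) \<and> (\<forall>E'. E' \<subseteq> A \<and> separated n e E' \<longrightarrow> card E' \<le> card E)"
    by (rule ex_has_greatest_nat[of _ "{}" _ "Suc (card C)"])
      (use bound in \<open>auto simp: less_Suc_eq_le separated_def[of _ _ "{}"]\<close>)
  then obtain E where E: "E \<subseteq> A" "separated n e E"
      "\<And>E'. E' \<subseteq> A \<Longrightarrow> separated n e E' \<Longrightarrow> card E' \<le> card E"
    by blast
  show ?thesis
  proof (rule that[OF E(1) _ E(2)])
    show "finite E" using bound E by blast
    fix x assume "x \<in> A"
    show "\<exists>y\<in>E. \<forall>k<n. dist ((f ^^ k) x) ((f ^^ k) y) < e"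
    proof (rule ccontr)
      assume no: "\<not> ?thesis"
      have "separated n e (insert x E)"
        using E(2) no unfolding separated_def by (auto simp: not_less) (metis dist_commute)
      then have "card (insert x E) \<le> card E" using E(3) \<open>x \<in> A\<close> E(1) by auto
      moreover have "x \<notin> E" using no assms by auto
      ultimately show False using \<open>finite E\<close> by simp
    qed
  qed
qed

text \<open>The margin \<open>rmax\<close> covers the flow orbits of length \<open>t\<close> that start above the base.\<close>
definition return_at :: "real \<Rightarrow> nat \<Rightarrow> 'a set" where
  "return_at t n = {x. t + rmax \<le> bsum \<rho> n x \<and> (\<forall>m<n. bsum \<rho> m x < t + rmax)}"

lemma ex_return_at: "\<exists>n. x \<in> return_at t n"
proof -
  have ex: "\<exists>n. t + rmax \<le> bsum \<rho> n x" using ex_bsum_roof_gt less_imp_le by blast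
  show ?thesis
    unfolding return_at_def
    using LeastI_ex[OF ex] not_less_Least[of _ "\<lambda>n. t + rmax \<le> bsum \<rho> n x"]
    by (intro exI[of _ "LEAST n. t + rmax \<le> bsum \<rho> n x"]) (auto simp: not_le)
qed

text \<open>The threshold \<open>t + rmax\<close> is overshot by at most one roof value, which gives
  the margin \<open>2 * rmax\<close>.\<close>

lemma return_at_bounds:
  assumes "x \<in> return_at t n" "0 < t"
  shows "bsum \<rho> n x \<le> t + 2 * rmax" "real n * rmin \<le> t + 2 * rmax" "t \<le> real n * rmax"
proof -
  have "n \<noteq> 0" using assms rmax_pos by (auto simp: return_at_def intro!: Nat.gr0I)
  then obtain m where m: "n = Suc m" by (cases n) auto
  show *: "bsum \<rho> n x \<le> t + 2 * rmax"
    using assms le_rmax[of "(f ^^ m) x"] by (auto simp: return_at_def m birkhoff_sum_Suc)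
  show "real n * rmin \<le> t + 2 * rmax" using * bsum_roof_ge[of n x] by linarith
  show "t \<le> real n * rmax" using assms bsum_roof_le[of n x] rmax_pos by (auto simp: return_at_def)
qed

end

section \<open>Spanning sets of the flow built from orbit segments of the base\<close>

context metric_suspension
begin

definition spanning_sets :: "real \<Rightarrow> real \<Rightarrow> ('a \<times> real) set set set" where
  "spanning_sets t \<epsilon> = {E. finite E \<and> E \<subseteq> S \<and> S \<subseteq> (\<Union>x\<in>E. bowen_ball S d g t x \<epsilon>)}"

lemma spanning_number_le: "E \<in> spanning_sets t \<epsilon> \<Longrightarrow> spanning_number S d g t \<epsilon> \<le> card E"
  unfolding spanning_number_def spanning_sets_def by (rule cINF_lower) auto

text \<open>A finite coding whose classes have small Bowen diameter yields a spanning set, by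
  choosing one representative from each class that occurs.\<close>

lemma spanning_set_of_classes:
  assumes "finite F" "\<And>x s. \<lbrakk>0 \<le> s; s \<le> \<rho> x\<rbrakk> \<Longrightarrow> cls (x, s) \<in> F"
    and "\<And>x s y r. \<lbrakk>0 \<le> s; s \<le> \<rho> x; 0 \<le> r; r \<le> \<rho> y; cls (x, s) = cls (y, r)\<rbrakk>
      \<Longrightarrow> proj (y, r) \<in> bowen_ball S d g t (proj (x, s)) \<epsilon>"
  obtains E where "E \<in> spanning_sets t \<epsilon>" "card E \<le> card F"
proof -
  define D where "D = {(x, s). 0 \<le> s \<and> s \<le> \<rho> x}"
  define rep where "rep = inv_into D cls"
  define E where "E = (\<lambda>c. proj (rep c)) ` cls ` D"
  have sub: "cls ` D \<subseteq> F" using assms(2) by (auto simp: D_def)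
  then have fin: "finite (cls ` D)" using assms(1) finite_subset by blast
  have rep: "rep (cls p) \<in> D" "cls (rep (cls p)) = cls p" if "p \<in> D" for p
    unfolding rep_def using that by (auto intro: inv_into_into f_inv_into_f)
  show ?thesis
  proof (rule that)
    show "card E \<le> card F"
      unfolding E_def using card_image_le[OF fin] card_mono[OF assms(1) sub] le_trans by blast
    have "E \<subseteq> S"
    proof
      fix q assume "q \<in> E"
      then obtain p where "p \<in> D" "q = proj (rep (cls p))" by (auto simp: E_def)
      then show "q \<in> S" using rep(1)[of p] by (auto simp: D_def)
    qed
    moreover have "S \<subseteq> (\<Union>x\<in>E. bowen_ball S d g t x \<epsilon>)"
    proof
      fix q assume "q \<in> S"
      then obtain y r where yr: "0 \<le> r" "r \<le> \<rho> y" "q = proj (y, r)" by (rule S_cases)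
      then have p: "(y, r) \<in> D" by (auto simp: D_def)
      obtain x s where xs: "rep (cls (y, r)) = (x, s)" by (cases "rep (cls (y, r))")
      have "proj (y, r) \<in> bowen_ball S d g t (proj (x, s)) \<epsilon>"
        by (rule assms(3)) (use rep[OF p] xs yr in \<open>auto simp: D_def\<close>)
      moreover have "proj (x, s) \<in> E" unfolding E_def using p xs by (metis imageI)
      ultimately show "q \<in> (\<Union>x\<in>E. bowen_ball S d g t x \<epsilon>)" using yr by blast
    qed
    ultimately show "E \<in> spanning_sets t \<epsilon>" unfolding spanning_sets_def using fin by (auto simp: E_def)
  qed
qed

text \<open>Two base orbits that stay close may drift apart in time. The drift is recorded, in units of
  \<open>\<tau>\<close>, once every \<open>L\<close> returns; it changes by at most one unit in between, which accounts for the
  factor \<open>3 ^ _\<close>.\<close>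
lemma spanning_set_bound:
  assumes "0 < \<epsilon>" "0 < L"
  obtains e0 H where "0 < e0" "0 < H"
    "\<And>t E. \<lbrakk>0 < t; \<And>n. finite (E n);
       \<And>n x. x \<in> return_at t n \<Longrightarrow> \<exists>y\<in>E n. \<forall>k<n. dist ((f ^^ k) x) ((f ^^ k) y) < e0\<rbrakk>
     \<Longrightarrow> \<exists>C\<in>spanning_sets t \<epsilon>. card C \<le>
          (\<Sum>n\<le>nat \<lfloor>(t + 2 * rmax) / rmin\<rfloor>. card (E n)) * H * 3 ^ (nat \<lfloor>(t + 2 * rmax) / rmin\<rfloor> div L + 1)"
proof -
  \<comment> \<open>Heights up to \<open>3 * rmax\<close> suffice: below, one return is left out, so
    heights reach \<open>2 * rmax\<close> plus a lag below \<open>rmin\<close>.\<close>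
  obtain \<delta> where \<delta>: "0 < \<delta>" "\<And>x y v w. \<lbrakk>0 \<le> v; v \<le> 3 * rmax; 0 \<le> w; w \<le> 3 * rmax; dist x y < \<delta>; \<bar>v - w\<bar> < \<delta>\<rbrakk>
    \<Longrightarrow> d (proj (x, v)) (proj (y, w)) < \<epsilon>"
    using proj_uniformly_close[OF assms(1), of "3 * rmax"] by blast
  \<comment> \<open>The total lag will be below \<open>4 * \<tau>\<close>: \<open>3 * \<tau>\<close>
    from the roof sums and \<open>\<tau>\<close> from the starting heights.\<close>
  define \<tau> where "\<tau> = min \<delta> rmin / 5"
  have \<tau>: "0 < \<tau>" "4 * \<tau> < \<delta>" "4 * \<tau> < rmin" using \<delta>(1) rmin_pos by (auto simp: \<tau>_def)
  \<comment> \<open>Each return changes the drift by less than \<open>\<tau> / L\<close>, hence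
    \<open>L\<close> returns by at most \<open>\<tau>\<close>.\<close>
  obtain e1 where e1: "0 < e1" "\<And>x y. dist x y < e1 \<Longrightarrow> dist (\<rho> x) (\<rho> y) < \<tau> / L"
    using uniformly_close[OF cont_roof, of "\<tau> / L"] \<tau>(1) assms(2) by auto
  define e0 where "e0 = min (\<delta> / 2) e1"
  have e0: "0 < e0" "2 * e0 \<le> \<delta>" "e0 \<le> e1" using \<delta> e1 by (auto simp: e0_def)
  define H where "H = card {0..\<lfloor>rmax / \<tau>\<rfloor>}"
  have "0 < H" using rmax_pos \<tau>(1) by (auto simp: H_def zero_le_floor intro!: add_nonneg_pos)
  show ?thesis
  proof (rule that[OF e0(1) \<open>0 < H\<close>])
    fix t :: real and E :: "nat \<Rightarrow> 'a set"
    assume t: "0 < t" and fin: "\<And>n. finite (E n)"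
      and span: "\<And>n x. x \<in> return_at t n \<Longrightarrow> \<exists>y\<in>E n. \<forall>k<n. dist ((f ^^ k) x) ((f ^^ k) y) < e0"
    define N where "N = nat \<lfloor>(t + 2 * rmax) / rmin\<rfloor>"
    define Q where "Q = N div L + 1"
    define nn where "nn x = (SOME n. x \<in> return_at t n)" for x
    have nn: "x \<in> return_at t (nn x)" for x
      unfolding nn_def by (rule someI_ex[OF ex_return_at])
    obtain ee where ee: "\<And>x. ee x \<in> E (nn x)"
        "\<And>x k. k < nn x \<Longrightarrow> dist ((f ^^ k) x) ((f ^^ k) (ee x)) < e0"
      using span[OF nn] by metis
    have nN: "nn x \<le> N" for x
      using return_at_bounds(2)[OF nn t, of x] rmin_pos by (simp add: N_def le_nat_floor pos_le_divide_eq)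
    define drift where "drift x k = bsum \<rho> k x - bsum \<rho> k (ee x)" for x k
    \<comment> \<open>The index is capped at \<open>nn x\<close> because the orbit of
      \<open>ee x\<close> is known to be close only up to that count.\<close>
    define D where "D x i = \<lfloor>drift x (min (i * L) (nn x)) / \<tau>\<rfloor>" for x i
    have drift_step: "\<bar>drift x b - drift x a\<bar> \<le> \<tau>" if "a \<le> b" "b \<le> a + L" "b \<le> nn x" for x a b
    proof -
      have ba: "b = a + (b - a)" using that by simp
      have "\<bar>bsum \<rho> (b - a) ((f ^^ a) x) - bsum \<rho> (b - a) ((f ^^ a) (ee x))\<bar> \<le> real (b - a) * (\<tau> / L)"
      proof (rule birkhoff_sum_diff_le)
        fix i assume "i < b - a"
        then have "dist ((f ^^ (i + a)) x) ((f ^^ (i + a)) (ee x)) < e1"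
          using ee(2)[of "i + a" x] that(3) e0(3) by force
        from e1(2)[OF this] show "\<bar>\<rho> ((f ^^ i) ((f ^^ a) x)) - \<rho> ((f ^^ i) ((f ^^ a) (ee x)))\<bar> \<le> \<tau> / L"
          by (simp add: dist_real_def funpow_add)
      qed
      also have "\<dots> \<le> real L * (\<tau> / L)"
        using that \<tau> by (intro mult_right_mono) auto
      finally have "\<bar>bsum \<rho> (b - a) ((f ^^ a) x) - bsum \<rho> (b - a) ((f ^^ a) (ee x))\<bar> \<le> \<tau>"
        using assms(2) by simp
      moreover have "drift x b - drift x a = bsum \<rho> (b - a) ((f ^^ a) x) - bsum \<rho> (b - a) ((f ^^ a) (ee x))"
        unfolding drift_def
        using birkhoff_sum_add[of f \<rho> a "b - a" x] birkhoff_sum_add[of f \<rho> a "b - a" "ee x"] ba by simp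
      ultimately show ?thesis by simp
    qed
    have D_step: "D x (Suc i) - D x i \<in> {-1, 0, 1}" for x i
    proof -
      have "\<bar>drift x (min (Suc i * L) (nn x)) - drift x (min (i * L) (nn x))\<bar> \<le> \<tau>"
        by (rule drift_step) auto
      then have "\<bar>drift x (min (Suc i * L) (nn x)) / \<tau> - drift x (min (i * L) (nn x)) / \<tau>\<bar> \<le> 1"
        using \<tau>(1) by (simp flip: diff_divide_distrib add: abs_divide)
      then show ?thesis unfolding D_def by (rule abs_floor_diff_le_1)
    qed
    have D_0: "D x 0 = 0" for x by (simp add: D_def drift_def)
    define pat where "pat x = restrict (\<lambda>i. D x (Suc i) - D x i) {..<Q}" for x
    define cls where "cls = (\<lambda>(x, s). ((nn x, ee x), \<lfloor>s / \<tau>\<rfloor>, pat x))"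
    \<comment> \<open>The codes: return count with shadowing point, height cell, and the sequence of
      changes of the recorded drift.\<close>
    define F where "F = (SIGMA n:{..N}. E n) \<times> {0..\<lfloor>rmax / \<tau>\<rfloor>} \<times> ({..<Q} \<rightarrow>\<^sub>E {-1, 0, 1::int})"
    have cF: "card F = (\<Sum>n\<le>N. card (E n)) * H * 3 ^ Q"
      using fin by (simp add: F_def card_cartesian_product card_PiE H_def numeral_3_eq_3)
    have "finite F" unfolding F_def using fin by (intro finite_cartesian_product finite_PiE) auto
    moreover have "cls (x, s) \<in> F" if "0 \<le> s" "s \<le> \<rho> x" for x s
    proof -
      have "s / \<tau> \<le> rmax / \<tau>" using that le_rmax[of x] \<tau>(1) by (intro divide_right_mono) auto
      then have "\<lfloor>s / \<tau>\<rfloor> \<le> \<lfloor>rmax / \<tau>\<rfloor>" by (rule floor_mono)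
      moreover have "0 \<le> \<lfloor>s / \<tau>\<rfloor>" using that \<tau>(1) by simp
      moreover have "pat x \<in> {..<Q} \<rightarrow>\<^sub>E {-1, 0, 1::int}" unfolding pat_def using D_step by auto
      ultimately show ?thesis using nN ee(1) by (simp add: cls_def F_def)
    qed
    moreover have "proj (y, r) \<in> bowen_ball S d g t (proj (x, s)) \<epsilon>"
      if sr: "0 \<le> s" "s \<le> \<rho> x" "0 \<le> r" "r \<le> \<rho> y" and cl: "cls (x, s) = cls (y, r)" for x s y r
    proof -
      have eq: "nn x = nn y" "ee x = ee y" "\<lfloor>s / \<tau>\<rfloor> = \<lfloor>r / \<tau>\<rfloor>" "pat x = pat y"
        using cl by (auto simp: cls_def)
      have sr\<tau>: "\<bar>s - r\<bar> < \<tau>" by (rule floor_eq_imp_abs_diff_less[OF eq(3) \<tau>(1)])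
      have D_eq: "D x i = D y i" if "i \<le> Q" for i
        using that
      proof (induction i)
        case (Suc i)
        have "pat x i = pat y i" using eq by simp
        then show ?case using Suc by (simp add: pat_def)
      qed (simp add: D_0)
      \<comment> \<open>Equal records put the drifts at the last recorded return within
        \<open>\<tau>\<close>, and each of the two drifts changes by at most \<open>\<tau>\<close>
        since then. The common reference orbit \<open>ee x\<close> cancels.\<close>
      have sync: "\<bar>bsum \<rho> k x - bsum \<rho> k y\<bar> < 3 * \<tau>" if k: "k \<le> nn x" for k
      proof -
        define i where "i = k div L"
        have iL: "i * L \<le> k" "k \<le> i * L + L"
          using div_mult_mod_eq[of k L] mod_less_divisor[OF assms(2), of k] unfolding i_def by linarith+
        have "i \<le> Q" unfolding i_def Q_def using k nN[of x] by (meson div_le_mono le_SucI le_trans add_leE trans_le_add1)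
        then have "\<lfloor>drift x (i * L) / \<tau>\<rfloor> = \<lfloor>drift y (i * L) / \<tau>\<rfloor>"
          using D_eq[of i] iL k eq(1) by (simp add: D_def min_absorb1)
        then have "\<bar>drift x (i * L) - drift y (i * L)\<bar> < \<tau>"
          by (rule floor_eq_imp_abs_diff_less[OF _ \<tau>(1)])
        moreover have "\<bar>drift x k - drift x (i * L)\<bar> \<le> \<tau>" "\<bar>drift y k - drift y (i * L)\<bar> \<le> \<tau>"
          using drift_step[OF iL] k eq(1) by auto
        moreover have "bsum \<rho> k x - bsum \<rho> k y = drift x k - drift y k"
          using eq by (simp add: drift_def)
        ultimately show ?thesis by linarith
      qed
      have "d (proj (x, s + u)) (proj (y, r + u)) < \<epsilon>" if u: "0 \<le> u" "u < t" for u
      proof -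
        obtain k where k: "bsum \<rho> k x \<le> s + u" "s + u < bsum \<rho> (Suc k) x"
          using ex_return[of "s + u" x] sr u by auto
        have "bsum \<rho> k x < t + rmax" using k(1) u sr le_rmax[of x] by linarith
        also have "\<dots> \<le> bsum \<rho> (nn x) x" using nn[of x] by (simp add: return_at_def)
        finally have kn: "k < nn x" using bsum_roof_mono[of "nn x" k x] by force
        \<comment> \<open>One return is left out, because the orbit of \<open>y\<close> may still be below its \<open>k\<close>-th return.\<close>
        define j where "j = k - 1"
        have jn: "j < nn x" "j \<le> k" using kn by (auto simp: j_def)
        have jx: "bsum \<rho> j x \<le> s + u" using k(1) bsum_roof_mono[OF jn(2), of x] by linarith
        have sj: "\<bar>bsum \<rho> j x - bsum \<rho> j y\<bar> < 3 * \<tau>" using sync jn by simp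
        have jy: "bsum \<rho> j y \<le> r + u"
        proof (cases k)
          case 0
          then show ?thesis using sr u by (simp add: j_def)
        next
          case (Suc m)
          then have "bsum \<rho> k x = bsum \<rho> j x + \<rho> ((f ^^ j) x)" by (simp add: j_def birkhoff_sum_Suc)
          then show ?thesis using sj sr\<tau> \<tau> k(1) rmin_le[of "(f ^^ j) x"] by linarith
        qed
        have "bsum \<rho> (Suc k) x \<le> bsum \<rho> j x + 2 * rmax"
        proof (cases k)
          case 0
          then show ?thesis using le_rmax[of x] rmax_pos by (simp add: j_def)
        next
          case (Suc m)
          then show ?thesis using le_rmax[of "(f ^^ m) x"] le_rmax[of "(f ^^ k) x"]
            by (simp add: j_def birkhoff_sum_Suc)
        qed
        then have vx: "s + u - bsum \<rho> j x \<le> 2 * rmax" using k(2) by linarith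
        have vw: "\<bar>(s + u - bsum \<rho> j x) - (r + u - bsum \<rho> j y)\<bar> < 4 * \<tau>"
          using sj sr\<tau> by linarith
        have "dist ((f ^^ j) x) ((f ^^ j) y) < \<delta>"
          using ee(2)[of j x] ee(2)[of j y] jn eq e0(2)
            dist_triangle2[of "(f ^^ j) x" "(f ^^ j) y" "(f ^^ j) (ee x)"] by auto
        then have "d (proj ((f ^^ j) x, s + u - bsum \<rho> j x)) (proj ((f ^^ j) y, r + u - bsum \<rho> j y)) < \<epsilon>"
          using \<delta>(2) jx jy vx vw \<tau> rmax_pos rmin_le_rmax by auto
        then show ?thesis using proj_iterate[OF jx] proj_iterate[OF jy] by simp
      qed
      then show ?thesis using sr by (auto simp: bowen_ball_def flow_proj)
    qed
    ultimately obtain C where "C \<in> spanning_sets t \<epsilon>" "card C \<le> card F"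
      by (rule spanning_set_of_classes)
    then show "\<exists>C\<in>spanning_sets t \<epsilon>. card C \<le>
          (\<Sum>n\<le>nat \<lfloor>(t + 2 * rmax) / rmin\<rfloor>. card (E n)) * H * 3 ^ (nat \<lfloor>(t + 2 * rmax) / rmin\<rfloor> div L + 1)"
      unfolding cF unfolding Q_def N_def by blast
  qed
qed


text \<open>Guarantees that the infimum defining \<open>spanning_number\<close> runs over a nonempty
  set and is therefore attained.\<close>

lemma ex_spanning_set:
  assumes "0 < \<epsilon>" "0 < t"
  shows "spanning_sets t \<epsilon> \<noteq> {}"
proof -
  obtain e0 H where e0: "0 < e0" and span: "\<And>t E. \<lbrakk>0 < t; \<And>n. finite (E n);
       \<And>n x. x \<in> return_at t n \<Longrightarrow> \<exists>y\<in>E n. \<forall>k<n. dist ((f ^^ k) x) ((f ^^ k) y) < e0\<rbrakk>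
     \<Longrightarrow> \<exists>C\<in>spanning_sets t \<epsilon>. card C \<le>
          (\<Sum>n\<le>nat \<lfloor>(t + 2 * rmax) / rmin\<rfloor>. card (E n)) * H * 3 ^ (nat \<lfloor>(t + 2 * rmax) / rmin\<rfloor> div 1 + 1)"
    by (rule spanning_set_bound[OF assms(1), of 1]) auto
  have "\<forall>n. \<exists>E. finite E \<and> (\<forall>x\<in>return_at t n. \<exists>y\<in>E. \<forall>k<n. dist ((f ^^ k) x) ((f ^^ k) y) < e0)"
    using ex_maximal_separated[OF e0] by metis
  then obtain E where "\<And>n. finite (E n)"
      "\<And>n x. x \<in> return_at t n \<Longrightarrow> \<exists>y\<in>E n. \<forall>k<n. dist ((f ^^ k) x) ((f ^^ k) y) < e0"
    by metis
  from span[OF assms(2) this] show ?thesis by blast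
qed

lemma ex_minimal_spanning_set:
  assumes "0 < \<epsilon>" "0 < t"
  obtains E where "E \<in> spanning_sets t \<epsilon>" "card E = spanning_number S d g t \<epsilon>"
proof -
  have "Inf (card ` spanning_sets t \<epsilon>) \<in> card ` spanning_sets t \<epsilon>"
    by (rule Inf_nat_def1) (use ex_spanning_set[OF assms] in simp)
  then obtain E where "E \<in> spanning_sets t \<epsilon>" "card E = Inf (card ` spanning_sets t \<epsilon>)" by force
  then show ?thesis using that unfolding spanning_number_def spanning_sets_def by simp
qed

lemma spanning_number_pos:
  assumes "0 < \<epsilon>" "0 < t"
  shows "1 \<le> spanning_number S d g t \<epsilon>"
proof -
  obtain E where E: "E \<in> spanning_sets t \<epsilon>" "card E = spanning_number S d g t \<epsilon>"
    by (rule ex_minimal_spanning_set[OF assms])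
  have "E \<noteq> {}" using E(1) proj_in_S[of 0] by (fastforce simp: spanning_sets_def)
  then have "0 < card E" using E(1) by (simp add: spanning_sets_def card_gt_0_iff)
  then show ?thesis using E(2) by simp
qed

lemma spanning_number_antimono:
  assumes "0 < \<epsilon>" "\<epsilon> \<le> \<epsilon>'" "0 < t"
  shows "spanning_number S d g t \<epsilon>' \<le> spanning_number S d g t \<epsilon>"
proof -
  obtain E where E: "E \<in> spanning_sets t \<epsilon>" "card E = spanning_number S d g t \<epsilon>"
    by (rule ex_minimal_spanning_set[OF assms(1,3)])
  have "bowen_ball S d g t x \<epsilon> \<subseteq> bowen_ball S d g t x \<epsilon>'" for x
    using assms(2) by (fastforce simp: bowen_ball_def)
  then have "E \<in> spanning_sets t \<epsilon>'" using E(1) by (fastforce simp: spanning_sets_def)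
  then show ?thesis using spanning_number_le E(2) by metis
qed

lemma flow_entropy_eq_SUP:
  "flow_entropy S d g =
    (SUP \<epsilon>\<in>{0<..}. Limsup at_top (\<lambda>t. ereal (ln (real (spanning_number S d g t \<epsilon>)) / t)))"
  unfolding flow_entropy_def
proof (rule Lim_at_right_antimono)
  fix a b :: real assume ab: "0 < a" "a \<le> b"
  have "eventually (\<lambda>t. ereal (ln (real (spanning_number S d g t b)) / t)
      \<le> ereal (ln (real (spanning_number S d g t a)) / t)) at_top"
    using eventually_gt_at_top[of 0]
  proof eventually_elim
    case (elim t)
    then show ?case using spanning_number_antimono[OF ab elim] spanning_number_pos[of b t] ab
      by (auto intro!: divide_right_mono)
  qed
  then show "Limsup at_top (\<lambda>t. ereal (ln (real (spanning_number S d g t b)) / t))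
      \<le> Limsup at_top (\<lambda>t. ereal (ln (real (spanning_number S d g t a)) / t))"
    by (rule Limsup_mono)
qed

text \<open>If the maximal separated sets for all large return counts were small,
  \<open>spanning_set_bound\<close> would make the spanning number grow more slowly than the entropy
  permits.\<close>

lemma ex_many_separated_orbits:
  assumes "ereal h < flow_entropy S d g"
  obtains e0 where "0 < e0" "\<And>N0. \<exists>n\<ge>N0. \<exists>E t. finite E \<and> separated n e0 E \<and>
     (\<forall>x\<in>E. bsum \<rho> n x \<le> t) \<and> exp (h * t) \<le> real (card E)"
proof -
  obtain h1 where h1: "ereal h < ereal h1" "ereal h1 < flow_entropy S d g"
    using assms ereal_dense2 by blast
  then obtain \<epsilon> where \<epsilon>: "0 < \<epsilon>"
      "ereal h1 < Limsup at_top (\<lambda>t. ereal (ln (real (spanning_number S d g t \<epsilon>)) / t))"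
    unfolding flow_entropy_eq_SUP less_SUP_iff by auto
  have freq: "\<exists>t>T. exp (h1 * t) < real (spanning_number S d g t \<epsilon>)" for T
  proof (rule ccontr)
    assume no: "\<not> ?thesis"
    have "eventually (\<lambda>t. ereal (ln (real (spanning_number S d g t \<epsilon>)) / t) \<le> ereal h1) at_top"
      using eventually_gt_at_top[of "max 0 T"]
    proof eventually_elim
      case (elim t)
      then have "real (spanning_number S d g t \<epsilon>) \<le> exp (h1 * t)"
        using no by (meson max_less_iff_conj not_le)
      moreover have "0 < real (spanning_number S d g t \<epsilon>)"
        using spanning_number_pos[OF \<epsilon>(1), of t] elim by simp
      ultimately have "ln (real (spanning_number S d g t \<epsilon>)) \<le> h1 * t"
        by (metis exp_gt_zero ln_exp ln_le_cancel_iff)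
      then show ?case using elim by (simp add: divide_le_eq)
    qed
    then have "Limsup at_top (\<lambda>t. ereal (ln (real (spanning_number S d g t \<epsilon>)) / t)) \<le> ereal h1"
      by (rule Limsup_bounded)
    then show False using \<epsilon>(2) by simp
  qed
  \<comment> \<open>The gap \<open>h1 - h\<close> is spent in two halves: one for the linear factor
    and the constants, one for the drift records.\<close>
  define \<kappa> where "\<kappa> = (h1 - h) / 2"
  have \<kappa>: "0 < \<kappa>" using h1 by (simp add: \<kappa>_def)
  \<comment> \<open>With drift recorded this rarely, the factor \<open>3 ^ (N div L)\<close> costs
    at most the rate \<open>\<kappa>\<close>.\<close>
  obtain L where L: "ln 3 / (rmin * \<kappa>) < real L" using reals_Archimedean2 by blast
  have "0 < ln 3 / (rmin * \<kappa>)" using \<kappa> rmin_pos by simp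
  then have L0: "0 < L" using L by (cases L) auto
  have L\<kappa>: "ln 3 / L \<le> rmin * \<kappa>" using L L0 rmin_pos \<kappa> by (simp add: field_simps)
  obtain e0 H where e0: "0 < e0" and H: "0 < H" and span: "\<And>t E. \<lbrakk>0 < t; \<And>n. finite (E n);
       \<And>n x. x \<in> return_at t n \<Longrightarrow> \<exists>y\<in>E n. \<forall>k<n. dist ((f ^^ k) x) ((f ^^ k) y) < e0\<rbrakk>
     \<Longrightarrow> \<exists>C\<in>spanning_sets t \<epsilon>. card C \<le>
          (\<Sum>n\<le>nat \<lfloor>(t + 2 * rmax) / rmin\<rfloor>. card (E n)) * H * 3 ^ (nat \<lfloor>(t + 2 * rmax) / rmin\<rfloor> div L + 1)"
    using spanning_set_bound[OF \<epsilon>(1) L0] by blast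
  show ?thesis
  proof (rule that[OF e0])
    fix N0 :: nat
    define K where "K = exp (h * (2 * rmax)) * H * 3 * exp (\<kappa> * (2 * rmax))"
    have "eventually (\<lambda>t. K / rmin * t + K * (2 * rmax / rmin + 1) \<le> exp (\<kappa> * t)) at_top"
      by (rule eventually_linear_le_exp[OF \<kappa>])
    then obtain T where T: "\<And>t. T \<le> t \<Longrightarrow> K / rmin * t + K * (2 * rmax / rmin + 1) \<le> exp (\<kappa> * t)"
      by (auto simp: eventually_at_top_linorder)
    \<comment> \<open>Since \<open>t\<close> exceeds \<open>real N0 * rmax\<close>, fewer than
      \<open>N0\<close> returns cannot fill the time \<open>t\<close>, so the sets with
      \<open>n < N0\<close> are empty.\<close>
    obtain t where t: "max 0 (max T (real N0 * rmax)) < t"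
        and big: "exp (h1 * t) < real (spanning_number S d g t \<epsilon>)"
      using freq by blast
    have t0: "0 < t" using t by simp
    have "\<forall>n. \<exists>E. E \<subseteq> return_at t n \<and> finite E \<and> separated n e0 E \<and>
        (\<forall>x\<in>return_at t n. \<exists>y\<in>E. \<forall>k<n. dist ((f ^^ k) x) ((f ^^ k) y) < e0)"
      using ex_maximal_separated[OF e0] by metis
    then obtain E where E: "\<And>n. E n \<subseteq> return_at t n" "\<And>n. finite (E n)" "\<And>n. separated n e0 (E n)"
        "\<And>n x. x \<in> return_at t n \<Longrightarrow> \<exists>y\<in>E n. \<forall>k<n. dist ((f ^^ k) x) ((f ^^ k) y) < e0"
      by metis
    have "\<exists>n\<ge>N0. exp (h * (t + 2 * rmax)) \<le> real (card (E n))"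
    proof (rule ccontr)
      assume no: "\<not> ?thesis"
      have small: "real (card (E n)) \<le> exp (h * (t + 2 * rmax))" for n
      proof (cases "N0 \<le> n")
        case False
        have "E n = {}"
        proof (rule ccontr)
          assume "E n \<noteq> {}"
          then have "t \<le> real n * rmax" using E(1) return_at_bounds(3)[OF _ t0] by blast
          also have "\<dots> \<le> real N0 * rmax" using False rmax_pos by (intro mult_right_mono) auto
          finally show False using t by simp
        qed
        then show ?thesis by simp
      qed (use no in \<open>meson less_imp_le not_le\<close>)
      define N where "N = nat \<lfloor>(t + 2 * rmax) / rmin\<rfloor>"
      have N: "real N \<le> (t + 2 * rmax) / rmin"
        unfolding N_def using t0 rmax_pos rmin_pos by (intro of_nat_floor) auto
      obtain C where C: "C \<in> spanning_sets t \<epsilon>" "card C \<le> (\<Sum>n\<le>N. card (E n)) * H * 3 ^ (N div L + 1)"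
        using span[OF t0 E(2,4)] unfolding N_def by blast
      have "real (N div L) \<le> real N / L" by (simp add: of_nat_div_le_of_nat)
      then have "ln 3 * real (N div L) \<le> ln 3 * (real N / L)" by (intro mult_left_mono) auto
      also have "\<dots> = ln 3 / L * real N" by simp
      also have "\<dots> \<le> rmin * \<kappa> * ((t + 2 * rmax) / rmin)"
        using L\<kappa> N rmin_pos \<kappa> by (intro mult_mono) auto
      also have "\<dots> = \<kappa> * (t + 2 * rmax)" using rmin_pos by simp
      finally have "exp (ln 3 * real (N div L)) \<le> exp (\<kappa> * (t + 2 * rmax))" by simp
      then have p3: "3 ^ (N div L) \<le> exp (\<kappa> * (t + 2 * rmax))"
        by (simp add: exp_of_nat2_mult)
      have "real (\<Sum>n\<le>N. card (E n)) \<le> real (card {..N}) * exp (h * (t + 2 * rmax))"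
        unfolding of_nat_sum by (rule sum_bounded_above) (rule small)
      also have "\<dots> \<le> ((t + 2 * rmax) / rmin + 1) * exp (h * (t + 2 * rmax))"
        using N by (intro mult_right_mono) auto
      finally have sE: "real (\<Sum>n\<le>N. card (E n)) \<le> ((t + 2 * rmax) / rmin + 1) * exp (h * (t + 2 * rmax))" .
      have "real (spanning_number S d g t \<epsilon>) \<le> real (card C)"
        using spanning_number_le[OF C(1)] by simp
      also have "\<dots> \<le> real ((\<Sum>n\<le>N. card (E n)) * H * 3 ^ (N div L + 1))"
        using C(2) of_nat_le_iff by blast
      also have "\<dots> = real (\<Sum>n\<le>N. card (E n)) * real H * 3 * 3 ^ (N div L)" by simp
      also have "\<dots> \<le> (((t + 2 * rmax) / rmin + 1) * exp (h * (t + 2 * rmax))) * real H * 3 * exp (\<kappa> * (t + 2 * rmax))"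
        using sE p3 t0 rmax_pos rmin_pos by (intro mult_mono) auto
      also have "\<dots> = (K / rmin * t + K * (2 * rmax / rmin + 1)) * exp (h * t) * exp (\<kappa> * t)"
        by (simp add: K_def algebra_simps exp_add add_divide_distrib)
      also have "\<dots> \<le> exp (\<kappa> * t) * exp (h * t) * exp (\<kappa> * t)"
        using T[of t] t by (intro mult_right_mono) auto
      also have "\<dots> = exp (h1 * t)"
        by (simp add: \<kappa>_def field_simps flip: exp_add)
      finally show False using big by simp
    qed
    then obtain n where n: "N0 \<le> n" "exp (h * (t + 2 * rmax)) \<le> real (card (E n))" by blast
    moreover have "\<forall>x\<in>E n. bsum \<rho> n x \<le> t + 2 * rmax" using E(1) return_at_bounds(1)[OF _ t0] by blast
    ultimately show "\<exists>n\<ge>N0. \<exists>E t. finite E \<and> separated n e0 E \<and>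
     (\<forall>x\<in>E. bsum \<rho> n x \<le> t) \<and> exp (h * t) \<le> real (card E)"
      using E(2,3) by blast
  qed
qed

end

section \<open>Time averages along the flow\<close>

locale observed_suspension = suspension f \<rho>
  for f :: "'a::metric_space \<Rightarrow> 'a" and \<rho> +
  fixes \<Phi> :: "('a \<times> real) set \<Rightarrow> real"
  assumes cont_obs: "continuous_map (susp_topology f \<rho>) euclideanreal \<Phi>"
begin

definition \<phi> :: "'a \<Rightarrow> real" where
  "\<phi> x = integral {0..\<rho> x} (\<lambda>s. \<Phi> (proj (x, s)))"

lemma continuous_on_obs: "continuous_on (UNIV \<times> {0..}) (\<lambda>p. \<Phi> (proj p))"
  using continuous_map_compose[OF continuous_map_proj cont_obs] by (simp add: o_def)

lemma continuous_on_obs_fibre: "0 \<le> a \<Longrightarrow> continuous_on {a..b} (\<lambda>t. \<Phi> (proj (x, t)))"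
  by (rule continuous_on_compose2[OF continuous_on_obs]) (auto intro!: continuous_intros)

lemma obs_integrable: "0 \<le> a \<Longrightarrow> (\<lambda>t. \<Phi> (proj (x, t))) integrable_on {a..b}"
  by (rule integrable_continuous_real[OF continuous_on_obs_fibre])

lemma ex_obs_bound: "\<exists>B>0. \<forall>p\<in>S. \<bar>\<Phi> p\<bar> \<le> B"
proof -
  let ?K = "(UNIV :: 'a set) \<times> {0..rmax}"
  have "compact ((\<lambda>p. \<Phi> (proj p)) ` ?K)"
    by (rule compact_continuous_image[OF continuous_on_subset[OF continuous_on_obs]])
      (auto intro!: compact_Times compact_base)
  then obtain B where B: "\<And>p. p \<in> ?K \<Longrightarrow> \<bar>\<Phi> (proj p)\<bar> \<le> B"
    by (metis (no_types, lifting) bounded_real compact_imp_bounded imageI)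
  show ?thesis
  proof (intro exI[of _ "\<bar>B\<bar> + 1"] conjI ballI)
    fix p assume "p \<in> S"
    then obtain x s where "0 \<le> s" "s \<le> \<rho> x" "p = proj (x, s)" by (rule S_cases)
    then show "\<bar>\<Phi> p\<bar> \<le> \<bar>B\<bar> + 1" using B[of "(x, s)"] le_rmax[of x] by auto
  qed simp
qed

definition "obs_bound = (SOME B. 0 < B \<and> (\<forall>p\<in>S. \<bar>\<Phi> p\<bar> \<le> B))"

lemma obs_bound_pos: "0 < obs_bound" and obs_le: "p \<in> S \<Longrightarrow> \<bar>\<Phi> p\<bar> \<le> obs_bound"
proof -
  have "0 < obs_bound \<and> (\<forall>p\<in>S. \<bar>\<Phi> p\<bar> \<le> obs_bound)"
    unfolding obs_bound_def by (rule someI_ex) (rule ex_obs_bound)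
  then show "0 < obs_bound" "p \<in> S \<Longrightarrow> \<bar>\<Phi> p\<bar> \<le> obs_bound" by auto
qed

lemma abs_integral_obs_le:
  assumes "0 \<le> a" "a \<le> b"
  shows "\<bar>integral {a..b} (\<lambda>t. \<Phi> (proj (x, t)))\<bar> \<le> obs_bound * (b - a)"
  using integral_bound[OF assms(2) continuous_on_obs_fibre[OF assms(1)], of x obs_bound] obs_le assms
  by auto

lemma integral_obs_combine:
  assumes "0 \<le> a" "a \<le> b" "b \<le> c"
  shows "integral {a..b} (\<lambda>t. \<Phi> (proj (x, t))) + integral {b..c} (\<lambda>t. \<Phi> (proj (x, t)))
    = integral {a..c} (\<lambda>t. \<Phi> (proj (x, t)))"
  by (rule Henstock_Kurzweil_Integration.integral_combine[OF assms(2,3) obs_integrable[OF assms(1)]])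

lemma integral_obs_return:
  "integral {0..bsum \<rho> k x} (\<lambda>t. \<Phi> (proj (x, t))) = bsum \<phi> k x"
proof (induction k)
  case (Suc k)
  let ?a = "bsum \<rho> k x" and ?y = "(f ^^ k) x"
  have "integral {0..bsum \<rho> (Suc k) x} (\<lambda>t. \<Phi> (proj (x, t)))
      = bsum \<phi> k x + integral {?a..bsum \<rho> (Suc k) x} (\<lambda>t. \<Phi> (proj (x, t)))"
    using integral_obs_combine[of 0 ?a "bsum \<rho> (Suc k) x" x] Suc bsum_roof_nonneg[of k x]
      bsum_roof_mono[of k "Suc k" x] by simp
  also have "{?a..bsum \<rho> (Suc k) x} = {0 + ?a..\<rho> ?y + ?a}" by (simp add: birkhoff_sum_Suc)
  also have "integral \<dots> (\<lambda>t. \<Phi> (proj (x, t))) = integral {0..\<rho> ?y} ((\<lambda>t. \<Phi> (proj (x, t))) \<circ> (+) ?a)"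
    by (rule integral_shift_Icc_real[symmetric])
  also have "\<dots> = \<phi> ?y"
    unfolding \<phi>_def
  proof (rule Henstock_Kurzweil_Integration.integral_cong)
    fix s assume "s \<in> {0..\<rho> ?y}"
    then show "((\<lambda>t. \<Phi> (proj (x, t))) \<circ> (+) ?a) s = \<Phi> (proj (?y, s))"
      using proj_iterate[of k x "?a + s"] by simp
  qed
  finally show ?case by (simp add: birkhoff_sum_Suc)
qed simp

text \<open>Rescaling the fibre to the unit interval removes the variable upper limit, so that
  continuity of integrals with a parameter applies.\<close>

lemma continuous_on_\<phi>: "continuous_on UNIV \<phi>"
proof -
  have "\<phi> x = \<rho> x * integral {0..1} (\<lambda>u. \<Phi> (proj (x, \<rho> x * u)))" for x
  proof -
    have "((\<lambda>t. \<Phi> (proj (x, t))) has_integral \<phi> x) (cbox 0 (\<rho> x))"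
      unfolding \<phi>_def box_real by (rule integrable_integral[OF obs_integrable]) simp
    from has_integral_affinity'[OF this roof_pos[of x], of 0]
    have "((\<lambda>u. \<Phi> (proj (x, \<rho> x * u))) has_integral \<phi> x / \<rho> x) {0..1}"
      using roof_pos[of x] by (simp add: divide_inverse mult.commute)
    then show ?thesis using roof_pos[of x] by (simp add: integral_unique)
  qed
  moreover have "continuous_on UNIV (\<lambda>x. \<rho> x * integral (cbox 0 1) (\<lambda>u. \<Phi> (proj (x, \<rho> x * u))))"
  proof (intro continuous_on_mult cont_roof integral_continuous_on_param)
    have "continuous_on (UNIV \<times> cbox 0 1) (\<lambda>z::'a \<times> real. \<rho> (fst z))"
      by (rule continuous_on_compose2[OF cont_roof]) (auto intro!: continuous_intros)
    then show "continuous_on (UNIV \<times> cbox 0 1) (\<lambda>(x, u). \<Phi> (proj (x, \<rho> x * u)))"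
      unfolding case_prod_unfold
      by (intro continuous_on_compose2[OF continuous_on_obs])
        (auto intro!: continuous_intros mult_nonneg_nonneg less_imp_le[OF roof_pos])
  qed
  ultimately show ?thesis by (simp add: fun_eq_iff[symmetric])
qed

lemma abs_\<phi>_le: "\<bar>\<phi> x\<bar> \<le> obs_bound * rmax"
proof -
  have "\<bar>\<phi> x\<bar> \<le> obs_bound * (\<rho> x - 0)"
    unfolding \<phi>_def by (rule abs_integral_obs_le) (simp_all add: less_imp_le[OF roof_pos])
  also have "\<dots> \<le> obs_bound * rmax" using obs_bound_pos le_rmax[of x] by simp
  finally show ?thesis .
qed

text \<open>Uniform over all times: both times are measured from the last return before
  \<open>v\<close>, which puts their heights into a compact range.\<close>

lemma obs_uniform_in_time:
  assumes "0 < \<eta>"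
  obtains \<tau> where "0 < \<tau>" "\<And>x v w. \<lbrakk>0 \<le> v; v \<le> w; w \<le> v + \<tau>\<rbrakk> \<Longrightarrow> \<bar>\<Phi> (proj (x, w)) - \<Phi> (proj (x, v))\<bar> \<le> \<eta>"
proof -
  let ?K = "(UNIV :: 'a set) \<times> {0..2 * rmax}"
  have "uniformly_continuous_on ?K (\<lambda>p. \<Phi> (proj p))"
    by (rule compact_uniformly_continuous[OF continuous_on_subset[OF continuous_on_obs]])
      (auto intro!: compact_Times compact_base)
  then obtain \<delta> where \<delta>: "0 < \<delta>"
      "\<And>p q. p \<in> ?K \<Longrightarrow> q \<in> ?K \<Longrightarrow> dist q p < \<delta> \<Longrightarrow> dist (\<Phi> (proj q)) (\<Phi> (proj p)) < \<eta>"
    using assms unfolding uniformly_continuous_on_def by metis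
  show ?thesis
  proof (rule that[of "min (\<delta> / 2) rmax"])
    fix x v w assume vw: "0 \<le> v" "v \<le> w" "w \<le> v + min (\<delta> / 2) rmax"
    obtain k where k: "bsum \<rho> k x \<le> v" "v < bsum \<rho> (Suc k) x" using ex_return[OF vw(1)] .
    let ?y = "(f ^^ k) x" and ?v = "v - bsum \<rho> k x" and ?w = "w - bsum \<rho> k x"
    have "?v \<le> rmax" using k le_rmax[of ?y] by (simp add: birkhoff_sum_Suc)
    then have "(?y, ?v) \<in> ?K" "(?y, ?w) \<in> ?K" "dist (?y, ?w) (?y, ?v) < \<delta>"
      using k vw \<delta>(1) rmax_pos by (auto simp: dist_Pair_Pair dist_real_def)
    from \<delta>(2)[OF this] show "\<bar>\<Phi> (proj (x, w)) - \<Phi> (proj (x, v))\<bar> \<le> \<eta>"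
      using proj_iterate[of k x v] proj_iterate[of k x w] k vw by (simp add: dist_real_def)
  qed (use \<delta> rmax_pos in simp)
qed

text \<open>A lower bound on all blocks of \<open>n\<close> returns adds up along any orbit. The
  incomplete block and the incomplete returns at both ends contribute only a constant, uniform in
  the starting point and in \<open>T\<close>.\<close>

lemma time_average_ge:
  assumes "0 < \<delta>" and low: "\<And>x. \<delta> * real n \<le> bsum \<phi> n x - c * bsum \<rho> n x" and "0 < n"
  obtains C where "\<And>x s T. \<lbrakk>0 \<le> s; s \<le> \<rho> x; 0 \<le> T\<rbrakk> \<Longrightarrow>
    (c + \<delta> / rmax) * T - C \<le> integral {s..s + T} (\<lambda>t. \<Phi> (proj (x, t)))"
proof -
  define \<psi> where "\<psi> x = \<phi> x - c * \<rho> x" for x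
  define C0 where "C0 = (obs_bound + \<bar>c\<bar>) * rmax"
  have \<psi>_bsum: "bsum \<psi> k x = bsum \<phi> k x - c * bsum \<rho> k x" for k x
    unfolding \<psi>_def by (rule birkhoff_sum_linear)
  have "\<bar>\<psi> x\<bar> \<le> C0" for x
  proof -
    have "\<bar>c * \<rho> x\<bar> \<le> \<bar>c\<bar> * rmax"
      using le_rmax[of x] roof_pos[of x] by (simp add: abs_mult mult_left_mono)
    then show ?thesis using abs_\<phi>_le[of x] unfolding \<psi>_def C0_def ring_distribs by linarith
  qed
  then have \<psi>_le: "\<bar>bsum \<psi> k x\<bar> \<le> real k * C0" for k x by (rule birkhoff_sum_bounded)
  have C0: "0 \<le> C0" using obs_bound_pos rmax_pos by (simp add: C0_def)
  have growth: "\<delta> * real k - real n * (C0 + \<delta>) \<le> bsum \<psi> k x" for k x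
  proof (induction k arbitrary: x rule: less_induct)
    case (less k)
    show ?case
    proof (cases "k < n")
      case True
      then have "real k * C0 \<le> real n * C0" "\<delta> * real k \<le> \<delta> * real n"
        using C0 assms(1) by (auto intro: mult_right_mono)
      then show ?thesis using \<psi>_le[of k x] by (simp add: algebra_simps)
    next
      case False
      then have "bsum \<psi> k x = bsum \<psi> n x + bsum \<psi> (k - n) ((f ^^ n) x)"
        using birkhoff_sum_add[of f \<psi> n "k - n" x] by simp
      moreover have "\<delta> * real (k - n) - real n * (C0 + \<delta>) \<le> bsum \<psi> (k - n) ((f ^^ n) x)"
        using less[of "k - n"] False assms(3) by simp
      moreover have "\<delta> * real n \<le> bsum \<psi> n x" using low \<psi>_bsum by simp
      ultimately show ?thesis using False by (simp add: of_nat_diff algebra_simps)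
    qed
  qed
  \<comment> \<open>The summands pay for the incomplete block, for the two end integrals, for
    replacing \<open>T\<close> by a roof sum, and for the unfinished last return.\<close>
  define C where "C = real n * (C0 + \<delta>) + 2 * rmax * obs_bound + \<bar>c\<bar> * rmax + \<delta>"
  show ?thesis
  proof (rule that[of C])
    fix x s T assume sT: "0 \<le> s" "s \<le> \<rho> x" "0 \<le> (T::real)"
    let ?F = "\<lambda>t. \<Phi> (proj (x, t))"
    obtain k where k: "bsum \<rho> k x \<le> s + T" "s + T < bsum \<rho> (Suc k) x"
      using ex_return[of "s + T" x] sT by auto
    have sr: "s \<le> rmax" using sT le_rmax[of x] by linarith
    have kr: "s + T - bsum \<rho> k x \<le> rmax" using k(2) le_rmax[of "(f ^^ k) x"] by (simp add: birkhoff_sum_Suc)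
    have "integral {0..s} ?F + integral {s..s + T} ?F = integral {0..s + T} ?F"
      using integral_obs_combine[of 0 s "s + T" x] sT by simp
    moreover have "bsum \<phi> k x + integral {bsum \<rho> k x..s + T} ?F = integral {0..s + T} ?F"
      using integral_obs_combine[of 0 "bsum \<rho> k x" "s + T" x] k(1) bsum_roof_nonneg[of k x]
      by (simp add: integral_obs_return)
    moreover have "\<bar>integral {0..s} ?F\<bar> \<le> obs_bound * rmax"
      using abs_integral_obs_le[OF order_refl sT(1), of x, unfolded diff_zero] mult_left_mono[OF sr less_imp_le[OF obs_bound_pos]]
      by linarith
    moreover have "\<bar>integral {bsum \<rho> k x..s + T} ?F\<bar> \<le> obs_bound * rmax"
      using abs_integral_obs_le[OF bsum_roof_nonneg k(1), of x] mult_left_mono[OF kr less_imp_le[OF obs_bound_pos]]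
      by linarith
    ultimately have I: "bsum \<phi> k x - 2 * (obs_bound * rmax) \<le> integral {s..s + T} ?F"
      by linarith
    have "\<bar>T - bsum \<rho> k x\<bar> \<le> rmax" using k(1) kr sr sT by linarith
    then have "\<bar>c * (T - bsum \<rho> k x)\<bar> \<le> \<bar>c\<bar> * rmax" by (simp add: abs_mult mult_left_mono)
    then have cT: "c * T \<le> c * bsum \<rho> k x + \<bar>c\<bar> * rmax" by (simp add: algebra_simps)
    have "T \<le> (real k + 1) * rmax"
      using k(2) bsum_roof_le[of "Suc k" x] sT by (simp add: add.commute)
    then have "\<delta> / rmax * T \<le> \<delta> / rmax * ((real k + 1) * rmax)"
      using assms(1) rmax_pos by (intro mult_left_mono) auto
    then have "\<delta> / rmax * T \<le> \<delta> * real k + \<delta>"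
      using rmax_pos by (simp add: algebra_simps)
    then show "(c + \<delta> / rmax) * T - C \<le> integral {s..s + T} ?F"
      using I cT growth[of k x] \<psi>_bsum[of k x] unfolding C_def by (simp add: algebra_simps)
  qed
qed

text \<open>If every block of \<open>n\<close> returns were above this bound, all long time averages
  would exceed the space average by a fixed amount, which contradicts invariance after
  integration.\<close>

lemma ex_low_average:
  assumes \<mu>: "\<mu> \<in> invariant_prob_measures (susp_topology f \<rho>) g" and "0 < \<delta>" "0 < n"
  shows "\<exists>x. bsum \<phi> n x \<le> integral\<^sup>L \<mu> \<Phi> * bsum \<rho> n x + \<delta> * real n"
proof (rule ccontr)
  define c where "c = integral\<^sup>L \<mu> \<Phi>"
  assume "\<not> ?thesis"
  then have "\<And>x. \<delta> * real n \<le> bsum \<phi> n x - c * bsum \<rho> n x"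
    unfolding c_def by (smt (verit))
  from time_average_ge[OF assms(2) this assms(3)] obtain C where C:
    "\<And>x s T. \<lbrakk>0 \<le> s; s \<le> \<rho> x; 0 \<le> T\<rbrakk> \<Longrightarrow>
      (c + \<delta> / rmax) * T - C \<le> integral {s..s + T} (\<lambda>t. \<Phi> (proj (x, t)))"
    by metis
  \<comment> \<open>Half of the excess \<open>\<delta> / rmax\<close>: the other half remains as a
    contradiction once the discretisation error is paid.\<close>
  define \<eta> where "\<eta> = \<delta> / (2 * rmax)"
  have \<eta>: "0 < \<eta>" using assms(2) rmax_pos by (simp add: \<eta>_def)
  obtain \<tau> where \<tau>: "0 < \<tau>"
      "\<And>x v w. \<lbrakk>0 \<le> v; v \<le> w; w \<le> v + \<tau>\<rbrakk> \<Longrightarrow> \<bar>\<Phi> (proj (x, w)) - \<Phi> (proj (x, v))\<bar> \<le> \<eta>"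
    using obs_uniform_in_time[OF \<eta>] by metis
  have piece: "integral {v..v + \<tau>} (\<lambda>t. \<Phi> (proj (x, t))) \<le> \<tau> * (\<Phi> (proj (x, v)) + \<eta>)" if "0 \<le> v" for x v
  proof -
    have "integral {v..v + \<tau>} (\<lambda>t. \<Phi> (proj (x, t))) \<le> integral {v..v + \<tau>} (\<lambda>t. \<Phi> (proj (x, v)) + \<eta>)"
    proof (rule integral_le[OF obs_integrable[OF that]])
      fix t assume "t \<in> {v..v + \<tau>}"
      then show "\<Phi> (proj (x, t)) \<le> \<Phi> (proj (x, v)) + \<eta>" using \<tau>(2)[of v t x] that by auto
    qed auto
    then show ?thesis using \<tau>(1) by simp
  qed
  \<comment> \<open>Riemann sums replace the time integral by finitely many flow times, so the
    measure is integrated against a finite sum and neither joint measurability of the flow nor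
    Fubini is involved.\<close>
  have riemann: "integral {s..s + real N * \<tau>} (\<lambda>t. \<Phi> (proj (x, t)))
      \<le> \<tau> * (\<Sum>j<N. \<Phi> (proj (x, s + real j * \<tau>))) + real N * \<tau> * \<eta>" if "0 \<le> s" for x s N
  proof (induction N)
    case (Suc N)
    have "0 \<le> s + real N * \<tau>" using that \<tau>(1) by simp
    from piece[OF this, of x] Suc integral_obs_combine[of s "s + real N * \<tau>" "s + real N * \<tau> + \<tau>" x] that \<tau>(1)
    show ?case by (simp add: algebra_simps)
  qed simp
  have \<mu>': "prob_space \<mu>" "space \<mu> = S" "sets \<mu> = sigma_sets S {U. openin (susp_topology f \<rho>) U}"
      "\<And>t. g t \<in> measurable \<mu> \<mu>" "\<And>t. distr \<mu> \<mu> (g t) = \<mu>"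
    using \<mu> by (auto simp: invariant_prob_measures_def)
  interpret prob_space \<mu> by (rule \<mu>'(1))
  have meas: "\<Phi> \<in> borel_measurable \<mu>"
  proof (rule borel_measurableI)
    fix U :: "real set" assume "open U"
    then have "openin (susp_topology f \<rho>) {p \<in> S. \<Phi> p \<in> U}"
      using openin_continuous_map_preimage[OF cont_obs, of U] by (simp add: topspace_susp_topology)
    moreover have "\<Phi> -` U \<inter> space \<mu> = {p \<in> S. \<Phi> p \<in> U}" using \<mu>'(2) by auto
    ultimately show "\<Phi> -` U \<inter> space \<mu> \<in> sets \<mu>" unfolding \<mu>'(3) by auto
  qed
  have int: "integrable \<mu> \<Phi>"
    by (rule integrable_const_bound[of _ obs_bound]) (use obs_le meas \<mu>'(2) in auto)
  have int_t: "integrable \<mu> (\<lambda>p. \<Phi> (g t p))" "(\<integral>p. \<Phi> (g t p) \<partial>\<mu>) = c" for t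
  proof -
    show "(\<integral>p. \<Phi> (g t p) \<partial>\<mu>) = c"
      unfolding c_def using integral_distr[OF \<mu>'(4)[of t] meas] \<mu>'(5)[of t] by simp
    have "integrable (distr \<mu> \<mu> (g t)) \<Phi>" using int \<mu>'(5) by simp
    then show "integrable \<mu> (\<lambda>p. \<Phi> (g t p))" by (rule integrable_distr[OF \<mu>'(4)])
  qed
  have bound: "\<eta> * (real N * \<tau>) \<le> C" for N
  proof -
    define T where "T = real N * \<tau>"
    have T: "0 \<le> T" using \<tau>(1) by (simp add: T_def)
    have "(c + \<delta> / rmax) * T - C - T * \<eta> = (\<integral>p. (c + \<delta> / rmax) * T - C - T * \<eta> \<partial>\<mu>)"
      using prob_space by simp
    also have "\<dots> \<le> (\<integral>p. \<tau> * (\<Sum>j<N. \<Phi> (g (real j * \<tau>) p)) \<partial>\<mu>)"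
    proof (rule integral_mono)
      fix p assume "p \<in> space \<mu>"
      then obtain x s where xs: "0 \<le> s" "s \<le> \<rho> x" "p = proj (x, s)" using \<mu>'(2) S_cases by metis
      have "\<Phi> (g (real j * \<tau>) p) = \<Phi> (proj (x, s + real j * \<tau>))" for j
        using \<tau>(1) xs(3) by (simp add: flow_proj)
      then show "(c + \<delta> / rmax) * T - C - T * \<eta> \<le> \<tau> * (\<Sum>j<N. \<Phi> (g (real j * \<tau>) p))"
        using C[OF xs(1,2) T] riemann[OF xs(1), of N x] by (simp add: T_def)
    qed (use int_t(1) in auto)
    also have "\<dots> = c * T"
      using int_t by (simp add: T_def)
    finally show ?thesis by (simp add: T_def \<eta>_def field_simps)
  qed
  obtain N where "C < real N * (\<eta> * \<tau>)"
    using reals_Archimedean3[of "\<eta> * \<tau>"] \<eta> \<tau>(1) by auto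
  then show False using bound[of N] by (simp add: algebra_simps)
qed

text \<open>The preceding bound for the negated observable.\<close>

lemma ex_high_average:
  assumes \<mu>: "\<mu> \<in> invariant_prob_measures (susp_topology f \<rho>) g" and "0 < \<delta>" "0 < n"
  shows "\<exists>x. integral\<^sup>L \<mu> \<Phi> * bsum \<rho> n x - \<delta> * real n \<le> bsum \<phi> n x"
proof -
  interpret neg: observed_suspension f \<rho> "\<lambda>p. - \<Phi> p"
    by unfold_locales (use cont_obs in \<open>auto intro: continuous_map_minus\<close>)
  have "neg.\<phi> = (\<lambda>x. - \<phi> x)" by (simp add: neg.\<phi>_def \<phi>_def fun_eq_iff)
  then have "bsum neg.\<phi> n x = - bsum \<phi> n x" for x
    by (simp add: birkhoff_sum_def sum_negf)
  moreover obtain x where "bsum neg.\<phi> n x \<le> (\<integral>p. - \<Phi> p \<partial>\<mu>) * bsum \<rho> n x + \<delta> * real n"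
    using neg.ex_low_average[OF assms] by blast
  ultimately show ?thesis by (intro exI[of _ x]) auto
qed

end

section \<open>Shadowing and oscillating block sums\<close>

lemma birkhoff_sum_mult:
  "birkhoff_sum f h (Q * P) x = (\<Sum>q<Q. birkhoff_sum f h P ((f ^^ (q * P)) x))"
proof (induction Q)
  case (Suc Q)
  have "Suc Q * P = Q * P + P" by simp
  then show ?case by (simp only: birkhoff_sum_add Suc sum.lessThan_Suc)
qed simp

text \<open>A partial sum that is \<open>o(Q)\<close> is also small over dyadic stages, since these make up a fixed
  proportion of \<open>{..<Q}\<close>.\<close>
lemma dyadic_stage_average:
  fixes t :: "nat \<Rightarrow> real"
  assumes lim: "(\<lambda>Q. (\<Sum>q<Q. t q) / real Q) \<longlonglongrightarrow> 0"
    and stages: "\<And>N. \<exists>i\<ge>N. \<forall>q\<in>{2 ^ i..<2 ^ Suc i}. \<bar>t q - u\<bar> \<le> \<kappa>"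
  shows "\<bar>u\<bar> \<le> \<kappa>"
proof (rule field_le_epsilon)
  fix e :: real assume "0 < e"
  \<comment> \<open>The sums up to \<open>A\<close> and up to \<open>2 * A\<close> together cost
    \<open>3 * \<epsilon> * A\<close>.\<close>
  define \<epsilon> where "\<epsilon> = e / 3"
  have \<epsilon>: "0 < \<epsilon>" using \<open>0 < e\<close> by (simp add: \<epsilon>_def)
  obtain N where N: "\<And>Q. N \<le> Q \<Longrightarrow> \<bar>(\<Sum>q<Q. t q) / real Q\<bar> < \<epsilon>"
    using LIMSEQ_D[OF lim \<epsilon>] by auto
  have small: "\<bar>\<Sum>q<Q. t q\<bar> \<le> \<epsilon> * real Q" if "N \<le> Q" for Q
    using N[OF that] by (cases "Q = 0") (auto simp: abs_divide divide_less_eq)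
  obtain i where i: "N \<le> i" "\<And>q. q \<in> {2 ^ i..<2 ^ Suc i} \<Longrightarrow> \<bar>t q - u\<bar> \<le> \<kappa>" using stages by blast
  define A :: nat where "A = 2 ^ i"
  have NA: "N \<le> A" unfolding A_def using i(1) less_exp[of i] by linarith
  have A0: "0 < real A" by (simp add: A_def)
  have A2: "2 ^ Suc i = 2 * A" by (simp add: A_def)
  have "(\<Sum>q<2 * A. t q) = (\<Sum>q<A. t q) + (\<Sum>q\<in>{A..<2 * A}. t q)"
    using sum.atLeastLessThan_concat[of 0 A "2 * A" t] by (simp add: lessThan_atLeast0)
  moreover have "\<bar>(\<Sum>q\<in>{A..<2 * A}. t q) - real A * u\<bar> \<le> real A * \<kappa>"
  proof -
    have "(\<Sum>q\<in>{A..<2 * A}. t q) - real A * u = (\<Sum>q\<in>{A..<2 * A}. t q - u)"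
      by (simp add: sum_subtractf)
    also have "\<bar>\<dots>\<bar> \<le> (\<Sum>q\<in>{A..<2 * A}. \<bar>t q - u\<bar>)" by (rule sum_abs)
    also have "\<dots> \<le> real (card {A..<2 * A}) * \<kappa>"
      by (rule sum_bounded_above) (use i(2) A2 in \<open>simp add: A_def\<close>)
    finally show ?thesis by simp
  qed
  ultimately have "\<bar>real A * u\<bar> \<le> real A * \<kappa> + 3 * \<epsilon> * real A"
    using small[of A] small[of "2 * A"] NA by simp
  then have "real A * \<bar>u\<bar> \<le> real A * (\<kappa> + e)" by (simp add: abs_mult \<epsilon>_def algebra_simps)
  then show "\<bar>u\<bar> \<le> \<kappa> + e" using A0 by (simp only: mult_le_cancel_left_pos)
qed

text \<open>The stages are the dyadic ranges from \<open>2 ^ i\<close> to \<open>2 ^ Suc i\<close>.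
  The index 0 lies in none of them and so counts as not odd.\<close>

definition odd_stage :: "nat \<Rightarrow> bool" where
  "odd_stage q \<longleftrightarrow> (\<exists>i. odd i \<and> 2 ^ i \<le> q \<and> q < 2 ^ Suc i)"

lemma odd_stage_iff:
  assumes "2 ^ i \<le> q" "q < 2 ^ Suc i"
  shows "odd_stage q \<longleftrightarrow> odd i"
proof -
  have "i' = i" if "2 ^ i' \<le> q" "q < 2 ^ Suc i'" for i'
  proof -
    have "i' < Suc i"
      by (rule power_less_imp_less_exp[of "2::nat"]) (use assms that in linarith)+
    moreover have "i < Suc i'"
      by (rule power_less_imp_less_exp[of "2::nat"]) (use assms that in linarith)+
    ultimately show ?thesis by simp
  qed
  then show ?thesis using assms unfolding odd_stage_def by blast
qed

lemma dyadic_alternating_averages: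
  fixes t :: "nat \<Rightarrow> real"
  assumes lim: "(\<lambda>Q. (\<Sum>q<Q. t q) / real Q) \<longlonglongrightarrow> 0"
    and t: "\<And>q. \<bar>t q - (if odd_stage q then v else u)\<bar> \<le> \<kappa>"
  shows "\<bar>u\<bar> \<le> \<kappa>" "\<bar>v\<bar> \<le> \<kappa>"
proof -
  have "\<bar>t q - (if odd i then v else u)\<bar> \<le> \<kappa>" if "q \<in> {2 ^ i..<2 ^ Suc i}" for q i
    using t[of q] odd_stage_iff[of i q] that by auto
  then have st: "\<forall>q\<in>{2 ^ i..<2 ^ Suc i}. \<bar>t q - (if odd i then v else u)\<bar> \<le> \<kappa>" for i
    by blast
  have "\<exists>i\<ge>N. \<forall>q\<in>{2 ^ i..<2 ^ Suc i}. \<bar>t q - u\<bar> \<le> \<kappa>" for N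
    using st[of "2 * N"] by (intro exI[of _ "2 * N"]) auto
  then show "\<bar>u\<bar> \<le> \<kappa>" by (rule dyadic_stage_average[OF lim])
  have "\<exists>i\<ge>N. \<forall>q\<in>{2 ^ i..<2 ^ Suc i}. \<bar>t q - v\<bar> \<le> \<kappa>" for N
    using st[of "2 * N + 1"] by (intro exI[of _ "2 * N + 1"]) auto
  then show "\<bar>v\<bar> \<le> \<kappa>" by (rule dyadic_stage_average[OF lim])
qed

section \<open>Infinite shadowing and the cost of gaps\<close>

context suspension
begin

text \<open>Specification handles finitely many blocks; a limit point of the finite solutions, which
  exists by compactness, shadows all blocks at once. Passing to the limit weakens the strict
  inequality.\<close>

lemma ex_infinite_shadowing:
  assumes spec: "specification_property f" and "0 < e"
  obtains m where "\<And>n (x :: nat \<Rightarrow> 'a). 0 < n \<Longrightarrow>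
    \<exists>z. \<forall>j. \<forall>p<n. dist ((f ^^ (p + j * (n + m))) z) ((f ^^ p) (x j)) \<le> e"
proof -
  obtain m0 :: int where m0: "\<And>(k::nat) a b (x::nat \<Rightarrow> 'a).
       \<lbrakk>\<forall>j\<in>{1..k}. a j \<le> b j; \<forall>j. 1 \<le> j \<and> j < k \<longrightarrow> int (a (Suc j)) - int (b j) \<ge> m0\<rbrakk> \<Longrightarrow>
       \<exists>z. \<forall>j\<in>{1..k}. \<forall>p\<le>b j - a j. dist ((f ^^ (p + a j)) z) ((f ^^ p) (x j)) < e"
    using spec[unfolded specification_property_def, rule_format, OF assms(2)] by metis
  define m where "m = nat m0"
  show ?thesis
  proof (rule that[of m])
    fix n :: nat and x :: "nat \<Rightarrow> 'a" assume n: "0 < n"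
    have fin: "\<exists>z. \<forall>j<k. \<forall>p<n. dist ((f ^^ (p + j * (n + m))) z) ((f ^^ p) (x j)) < e" for k
    proof -
      \<comment> \<open>Specification counts intervals from 1, the sequence of blocks from 0. A
        block of \<open>n\<close> points ends at offset \<open>n - 1\<close>, so consecutive
        intervals are \<open>m + 1\<close> apart.\<close>
      let ?a = "\<lambda>j. (j - 1) * (n + m)" and ?b = "\<lambda>j. (j - 1) * (n + m) + (n - 1)"
      have "int (?a (Suc j)) - int (?b j) \<ge> m0" if "1 \<le> j" for j
      proof -
        obtain i where "j = Suc i" using \<open>1 \<le> j\<close> by (cases j) auto
        then show ?thesis using n by (simp add: m_def of_nat_diff algebra_simps)
      qed
      then have "\<exists>z. \<forall>j\<in>{1..k}. \<forall>p\<le>?b j - ?a j. dist ((f ^^ (p + ?a j)) z) ((f ^^ p) (x (j - 1))) < e"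
        using m0[of k ?a ?b "\<lambda>j. x (j - 1)"] by auto
      then obtain z where z: "\<And>j p. j \<in> {1..k} \<Longrightarrow> p \<le> n - 1 \<Longrightarrow>
          dist ((f ^^ (p + ?a j)) z) ((f ^^ p) (x (j - 1))) < e"
        by (metis diff_add_inverse)
      show ?thesis
      proof (intro exI[of _ z] allI impI)
        fix j p assume "j < k" "p < n"
        then show "dist ((f ^^ (p + j * (n + m))) z) ((f ^^ p) (x j)) < e"
          using z[of "Suc j" p] by auto
      qed
    qed
    then obtain z where z: "\<And>k j p. j < k \<Longrightarrow> p < n \<Longrightarrow>
        dist ((f ^^ (p + j * (n + m))) (z k)) ((f ^^ p) (x j)) < e" by metis
    obtain l r where lr: "strict_mono r" "(z \<circ> r) \<longlonglongrightarrow> l"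
      using compact_base unfolding compact_def by (metis UNIV_I)
    have "dist ((f ^^ (p + j * (n + m))) l) ((f ^^ p) (x j)) \<le> e" if "p < n" for j p
    proof (rule tendsto_upperbound)
      have "isCont (f ^^ (p + j * (n + m))) l"
        using continuous_on_iterate[of "p + j * (n + m)"] by (simp add: continuous_on_eq_continuous_at)
      from isCont_tendsto_compose[OF this lr(2)]
      show "(\<lambda>i. dist ((f ^^ (p + j * (n + m))) ((z \<circ> r) i)) ((f ^^ p) (x j)))
          \<longlonglongrightarrow> dist ((f ^^ (p + j * (n + m))) l) ((f ^^ p) (x j))"
        by (intro tendsto_dist tendsto_const)
      show "\<forall>\<^sub>F i in sequentially. dist ((f ^^ (p + j * (n + m))) ((z \<circ> r) i)) ((f ^^ p) (x j)) \<le> e"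
        unfolding eventually_sequentially
      proof (intro exI[of _ "Suc j"] allI impI)
        fix i assume "Suc j \<le> i"
        then have "j < r i" using seq_suble[OF lr(1), of i] by linarith
        then show "dist ((f ^^ (p + j * (n + m))) ((z \<circ> r) i)) ((f ^^ p) (x j)) \<le> e"
          using z[of j "r i" p] that by simp
      qed
    qed simp
    then show "\<exists>z. \<forall>j. \<forall>p<n. dist ((f ^^ (p + j * (n + m))) z) ((f ^^ p) (x j)) \<le> e" by blast
  qed
qed

text \<open>The uncontrolled gap of \<open>m\<close> iterates after the block costs at most
  \<open>real m * B\<close>.\<close>

lemma birkhoff_sum_block:
  assumes shadow: "\<And>p. p < n \<Longrightarrow> dist ((f ^^ p) y) ((f ^^ p) x) \<le> e"
    and var: "\<And>x y. dist x y \<le> e \<Longrightarrow> \<bar>h x - h y\<bar> \<le> \<eta>"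
    and bound: "\<And>x. \<bar>h x\<bar> \<le> B"
  shows "\<bar>bsum h (n + m) y - bsum h n x\<bar> \<le> real n * \<eta> + real m * B"
proof -
  have "\<bar>bsum h n y - bsum h n x\<bar> \<le> real n * \<eta>"
    by (rule birkhoff_sum_diff_le) (use shadow var in blast)
  moreover have "\<bar>bsum h m ((f ^^ n) y)\<bar> \<le> real m * B"
    by (rule birkhoff_sum_bounded[OF bound])
  ultimately show ?thesis by (simp add: birkhoff_sum_add)
qed

text \<open>A superblock is \<open>K\<close> consecutive blocks, the first one prescribed; the
  others all contribute nearly the same amount \<open>s\<close>, whichever words are chosen
  there.\<close>

lemma birkhoff_sum_superblock:
  assumes shadow: "\<And>j p. p < n \<Longrightarrow> dist ((f ^^ (p + j * (n + m))) z) ((f ^^ p) (w j)) \<le> e"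
    and var: "\<And>x y. dist x y \<le> e \<Longrightarrow> \<bar>h x - h y\<bar> \<le> \<eta>"
    and bound: "\<And>x. \<bar>h x\<bar> \<le> B"
    and s: "\<And>j. \<not> K dvd j \<Longrightarrow> \<bar>bsum h n (w j) - s\<bar> \<le> \<eta>'" and "0 < K" "0 \<le> \<eta>'"
  shows "\<bar>bsum h (K * (n + m)) ((f ^^ (q * (K * (n + m)))) z) - (bsum h n (w (q * K)) + (real K - 1) * s)\<bar>
     \<le> real K * (real n * \<eta> + real m * B + \<eta>')"
proof -
  let ?M = "n + m"
  define X where "X i = bsum h ?M ((f ^^ ((q * K + i) * ?M)) z)" for i
  define Y where "Y i = (if i = (0::nat) then bsum h n (w (q * K)) else s)" for i
  have "bsum h (K * ?M) ((f ^^ (q * (K * ?M))) z) = (\<Sum>i<K. X i)"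
    unfolding birkhoff_sum_mult X_def
    by (intro sum.cong refl arg_cong2[of _ _ _ _ "bsum h"]) (simp add: funpow_add[symmetric, THEN fun_cong, unfolded o_def] algebra_simps)
  moreover have "bsum h n (w (q * K)) + (real K - 1) * s = (\<Sum>i<K. Y i)"
  proof -
    obtain k where "K = Suc k" using \<open>0 < K\<close> by (cases K) auto
    then show ?thesis by (simp add: Y_def sum.lessThan_Suc_shift del: sum.lessThan_Suc)
  qed
  moreover have "\<bar>X i - Y i\<bar> \<le> real n * \<eta> + real m * B + \<eta>'" if "i < K" for i
  proof -
    have "\<bar>X i - bsum h n (w (q * K + i))\<bar> \<le> real n * \<eta> + real m * B"
      unfolding X_def
    proof (rule birkhoff_sum_block[OF _ var bound])
      fix p assume "p < n"
      from shadow[OF this, of "q * K + i"]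
      show "dist ((f ^^ p) ((f ^^ ((q * K + i) * ?M)) z)) ((f ^^ p) (w (q * K + i))) \<le> e"
        by (simp add: funpow_add)
    qed
    moreover have "\<bar>bsum h n (w (q * K + i)) - Y i\<bar> \<le> \<eta>'"
    proof (cases "i = 0")
      case False
      have "\<not> K dvd q * K + i"
        using False that by (simp add: dvd_add_right_iff nat_dvd_not_less)
      then show ?thesis using s False by (simp add: Y_def)
    qed (use \<open>0 \<le> \<eta>'\<close> in \<open>simp add: Y_def\<close>)
    ultimately show ?thesis by linarith
  qed
  then have "(\<Sum>i<K. \<bar>X i - Y i\<bar>) \<le> real (card {..<K}) * (real n * \<eta> + real m * B + \<eta>')"
    by (intro sum_bounded_above) auto
  moreover have "\<bar>(\<Sum>i<K. X i) - (\<Sum>i<K. Y i)\<bar> \<le> (\<Sum>i<K. \<bar>X i - Y i\<bar>)"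
    unfolding sum_subtractf[symmetric] by (rule sum_abs)
  ultimately show ?thesis by simp
qed

end

section \<open>Entropy of subsets\<close>

lemma Lim_at_top_mono:
  fixes F :: "real \<Rightarrow> ennreal"
  assumes "mono F"
  shows "Lim at_top F = (SUP T. F T)"
proof (rule tendsto_Lim)
  show "(F \<longlongrightarrow> (SUP T. F T)) at_top"
  proof (rule order_tendstoI)
    fix a assume "a < (SUP T. F T)"
    then obtain T where "a < F T" by (auto simp: less_SUP_iff)
    then have "a < F x" if "T \<le> x" for x
      using less_le_trans[OF _ monoD[OF assms that]] by blast
    then show "eventually (\<lambda>x. a < F x) at_top"
      using eventually_at_top_linorder by blast
  next
    fix a assume "(SUP T. F T) < a"
    then show "eventually (\<lambda>x. F x < a) at_top"
      by (intro always_eventually allI) (meson SUP_upper UNIV_I le_less_trans)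
  qed
qed simp

section \<open>Entropy of subsets: monotonicity, a lower criterion and the upper bound\<close>

context metric_suspension
begin

lemma entropy_m_eq_SUP: "entropy_m S d g Z \<alpha> \<epsilon> = (SUP T. entropy_M S d g Z \<alpha> \<epsilon> T)"
  unfolding entropy_m_def
proof (rule Lim_at_top_mono, rule monoI)
  fix T T' :: real assume "T \<le> T'"
  then have "bowen_covers S d g Z \<epsilon> T' \<subseteq> bowen_covers S d g Z \<epsilon> T"
    by (fastforce simp: bowen_covers_def)
  then show "entropy_M S d g Z \<alpha> \<epsilon> T \<le> entropy_M S d g Z \<alpha> \<epsilon> T'"
    unfolding entropy_M_def by (rule INF_superset_mono) simp
qed

lemma entropy_m_antimono:
  assumes "\<epsilon> \<le> \<epsilon>'"
  shows "entropy_m S d g Z \<alpha> \<epsilon>' \<le> entropy_m S d g Z \<alpha> \<epsilon>"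
proof -
  have ball: "bowen_ball S d g t x \<epsilon> \<subseteq> bowen_ball S d g t x \<epsilon>'" for x t
    using assms by (fastforce simp: bowen_ball_def)
  have "bowen_covers S d g Z \<epsilon> T \<subseteq> bowen_covers S d g Z \<epsilon>' T" for T
  proof
    fix \<Gamma> assume \<Gamma>: "\<Gamma> \<in> bowen_covers S d g Z \<epsilon> T"
    have "(\<Union>(x, t)\<in>\<Gamma>. bowen_ball S d g t x \<epsilon>) \<subseteq> (\<Union>(x, t)\<in>\<Gamma>. bowen_ball S d g t x \<epsilon>')"
      by (rule UN_mono) (use ball in auto)
    then show "\<Gamma> \<in> bowen_covers S d g Z \<epsilon>' T"
      using \<Gamma> unfolding bowen_covers_def by blast
  qed
  then show ?thesis
    unfolding entropy_m_eq_SUP entropy_M_def by (intro SUP_mono' INF_superset_mono) auto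
qed

lemma set_entropy_eq_SUP: "set_entropy S d g Z = (SUP \<epsilon>\<in>{0<..}. set_entropy_eps S d g Z \<epsilon>)"
  unfolding set_entropy_def
proof (rule Lim_at_right_antimono)
  fix a b :: real assume "a \<le> b"
  have "entropy_m S d g Z \<alpha> b = 0" if "entropy_m S d g Z \<alpha> a = 0" for \<alpha>
    using entropy_m_antimono[OF \<open>a \<le> b\<close>, of Z \<alpha>] that by simp
  then have "{\<alpha>. entropy_m S d g Z \<alpha> a = 0} \<subseteq> {\<alpha>. entropy_m S d g Z \<alpha> b = 0}" by blast
  then show "set_entropy_eps S d g Z b \<le> set_entropy_eps S d g Z a"
    unfolding set_entropy_eps_def by (intro Inf_superset_mono image_mono)
qed

lemma entropy_Q_antimono:
  assumes "\<Gamma> \<subseteq> S \<times> {0<..}" "\<alpha> \<le> \<alpha>'"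
  shows "entropy_Q \<alpha>' \<Gamma> \<le> entropy_Q \<alpha> \<Gamma>"
  unfolding entropy_Q_def
  by (rule infsum_mono) (use assms in \<open>auto intro!: nonneg_summable_on_complete ennreal_leI mult_right_mono\<close>)

text \<open>A bound at a single threshold \<open>T\<close> suffices since \<open>entropy_M\<close>
  increases with \<open>T\<close>. It extends to all smaller exponents, none of which can then have
  vanishing \<open>entropy_m\<close>.\<close>

lemma set_entropy_ge:
  assumes "0 < \<epsilon>" and Q: "\<And>\<Gamma>. \<Gamma> \<in> bowen_covers S d g Z \<epsilon> T \<Longrightarrow> 1 \<le> entropy_Q \<alpha> \<Gamma>"
  shows "ereal \<alpha> \<le> set_entropy S d g Z"
proof -
  have "1 \<le> entropy_m S d g Z \<alpha>' \<epsilon>" if "\<alpha>' \<le> \<alpha>" for \<alpha>'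
  proof -
    have "1 \<le> entropy_Q \<alpha>' \<Gamma>" if \<Gamma>: "\<Gamma> \<in> bowen_covers S d g Z \<epsilon> T" for \<Gamma>
      using Q[OF \<Gamma>] entropy_Q_antimono[OF _ \<open>\<alpha>' \<le> \<alpha>\<close>, of \<Gamma>] \<Gamma>
      by (auto simp: bowen_covers_def intro: order_trans)
    then have "1 \<le> entropy_M S d g Z \<alpha>' \<epsilon> T" unfolding entropy_M_def by (rule INF_greatest)
    then show ?thesis unfolding entropy_m_eq_SUP by (meson SUP_upper2 UNIV_I)
  qed
  then have "\<alpha> < \<alpha>'" if "entropy_m S d g Z \<alpha>' \<epsilon> = 0" for \<alpha>'
    using that by (metis not_le not_one_le_zero)
  then have "ereal \<alpha> \<le> set_entropy_eps S d g Z \<epsilon>"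
    unfolding set_entropy_eps_def by (intro Inf_greatest) (auto intro: less_imp_le)
  also have "\<dots> \<le> set_entropy S d g Z"
    unfolding set_entropy_eq_SUP by (rule SUP_upper) (use assms in simp)
  finally show ?thesis .
qed

lemma entropy_Q_spanning:
  assumes "finite E"
  shows "entropy_Q \<alpha> (E \<times> {t}) = ennreal (real (card E) * exp (- \<alpha> * t))"
proof -
  have "entropy_Q \<alpha> (E \<times> {t}) = (\<Sum>(x, t)\<in>E \<times> {t}. ennreal (exp (- \<alpha> * t)))"
    unfolding entropy_Q_def using assms by (intro infsum_finite) simp
  also have "\<dots> = (\<Sum>x\<in>E. ennreal (exp (- \<alpha> * t)))"
    by (rule sum.reindex_bij_witness[of _ "\<lambda>x. (x, t)" fst]) auto
  also have "\<dots> = ennreal (real (card E) * exp (- \<alpha> * t))"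
    by (simp add: ennreal_mult ennreal_of_nat_eq_real_of_nat)
  finally show ?thesis .
qed

text \<open>A minimal spanning set at one large time \<open>t\<close> is an admissible cover. With
  exponent \<open>\<alpha> + e\<close> against a growth rate below \<open>\<alpha> + e / 2\<close>,
  its sum is at most \<open>exp (- (e / 2) * t)\<close>.\<close>

lemma set_entropy_le_flow_entropy:
  assumes "Z \<subseteq> S"
  shows "set_entropy S d g Z \<le> flow_entropy S d g"
proof (rule ereal_le_real)
  fix \<alpha> assume "flow_entropy S d g \<le> ereal \<alpha>"
  show "set_entropy S d g Z \<le> ereal \<alpha>"
  proof (rule ereal_le_epsilon2)
    fix e :: real assume e: "0 < e"
    let ?a = "\<alpha> + e"
    have "set_entropy_eps S d g Z \<epsilon> \<le> ereal ?a" if \<epsilon>: "0 < \<epsilon>" for \<epsilon>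
    proof -
      have "Limsup at_top (\<lambda>t. ereal (ln (real (spanning_number S d g t \<epsilon>)) / t)) \<le> flow_entropy S d g"
        unfolding flow_entropy_eq_SUP by (rule SUP_upper) (use \<epsilon> in simp)
      also have "\<dots> < ereal (\<alpha> + e / 2)"
        using \<open>flow_entropy S d g \<le> ereal \<alpha>\<close> e by (auto intro: le_less_trans)
      finally have ev: "eventually (\<lambda>t. ereal (ln (real (spanning_number S d g t \<epsilon>)) / t) < ereal (\<alpha> + e / 2)) at_top"
        by (rule Limsup_lessD)
      have M0: "entropy_M S d g Z ?a \<epsilon> T = 0" for T
      proof -
        have "entropy_M S d g Z ?a \<epsilon> T \<le> ennreal r" if r: "0 < r" for r
        proof -
          have "((\<lambda>t. exp (- (e / 2) * t)) \<longlongrightarrow> 0) at_top" using e by real_asymp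
          then have "eventually (\<lambda>t. exp (- (e / 2) * t) < r) at_top"
            using r by (rule order_tendstoD)
          then have "eventually (\<lambda>t. exp (- (e / 2) * t) < r \<and> max T 1 < t \<and>
             ereal (ln (real (spanning_number S d g t \<epsilon>)) / t) < ereal (\<alpha> + e / 2)) at_top"
            using ev eventually_gt_at_top[of "max T 1"] by eventually_elim auto
          then obtain t where t: "exp (- (e / 2) * t) < r" "max T 1 < t"
              "ln (real (spanning_number S d g t \<epsilon>)) / t < \<alpha> + e / 2"
            by (auto simp: eventually_at_top_linorder)
          obtain E where E: "E \<in> spanning_sets t \<epsilon>" "card E = spanning_number S d g t \<epsilon>"
            using ex_minimal_spanning_set[OF \<epsilon>, of t] t(2) by auto
          have "E \<times> {t} \<in> bowen_covers S d g Z \<epsilon> T"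
            using E(1) t(2) assms unfolding bowen_covers_def spanning_sets_def
            by (auto intro: countable_finite) blast
          then have "entropy_M S d g Z ?a \<epsilon> T \<le> entropy_Q ?a (E \<times> {t})"
            unfolding entropy_M_def by (rule INF_lower)
          also have "\<dots> = ennreal (real (card E) * exp (- ?a * t))"
            by (rule entropy_Q_spanning) (use E(1) in \<open>simp add: spanning_sets_def\<close>)
          also have "\<dots> \<le> ennreal (exp ((\<alpha> + e / 2) * t) * exp (- ?a * t))"
          proof (intro ennreal_leI mult_right_mono)
            have "0 < real (card E)" using spanning_number_pos[OF \<epsilon>, of t] t(2) E(2) by simp
            moreover have "ln (real (card E)) \<le> (\<alpha> + e / 2) * t"
              using t(2,3) E(2) by (simp add: divide_less_eq less_imp_le)
            ultimately show "real (card E) \<le> exp ((\<alpha> + e / 2) * t)"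
              by (metis exp_le_cancel_iff exp_ln)
          qed simp
          also have "exp ((\<alpha> + e / 2) * t) * exp (- ?a * t) = exp (- (e / 2) * t)"
            by (simp add: algebra_simps flip: exp_add)
          also have "ennreal \<dots> \<le> ennreal r" using t(1) by (simp add: ennreal_leI)
          finally show ?thesis .
        qed
        then have "entropy_M S d g Z ?a \<epsilon> T \<le> 0 + ennreal r" if "0 < r" for r
          using that by (simp only: add_0)
        then have "entropy_M S d g Z ?a \<epsilon> T \<le> 0" by (rule ennreal_le_epsilon)
        then show ?thesis by simp
      qed
      then have "entropy_m S d g Z ?a \<epsilon> = 0" unfolding entropy_m_eq_SUP by simp
      then show ?thesis unfolding set_entropy_eps_def by (intro Inf_lower) auto
    qed
    then show "set_entropy S d g Z \<le> ereal \<alpha> + ereal e"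
      unfolding set_entropy_eq_SUP by (auto intro!: SUP_least)
  qed
qed

end

text \<open>The uniform product measure on \<open>UNIV \<rightarrow> E\<close> gives each of the sets \<open>W\<close> at most the mass of a
  cylinder over \<open>F\<close>.\<close>
lemma cylinder_cover_sum_ge_1:
  fixes E :: "'a set" and F :: "'i \<Rightarrow> nat set" and W :: "'i \<Rightarrow> (nat \<Rightarrow> 'a) set"
  assumes E: "finite E" "E \<noteq> {}" and "countable \<Gamma>"
    and cover: "UNIV \<rightarrow>\<^sub>E E \<subseteq> (\<Union>\<gamma>\<in>\<Gamma>. W \<gamma>)"
    and F: "\<And>\<gamma>. \<gamma> \<in> \<Gamma> \<Longrightarrow> finite (F \<gamma>)"
    and agree: "\<And>\<gamma> \<omega> \<omega>' i. \<lbrakk>\<gamma> \<in> \<Gamma>; \<omega> \<in> W \<gamma>; \<omega>' \<in> W \<gamma>; i \<in> F \<gamma>\<rbrakk> \<Longrightarrow> \<omega> i = \<omega>' i"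
    and weight: "\<And>\<gamma>. \<gamma> \<in> \<Gamma> \<Longrightarrow> ennreal (1 / real (card E) ^ card (F \<gamma>)) \<le> q \<gamma>"
  shows "1 \<le> infsum q \<Gamma>"
proof -
  define M where "M = (\<lambda>_::nat. uniform_count_measure E)"
  interpret prob_space "M i" for i unfolding M_def by (rule prob_space_uniform_count_measure[OF E])
  interpret product_prob_space M UNIV ..
  let ?P = "Pi\<^sub>M UNIV M"
  have sp: "space ?P = UNIV \<rightarrow>\<^sub>E E" by (simp add: space_PiM M_def space_uniform_count_measure)
  define ctr where "ctr \<gamma> = (SOME \<omega>. \<omega> \<in> W \<gamma>)" for \<gamma>
  \<comment> \<open>The sets \<open>W \<gamma>\<close> need not be measurable. They are replaced by
    the cylinders through one of their elements, which are measurable and contain them within the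
    product space.\<close>
  define C where "C \<gamma> = (if W \<gamma> \<inter> space ?P = {} then {} else
      {x\<in>space ?P. \<forall>i\<in>F \<gamma>. x i \<in> {ctr \<gamma> i} \<inter> E})" for \<gamma>
  have "{x\<in>space ?P. \<forall>i\<in>F \<gamma>. x i \<in> {ctr \<gamma> i} \<inter> E} \<in> sets ?P" if "\<gamma> \<in> \<Gamma>" for \<gamma>
  proof (rule sets.sets_Collect_finite_All[OF _ F[OF that]])
    fix i
    have "(\<lambda>x. x i) -` ({ctr \<gamma> i} \<inter> E) \<inter> space ?P \<in> sets ?P"
      by (rule measurable_sets[OF measurable_component_singleton])
        (auto simp: M_def sets_uniform_count_measure)
    moreover have "(\<lambda>x. x i) -` ({ctr \<gamma> i} \<inter> E) \<inter> space ?P = {x\<in>space ?P. x i \<in> {ctr \<gamma> i} \<inter> E}"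
      by auto
    ultimately show "{x\<in>space ?P. x i \<in> {ctr \<gamma> i} \<inter> E} \<in> sets ?P" by simp
  qed
  then have C_sets: "C \<gamma> \<in> sets ?P" if "\<gamma> \<in> \<Gamma>" for \<gamma>
    using that by (simp add: C_def)
  have ctr: "ctr \<gamma> \<in> W \<gamma>" if "W \<gamma> \<noteq> {}" for \<gamma>
    unfolding ctr_def using that by (simp add: some_in_eq)
  have sub: "W \<gamma> \<inter> space ?P \<subseteq> C \<gamma>" if "\<gamma> \<in> \<Gamma>" for \<gamma>
    using agree[OF that _ ctr, of _ ] ctr unfolding C_def sp by (auto simp: PiE_iff)
  have C_le: "emeasure ?P (C \<gamma>) \<le> q \<gamma>" if "\<gamma> \<in> \<Gamma>" for \<gamma>
  proof (cases "W \<gamma> \<inter> space ?P = {}")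
    case False
    have "emeasure ?P (C \<gamma>) = (\<Prod>i\<in>F \<gamma>. emeasure (M i) ({ctr \<gamma> i} \<inter> E))"
      unfolding C_def if_not_P[OF False]
      by (rule emeasure_PiM_Collect) (use F[OF that] in \<open>auto simp: M_def sets_uniform_count_measure\<close>)
    also have "\<dots> \<le> (\<Prod>i\<in>F \<gamma>. ennreal (1 / real (card E)))"
    proof (rule prod_mono_ennreal)
      fix i
      have "emeasure (M i) ({ctr \<gamma> i} \<inter> E) = ennreal (real (card ({ctr \<gamma> i} \<inter> E)) / real (card E))"
        unfolding M_def by (rule emeasure_uniform_count_measure[OF E(1)]) auto
      also have "\<dots> \<le> ennreal (1 / real (card E))"
        by (intro ennreal_leI divide_right_mono) (auto simp: Int_insert_left)
      finally show "emeasure (M i) ({ctr \<gamma> i} \<inter> E) \<le> ennreal (1 / real (card E))" .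
    qed
    also have "\<dots> = ennreal (1 / real (card E) ^ card (F \<gamma>))"
      by (simp add: ennreal_power power_one_over)
    also have "\<dots> \<le> q \<gamma>" by (rule weight[OF that])
    finally show ?thesis .
  qed (simp add: C_def)
  have cov: "space ?P \<subseteq> (\<Union>\<gamma>\<in>\<Gamma>. C \<gamma>)" using cover sub unfolding sp by blast
  have "1 = emeasure ?P (space ?P)" by (simp add: emeasure_space_1)
  also have "\<dots> \<le> emeasure ?P (\<Union>\<gamma>\<in>\<Gamma>. C \<gamma>)"
    using cov by (rule emeasure_mono) (use \<open>countable \<Gamma>\<close> C_sets in auto)
  also have "\<dots> \<le> infsum q \<Gamma>"
  proof (cases "finite \<Gamma>")
    case True
    have "emeasure ?P (\<Union>\<gamma>\<in>\<Gamma>. C \<gamma>) \<le> (\<Sum>\<gamma>\<in>\<Gamma>. emeasure ?P (C \<gamma>))"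
      using True C_sets by (intro emeasure_subadditive_finite) auto
    also have "\<dots> \<le> infsum q \<Gamma>" using True C_le by (simp add: sum_mono)
    finally show ?thesis .
  next
    case False
    define b where "b = from_nat_into \<Gamma>"
    have b: "bij_betw b UNIV \<Gamma>"
      unfolding b_def by (rule bij_betw_from_nat_into[OF \<open>countable \<Gamma>\<close> False])
    then have b\<Gamma>: "b n \<in> \<Gamma>" for n by (auto simp: bij_betw_def)
    have "emeasure ?P (\<Union>\<gamma>\<in>\<Gamma>. C \<gamma>) = emeasure ?P (\<Union>n. C (b n))"
      using b by (simp add: bij_betw_def flip: image_image)
    also have "\<dots> \<le> (\<Sum>n. emeasure ?P (C (b n)))"
      using C_sets[OF b\<Gamma>] by (intro emeasure_subadditive_countably) auto
    also have "\<dots> \<le> (\<Sum>n. q (b n))" using C_le[OF b\<Gamma>] by (intro suminf_le) auto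
    also have "\<dots> = infsum (\<lambda>n. q (b n)) UNIV"
      by (intro sums_unique[symmetric] has_sum_imp_sums has_sum_infsum nonneg_summable_on_complete) simp
    also have "\<dots> = infsum q \<Gamma>" by (rule infsum_reindex_bij_betw[OF b])
    finally show ?thesis .
  qed
  finally show ?thesis .
qed

section \<open>Irregular points\<close>

lemma card_non_multiples_ge:
  assumes "0 < K"
  shows "Q * (K - 1) \<le> card {j. j < Q * K \<and> \<not> K dvd j}"
proof -
  have "card {..<Q * K} - card ((\<lambda>q. q * K) ` {..<Q}) \<le> card ({..<Q * K} - (\<lambda>q. q * K) ` {..<Q})"
    by (rule diff_card_le_card_Diff) simp
  moreover have "{..<Q * K} - (\<lambda>q. q * K) ` {..<Q} \<subseteq> {j. j < Q * K \<and> \<not> K dvd j}"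
    using assms by (auto simp: dvd_def mult.commute image_iff)
  then have "card ({..<Q * K} - (\<lambda>q. q * K) ` {..<Q}) \<le> card {j. j < Q * K \<and> \<not> K dvd j}"
    by (intro card_mono) auto
  moreover have "card ((\<lambda>q. q * K) ` {..<Q}) \<le> Q"
    using card_image_le[of "{..<Q}" "\<lambda>q. q * K"] by simp
  ultimately show ?thesis by (simp add: diff_mult_distrib2)
qed

text \<open>\<open>U\<close> bounds the duration of a superblock and \<open>G\<close> is its free
  entropy. Rounding \<open>T / U\<close> down loses at most one superblock, which the strict
  inequality compensates for large \<open>T\<close>; for negative \<open>\<alpha>\<close> zero
  superblocks do.\<close>

lemma ex_block_number:
  fixes \<alpha> U G :: real
  assumes "0 < U" and "0 \<le> \<alpha> \<Longrightarrow> \<alpha> * U < G"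
  shows "\<exists>T0. \<forall>T\<ge>T0. \<exists>Q::nat. real Q * U \<le> T \<and> \<alpha> * T \<le> real Q * G"
proof (cases "0 \<le> \<alpha>")
  case False
  have "real 0 * U \<le> T \<and> \<alpha> * T \<le> real 0 * G" if "0 \<le> T" for T
    using False that by (simp add: mult_nonpos_nonneg)
  then show ?thesis by blast
next
  case True
  have G: "\<alpha> * U < G" "0 < G"
    using assms(2)[OF True] mult_nonneg_nonneg[OF True, of U] assms(1) by linarith+
  then have pos: "0 < G / U - \<alpha>" using assms(1) by (simp add: less_divide_eq)
  show ?thesis
  proof (intro exI[of _ "max 0 (G / (G / U - \<alpha>))"] allI impI)
    fix T assume T: "max 0 (G / (G / U - \<alpha>)) \<le> T"
    define Q where "Q = nat \<lfloor>T / U\<rfloor>"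
    have TU: "0 \<le> T / U" using T assms(1) by simp
    then have Q: "real Q \<le> T / U" "T / U - 1 \<le> real Q"
      unfolding Q_def by (simp_all add: of_nat_floor)
    have "G \<le> T * (G / U - \<alpha>)" using T pos by (simp add: divide_le_eq)
    then have "\<alpha> * T \<le> (T / U - 1) * G" by (simp add: algebra_simps)
    also have "\<dots> \<le> real Q * G" using Q(2) G(2) by (intro mult_right_mono) auto
    finally show "\<exists>Q::nat. real Q * U \<le> T \<and> \<alpha> * T \<le> real Q * G"
      using Q(1) assms(1) by (intro exI[of _ Q]) (simp add: le_divide_eq)
  qed
qed

section \<open>Orbits whose time averages oscillate\<close>

context observed_suspension
begin

definition "both_bound = (obs_bound + 1) * rmax"

lemma both_bound: "\<bar>\<phi> x\<bar> \<le> both_bound" "\<bar>\<rho> x\<bar> \<le> both_bound" "0 < both_bound"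
proof -
  show "\<bar>\<phi> x\<bar> \<le> both_bound"
    using abs_\<phi>_le[of x] rmax_pos by (simp add: both_bound_def algebra_simps)
  have "0 \<le> obs_bound * rmax" using obs_bound_pos rmax_pos by simp
  then show "\<bar>\<rho> x\<bar> \<le> both_bound"
    using le_rmax[of x] roof_pos[of x] by (simp add: both_bound_def algebra_simps)
  show "0 < both_bound" using obs_bound_pos rmax_pos by (simp add: both_bound_def)
qed

text \<open>At every \<open>P\<close>-th return the time integral is a Birkhoff sum of
  \<open>\<phi>\<close>. The time of these returns is comparable to \<open>Q\<close>, so dividing by
  \<open>Q\<close> preserves the convergence.\<close>

lemma flow_average_returns:
  assumes lim: "((\<lambda>T. (1 / T) * integral {0..T} (\<lambda>t. \<Phi> (g t (proj (z, 0))))) \<longlongrightarrow> L) at_top"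
    and "0 < P"
  shows "\<bar>L\<bar> \<le> obs_bound"
    "(\<lambda>Q. (bsum \<phi> (Q * P) z - L * bsum \<rho> (Q * P) z) / real Q) \<longlonglongrightarrow> 0"
proof -
  have I: "integral {0..T} (\<lambda>t. \<Phi> (g t (proj (z, 0)))) = integral {0..T} (\<lambda>t. \<Phi> (proj (z, t)))" for T
    by (rule Henstock_Kurzweil_Integration.integral_cong) (simp add: flow_proj)
  have lim': "((\<lambda>T. (1 / T) * integral {0..T} (\<lambda>t. \<Phi> (proj (z, t)))) \<longlongrightarrow> L) at_top"
    using lim by (simp only: I)
  have "eventually (\<lambda>T. \<bar>(1 / T) * integral {0..T} (\<lambda>t. \<Phi> (proj (z, t)))\<bar> \<le> obs_bound) at_top"
    using eventually_gt_at_top[of 0]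
  proof eventually_elim
    case (elim T)
    then show ?case using abs_integral_obs_le[of 0 T z] by (simp add: abs_mult abs_divide divide_le_eq)
  qed
  then show "\<bar>L\<bar> \<le> obs_bound"
    by (rule tendsto_upperbound[OF tendsto_rabs[OF lim']]) simp
  define R where "R Q = bsum \<rho> (Q * P) z" for Q
  have R_ge: "real Q * rmin \<le> R Q" for Q
  proof -
    have "real Q \<le> real (Q * P)" using assms(2) unfolding of_nat_le_iff by simp
    then have "real Q * rmin \<le> real (Q * P) * rmin" using rmin_pos by (intro mult_right_mono) auto
    then show ?thesis using bsum_roof_ge[of "Q * P" z] by (simp add: R_def)
  qed
  have R_le: "R Q \<le> real Q * (real P * rmax)" for Q
    using bsum_roof_le[of "Q * P" z] by (simp add: R_def)
  have "filterlim (\<lambda>Q. real Q * rmin) at_top sequentially"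
    by (rule filterlim_at_top_mult_tendsto_pos[OF tendsto_const rmin_pos filterlim_real_sequentially])
  then have "filterlim R at_top sequentially"
    by (rule filterlim_at_top_mono) (simp add: R_ge)
  from filterlim_compose[OF lim' this]
  have "(\<lambda>Q. (1 / R Q) * bsum \<phi> (Q * P) z) \<longlonglongrightarrow> L" by (simp only: R_def integral_obs_return)
  then have "(\<lambda>Q. \<bar>(1 / R Q) * bsum \<phi> (Q * P) z - L\<bar>) \<longlonglongrightarrow> 0"
    by (intro tendsto_rabs_zero) (rule LIM_zero)
  then have "(\<lambda>Q. \<bar>(1 / R Q) * bsum \<phi> (Q * P) z - L\<bar> * (real P * rmax)) \<longlonglongrightarrow> 0"
    by (rule tendsto_mult_left_zero)
  moreover have "eventually (\<lambda>Q. norm ((bsum \<phi> (Q * P) z - L * bsum \<rho> (Q * P) z) / real Q)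
      \<le> \<bar>(1 / R Q) * bsum \<phi> (Q * P) z - L\<bar> * (real P * rmax)) sequentially"
    using eventually_gt_at_top[of 0]
  proof eventually_elim
    case (elim Q)
    have R0: "0 < R Q" using R_ge[of Q] elim rmin_pos by (meson less_le_trans mult_pos_pos of_nat_0_less_iff)
    then have "bsum \<phi> (Q * P) z - L * bsum \<rho> (Q * P) z = ((1 / R Q) * bsum \<phi> (Q * P) z - L) * R Q"
      by (simp add: R_def left_diff_distrib)
    then have "norm ((bsum \<phi> (Q * P) z - L * bsum \<rho> (Q * P) z) / real Q)
        = \<bar>(1 / R Q) * bsum \<phi> (Q * P) z - L\<bar> * (R Q / real Q)"
      using R0 by (simp add: abs_mult abs_divide)
    also have "\<dots> \<le> \<bar>(1 / R Q) * bsum \<phi> (Q * P) z - L\<bar> * (real P * rmax)"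
      using R_le[of Q] elim by (intro mult_left_mono) (auto simp: divide_le_eq mult.commute)
    finally show ?case .
  qed
  ultimately show "(\<lambda>Q. (bsum \<phi> (Q * P) z - L * bsum \<rho> (Q * P) z) / real Q) \<longlonglongrightarrow> 0"
    by (rule Lim_null_comparison[rotated])
qed

text \<open>Were \<open>L\<close> the limit of the time averages, the sums of
  \<open>\<phi> - L * \<rho>\<close> over superblocks would have mean 0. Both stage values would
  then be small, and with them the defects \<open>v0\<close> and \<open>vc\<close> of the two
  prescribed blocks, which \<open>incompatible\<close> excludes.\<close>

lemma irregular_pointI:
  assumes "0 < K" "0 < n" "0 \<le> \<eta>'"
    and shadow: "\<And>j p. p < n \<Longrightarrow> dist ((f ^^ (p + j * (n + m))) z) ((f ^^ p) (w j)) \<le> e"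
    and var: "\<And>x y. dist x y \<le> e \<Longrightarrow> \<bar>\<phi> x - \<phi> y\<bar> \<le> \<eta>" "\<And>x y. dist x y \<le> e \<Longrightarrow> \<bar>\<rho> x - \<rho> y\<bar> \<le> \<eta>"
    and s: "\<And>j. \<not> K dvd j \<Longrightarrow> \<bar>bsum \<phi> n (w j) - bsum \<phi> n e0\<bar> \<le> \<eta>'"
      "\<And>j. \<not> K dvd j \<Longrightarrow> \<bar>bsum \<rho> n (w j) - bsum \<rho> n e0\<bar> \<le> \<eta>'"
    and w: "\<And>q. w (q * K) = (if odd_stage q then c else e0)"
    and D: "real n * \<eta> + real m * both_bound + \<eta>' \<le> \<zeta> * real n"
    and incompatible: "\<And>L. \<lbrakk>\<bar>bsum \<phi> n e0 - L * bsum \<rho> n e0\<bar> \<le> (1 + obs_bound) * \<zeta> * real n;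
      \<bar>bsum \<phi> n c - L * bsum \<rho> n c\<bar> \<le> 2 * real K * (1 + obs_bound) * \<zeta> * real n\<rbrakk> \<Longrightarrow> False"
  shows "proj (z, 0) \<in> irregular_set S g \<Phi>"
proof -
  have False if lim: "((\<lambda>T. (1 / T) * integral {0..T} (\<lambda>t. \<Phi> (g t (proj (z, 0))))) \<longlongrightarrow> L) at_top" for L
  proof -
    define P where "P = K * (n + m)"
    have "0 < P" using assms(1,2) by (simp add: P_def)
    note L = flow_average_returns[OF lim this]
    define t where "t q = bsum \<phi> P ((f ^^ (q * P)) z) - L * bsum \<rho> P ((f ^^ (q * P)) z)" for q
    define v0 where "v0 = bsum \<phi> n e0 - L * bsum \<rho> n e0"
    define vc where "vc = bsum \<phi> n c - L * bsum \<rho> n c"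
    define X where "X = (1 + obs_bound) * \<zeta> * real n"
    have "(\<Sum>q<Q. t q) = bsum \<phi> (Q * P) z - L * bsum \<rho> (Q * P) z" for Q
      by (simp add: t_def birkhoff_sum_mult sum_subtractf sum_distrib_left)
    then have lim_t: "(\<lambda>Q. (\<Sum>q<Q. t q) / real Q) \<longlonglongrightarrow> 0" using L(2) by simp
    \<comment> \<open>The factor \<open>1 + obs_bound\<close> in \<open>X\<close> combines the error
      of the \<open>\<phi>\<close>-sum with \<open>L\<close> times that of the roof sum, as the
      limit is bounded by \<open>obs_bound\<close>.\<close>
    have close: "\<bar>t q - (if odd_stage q then vc + (real K - 1) * v0 else real K * v0)\<bar> \<le> real K * X" for q
    proof -
      define a where "a = bsum \<phi> P ((f ^^ (q * P)) z) - (bsum \<phi> n (w (q * K)) + (real K - 1) * bsum \<phi> n e0)"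
      define b where "b = bsum \<rho> P ((f ^^ (q * P)) z) - (bsum \<rho> n (w (q * K)) + (real K - 1) * bsum \<rho> n e0)"
      have "\<bar>a\<bar> \<le> real K * (real n * \<eta> + real m * both_bound + \<eta>')"
        unfolding a_def P_def
        by (rule birkhoff_sum_superblock[OF shadow var(1) both_bound(1) s(1) assms(1,3)])
      also have "\<dots> \<le> real K * (\<zeta> * real n)" using D by (intro mult_left_mono) auto
      finally have a: "\<bar>a\<bar> \<le> real K * (\<zeta> * real n)" .
      have "\<bar>b\<bar> \<le> real K * (real n * \<eta> + real m * both_bound + \<eta>')"
        unfolding b_def P_def
        by (rule birkhoff_sum_superblock[OF shadow var(2) both_bound(2) s(2) assms(1,3)])
      also have "\<dots> \<le> real K * (\<zeta> * real n)" using D by (intro mult_left_mono) auto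
      finally have "\<bar>b\<bar> \<le> real K * (\<zeta> * real n)" .
      then have "\<bar>L\<bar> * \<bar>b\<bar> \<le> obs_bound * (real K * (\<zeta> * real n))"
        using L(1) obs_bound_pos by (intro mult_mono) auto
      then have "\<bar>a - L * b\<bar> \<le> real K * (\<zeta> * real n) + obs_bound * (real K * (\<zeta> * real n))"
        using a abs_triangle_ineq4[of a "L * b"] by (simp add: abs_mult)
      moreover have "t q - (if odd_stage q then vc + (real K - 1) * v0 else real K * v0) = a - L * b"
        unfolding t_def a_def b_def w vc_def v0_def by (simp add: algebra_simps)
      ultimately show ?thesis by (simp add: X_def algebra_simps)
    qed
    have "\<bar>real K * v0\<bar> \<le> real K * X" "\<bar>vc + (real K - 1) * v0\<bar> \<le> real K * X"
      using dyadic_alternating_averages[OF lim_t close] by auto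
    then have v0: "\<bar>v0\<bar> \<le> X" using assms(1) by (simp add: abs_mult)
    have K1: "0 \<le> real K - 1" using assms(1) by linarith
    have "\<bar>(real K - 1) * v0\<bar> \<le> real K * X"
      unfolding abs_mult using v0 K1 by (intro mult_mono) auto
    then have "\<bar>vc\<bar> \<le> 2 * (real K * X)"
      using \<open>\<bar>vc + (real K - 1) * v0\<bar> \<le> real K * X\<close> by linarith
    then show False
      using incompatible[of L] v0 unfolding v0_def vc_def X_def by (simp add: mult.assoc)
  qed
  then show ?thesis by (auto simp: irregular_set_def)
qed

text \<open>A ratio \<open>L\<close> compatible with \<open>e0\<close> is within
  \<open>\<gamma> / 8\<close> of the ratio \<open>a\<close> of \<open>e0\<close>. The two measures
  give segments with ratios almost \<open>2 * \<gamma>\<close> apart, so the one on the far side of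
  \<open>a\<close> is incompatible with every such \<open>L\<close>.\<close>

lemma ex_incompatible_block:
  assumes x1: "bsum \<phi> n x1 \<le> c1 * bsum \<rho> n x1 + \<gamma> * rmin / 8 * real n"
    and x2: "c2 * bsum \<rho> n x2 - \<gamma> * rmin / 8 * real n \<le> bsum \<phi> n x2"
    and "c2 - c1 = 2 * \<gamma>" "0 < \<gamma>" "0 < n" "X \<le> \<gamma> * rmin / 8" "Y \<le> \<gamma> * rmin / 4"
  obtains c where "\<And>L. \<lbrakk>\<bar>bsum \<phi> n e0 - L * bsum \<rho> n e0\<bar> \<le> X * real n;
      \<bar>bsum \<phi> n c - L * bsum \<rho> n c\<bar> \<le> Y * real n\<rbrakk> \<Longrightarrow> False"
proof -
  define R where "R x = bsum \<rho> n x" for x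
  have R: "real n * rmin \<le> R x" for x unfolding R_def by (rule bsum_roof_ge)
  have n0: "0 < real n * rmin" using assms(5) rmin_pos by simp
  then have R0: "0 < R x" for x using R[of x] by linarith
  define a where "a = bsum \<phi> n e0 / R e0"
  have a: "bsum \<phi> n e0 = a * R e0" using R0[of e0] by (simp add: a_def)
  have aL: "\<bar>a - L\<bar> \<le> \<gamma> / 8" if "\<bar>bsum \<phi> n e0 - L * bsum \<rho> n e0\<bar> \<le> X * real n" for L
  proof -
    have "\<bar>a - L\<bar> * R e0 = \<bar>bsum \<phi> n e0 - L * bsum \<rho> n e0\<bar>"
      unfolding a R_def[symmetric] using R0[of e0] by (simp add: abs_mult flip: left_diff_distrib)
    also have "\<dots> \<le> X * real n" by (rule that)
    also have "\<dots> \<le> \<gamma> * rmin / 8 * real n" using assms(6) by (intro mult_right_mono) auto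
    also have "\<dots> = \<gamma> / 8 * (real n * rmin)" by simp
    also have "\<dots> \<le> \<gamma> / 8 * R e0" using R[of e0] assms(4) by (intro mult_left_mono) auto
    finally show ?thesis using R0[of e0] by simp
  qed
  have Y: "Y * real n \<le> \<gamma> / 4 * (real n * rmin)"
    using mult_right_mono[OF assms(7), of "real n"] by (simp add: mult_ac)
  show ?thesis
  proof (cases "c1 + \<gamma> \<le> a")
    case True
    show ?thesis
    proof (rule that[of x1])
      fix L assume L: "\<bar>bsum \<phi> n e0 - L * bsum \<rho> n e0\<bar> \<le> X * real n"
        "\<bar>bsum \<phi> n x1 - L * bsum \<rho> n x1\<bar> \<le> Y * real n"
      have "7 / 8 * \<gamma> \<le> L - c1" using aL[OF L(1)] True by linarith
      then have "7 / 8 * \<gamma> * (real n * rmin) \<le> (L - c1) * R x1"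
        using R[of x1] n0 assms(4) by (intro mult_mono) auto
      then have "7 / 8 * (\<gamma> * (real n * rmin)) \<le> L * R x1 - c1 * R x1" by (simp add: algebra_simps)
      moreover have "bsum \<phi> n x1 \<le> c1 * R x1 + 1 / 8 * (\<gamma> * (real n * rmin))"
        using x1 by (simp add: R_def mult_ac)
      moreover have "\<bar>bsum \<phi> n x1 - L * R x1\<bar> \<le> 1 / 4 * (\<gamma> * (real n * rmin))"
        using L(2) Y by (simp add: R_def)
      moreover have "0 < \<gamma> * (real n * rmin)" using assms(4) n0 by (rule mult_pos_pos)
      ultimately show False by linarith
    qed
  next
    case False
    show ?thesis
    proof (rule that[of x2])
      fix L assume L: "\<bar>bsum \<phi> n e0 - L * bsum \<rho> n e0\<bar> \<le> X * real n"
        "\<bar>bsum \<phi> n x2 - L * bsum \<rho> n x2\<bar> \<le> Y * real n"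
      have "7 / 8 * \<gamma> \<le> c2 - L" using aL[OF L(1)] False assms(3) by linarith
      then have "7 / 8 * \<gamma> * (real n * rmin) \<le> (c2 - L) * R x2"
        using R[of x2] n0 assms(4) by (intro mult_mono) auto
      then have "7 / 8 * (\<gamma> * (real n * rmin)) \<le> c2 * R x2 - L * R x2" by (simp add: algebra_simps)
      moreover have "c2 * R x2 - 1 / 8 * (\<gamma> * (real n * rmin)) \<le> bsum \<phi> n x2"
        using x2 by (simp add: R_def mult_ac)
      moreover have "\<bar>bsum \<phi> n x2 - L * R x2\<bar> \<le> 1 / 4 * (\<gamma> * (real n * rmin))"
        using L(2) Y by (simp add: R_def)
      moreover have "0 < \<gamma> * (real n * rmin)" using assms(4) n0 by (rule mult_pos_pos)
      ultimately show False by linarith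
    qed
  qed
qed

text \<open>Pigeonhole on the sums divided by \<open>n\<close>. These lie in a fixed bounded
  interval, so the number \<open>P\<close> of cells does not depend on \<open>n\<close>.\<close>

lemma ex_large_homogeneous_subset:
  assumes "0 < \<eta>"
  obtains P :: nat where "0 < P" "\<And>n E. \<lbrakk>0 < n; finite E\<rbrakk> \<Longrightarrow> \<exists>E'\<subseteq>E. card E \<le> P * card E' \<and>
     (\<forall>x\<in>E'. \<forall>y\<in>E'. \<bar>bsum \<phi> n x - bsum \<phi> n y\<bar> \<le> real n * \<eta> \<and> \<bar>bsum \<rho> n x - bsum \<rho> n y\<bar> \<le> real n * \<eta>)"
proof -
  define J where "J = {\<lfloor>- both_bound / \<eta>\<rfloor>..\<lfloor>both_bound / \<eta>\<rfloor>}"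
  have cell: "\<lfloor>bsum h n x / (real n * \<eta>)\<rfloor> \<in> J" if "\<And>x. \<bar>h x\<bar> \<le> both_bound" "0 < n" for h n x
  proof -
    have "\<bar>bsum h n x\<bar> \<le> real n * both_bound" by (rule birkhoff_sum_bounded[OF that(1)])
    then have "real n * (- both_bound) / (real n * \<eta>) \<le> bsum h n x / (real n * \<eta>)"
        "bsum h n x / (real n * \<eta>) \<le> real n * both_bound / (real n * \<eta>)"
      using assms by (intro divide_right_mono; simp)+
    then show ?thesis unfolding J_def using that(2) by (auto intro: floor_mono)
  qed
  have "finite J" by (simp add: J_def)
  have "J \<noteq> {}" using cell[of \<phi> 1, OF both_bound(1) zero_less_one] by blast
  show ?thesis
  proof (rule that[of "card (J \<times> J)"])
    show "0 < card (J \<times> J)" using \<open>finite J\<close> \<open>J \<noteq> {}\<close> by (simp add: card_gt_0_iff)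
    fix n :: nat and E :: "'a set" assume n: "0 < n" and "finite E"
    define idx where "idx x = (\<lfloor>bsum \<phi> n x / (real n * \<eta>)\<rfloor>, \<lfloor>bsum \<rho> n x / (real n * \<eta>)\<rfloor>)" for x
    have idx: "idx x \<in> J \<times> J" for x
      unfolding idx_def using cell[of \<phi>, OF both_bound(1) n] cell[of \<rho>, OF both_bound(2) n] by blast
    have "\<exists>i\<in>J \<times> J. card E \<le> card (J \<times> J) * card {x\<in>E. idx x = i}"
    proof (rule ccontr)
      assume no: "\<not> ?thesis"
      have "E = (\<Union>i\<in>J \<times> J. {x\<in>E. idx x = i})" using idx by auto
      then have "card E \<le> (\<Sum>i\<in>J \<times> J. card {x\<in>E. idx x = i})"
        using card_UN_le[of "J \<times> J" "\<lambda>i. {x\<in>E. idx x = i}"] \<open>finite J\<close> by simp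
      then have "card (J \<times> J) * card E \<le> (\<Sum>i\<in>J \<times> J. card (J \<times> J) * card {x\<in>E. idx x = i})"
        by (simp only: sum_distrib_left[symmetric] mult_le_mono2)
      also have "\<dots> < (\<Sum>i\<in>J \<times> J. card E)"
        by (rule sum_strict_mono) (use no \<open>finite J\<close> \<open>J \<noteq> {}\<close> in \<open>auto simp: not_le\<close>)
      finally show False by simp
    qed
    then obtain i where i: "card E \<le> card (J \<times> J) * card {x\<in>E. idx x = i}" by blast
    show "\<exists>E'\<subseteq>E. card E \<le> card (J \<times> J) * card E' \<and>
     (\<forall>x\<in>E'. \<forall>y\<in>E'. \<bar>bsum \<phi> n x - bsum \<phi> n y\<bar> \<le> real n * \<eta> \<and> \<bar>bsum \<rho> n x - bsum \<rho> n y\<bar> \<le> real n * \<eta>)"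
    proof (intro exI[of _ "{x\<in>E. idx x = i}"] conjI ballI i)
      fix x y assume "x \<in> {x\<in>E. idx x = i}" "y \<in> {x\<in>E. idx x = i}"
      then have e: "\<lfloor>bsum \<phi> n x / (real n * \<eta>)\<rfloor> = \<lfloor>bsum \<phi> n y / (real n * \<eta>)\<rfloor>"
          "\<lfloor>bsum \<rho> n x / (real n * \<eta>)\<rfloor> = \<lfloor>bsum \<rho> n y / (real n * \<eta>)\<rfloor>"
        by (auto simp: idx_def)
      have "0 < real n * \<eta>" using n assms by simp
      then show "\<bar>bsum \<phi> n x - bsum \<phi> n y\<bar> \<le> real n * \<eta>" "\<bar>bsum \<rho> n x - bsum \<rho> n y\<bar> \<le> real n * \<eta>"
        using floor_eq_imp_abs_diff_less[OF e(1)] floor_eq_imp_abs_diff_less[OF e(2)] by auto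
    qed auto
  qed
qed

end

section \<open>Entropy of the irregular set\<close>

locale observed_metric_suspension =
  metric_suspension f \<rho> d + observed_suspension f \<rho> \<Phi>
  for f :: "'a::metric_space \<Rightarrow> 'a" and \<rho> and d and \<Phi>
begin

text \<open>The constants are fixed in the order \<open>h1\<close>, \<open>K\<close>,
  \<open>\<zeta>\<close>, \<open>e\<close>, \<open>m\<close>, \<open>P\<close>, and only then the
  block length \<open>n\<close>, so that the gap cost and the pigeonhole loss become negligible
  relative to \<open>n\<close>.\<close>

lemma irregular_set_entropy_ge:
  assumes spec: "specification_property f"
    and \<mu>: "\<mu>1 \<in> invariant_prob_measures (susp_topology f \<rho>) g"
      "\<mu>2 \<in> invariant_prob_measures (susp_topology f \<rho>) g" "integral\<^sup>L \<mu>1 \<Phi> < integral\<^sup>L \<mu>2 \<Phi>"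
    and "ereal \<alpha> < flow_entropy S d g"
  shows "ereal \<alpha> \<le> set_entropy S d g (irregular_set S g \<Phi>)"
proof -
  obtain h where h: "\<alpha> < h" "ereal h < flow_entropy S d g"
    using assms(5) ereal_dense2 by force
  obtain es where es: "0 < es" and many: "\<And>N0. \<exists>n\<ge>N0. \<exists>E t. finite E \<and> separated n es E \<and>
     (\<forall>x\<in>E. bsum \<rho> n x \<le> t) \<and> exp (h * t) \<le> real (card E)"
    using ex_many_separated_orbits[OF h(2)] by blast
  define h1 where "h1 = (\<alpha> + h) / 2"
  have h1: "\<alpha> < h1" "h1 < h" using h(1) by (auto simp: h1_def)
  \<comment> \<open>\<open>K0\<close> free blocks follow each prescribed one. It is so large that
    the entropy surplus \<open>h1 - \<alpha>\<close> on them pays for the time of the prescribed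
    block and the errors.\<close>
  obtain K0 :: nat where "\<bar>\<alpha>\<bar> * (rmax / rmin + 1) / (h1 - \<alpha>) < real K0"
    using reals_Archimedean2 by blast
  then have K0: "\<bar>\<alpha>\<bar> * (rmax / rmin + 1) < real K0 * (h1 - \<alpha>)"
    using h1 by (simp add: divide_less_eq)
  define K where "K = Suc K0"
  have K: "0 < K" "real K - 1 = real K0" by (auto simp: K_def)
  define c1 where "c1 = integral\<^sup>L \<mu>1 \<Phi>"
  define c2 where "c2 = integral\<^sup>L \<mu>2 \<Phi>"
  define \<gamma> where "\<gamma> = (c2 - c1) / 2"
  have \<gamma>: "0 < \<gamma>" "c2 - c1 = 2 * \<gamma>" using \<mu>(3) by (auto simp: \<gamma>_def c1_def c2_def)
  define A where "A = real K * (1 + obs_bound)"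
  have A: "0 < A" "1 + obs_bound \<le> A"
    using K(1) obs_bound_pos mult_right_mono[of 1 "real K" "1 + obs_bound"] by (auto simp: A_def)
  \<comment> \<open>The first bound keeps the timing error of a superblock at most \<open>t\<close>;
    the second keeps the errors below the tolerances of
    \<open>ex_incompatible_block\<close>.\<close>
  define \<zeta> where "\<zeta> = min (rmin / real K) (\<gamma> * rmin / (8 * A))"
  have \<zeta>0: "0 < \<zeta>" using K(1) rmin_pos \<gamma>(1) A by (simp add: \<zeta>_def)
  have "\<zeta> \<le> rmin / real K" "\<zeta> \<le> \<gamma> * rmin / (8 * A)" by (simp_all add: \<zeta>_def)
  then have K\<zeta>: "real K * \<zeta> \<le> rmin" and A\<zeta>: "A * \<zeta> \<le> \<gamma> * rmin / 8"
    using K(1) A(1) by (simp_all add: field_simps)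
  \<comment> \<open>The relative error \<open>\<zeta>\<close> is split into a quarter for shadowing,
    a quarter for the inhomogeneity of the words and a half for the gaps.\<close>
  define \<eta> where "\<eta> = \<zeta> / 4"
  have \<eta>: "0 < \<eta>" using \<zeta>0 by (simp add: \<eta>_def)
  obtain e\<phi> where e\<phi>: "0 < e\<phi>" "\<And>x y. dist x y < e\<phi> \<Longrightarrow> dist (\<phi> x) (\<phi> y) < \<eta>"
    using uniformly_close[OF continuous_on_\<phi> \<eta>] by metis
  obtain e\<rho> where e\<rho>: "0 < e\<rho>" "\<And>x y. dist x y < e\<rho> \<Longrightarrow> dist (\<rho> x) (\<rho> y) < \<eta>"
    using uniformly_close[OF cont_roof \<eta>] by metis
  define e where "e = min (min e\<phi> e\<rho>) es / 8"
  have e: "0 < e" "e < e\<phi>" "e < e\<rho>" "8 * e \<le> es" using e\<phi>(1) e\<rho>(1) es by (auto simp: e_def)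
  have var: "\<bar>\<phi> x - \<phi> y\<bar> \<le> \<eta>" "\<bar>\<rho> x - \<rho> y\<bar> \<le> \<eta>" if "dist x y \<le> e" for x y
    using e\<phi>(2)[of x y] e\<rho>(2)[of x y] that e by (auto simp: dist_real_def)
  obtain m where shadowing: "\<And>n (x :: nat \<Rightarrow> 'a). 0 < n \<Longrightarrow>
    \<exists>z. \<forall>j. \<forall>p<n. dist ((f ^^ (p + j * (n + m))) z) ((f ^^ p) (x j)) \<le> e"
    using ex_infinite_shadowing[OF spec e(1)] by metis
  obtain P :: nat where P: "0 < P" and homogeneous: "\<And>n E. \<lbrakk>0 < n; finite E\<rbrakk> \<Longrightarrow> \<exists>E'\<subseteq>E. card E \<le> P * card E' \<and>
     (\<forall>x\<in>E'. \<forall>y\<in>E'. \<bar>bsum \<phi> n x - bsum \<phi> n y\<bar> \<le> real n * \<eta> \<and> \<bar>bsum \<rho> n x - bsum \<rho> n y\<bar> \<le> real n * \<eta>)"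
    using ex_large_homogeneous_subset[OF \<eta>] by metis
  \<comment> \<open>\<open>N1\<close> makes the gaps cost at most half of the error budget, and
    \<open>N2\<close> makes the pigeonhole factor \<open>P\<close> cost at most the rate
    \<open>h - h1\<close>.\<close>
  obtain N1 :: nat where N1: "real m * both_bound / (\<zeta> / 2) < real N1" using reals_Archimedean2 by blast
  obtain N2 :: nat where N2: "ln (real P) / ((h - h1) * rmin) < real N2" using reals_Archimedean2 by blast
  obtain n E t where n: "max 1 (max N1 N2) \<le> n" and E: "finite E" "separated n es E"
      "\<And>x. x \<in> E \<Longrightarrow> bsum \<rho> n x \<le> t" "exp (h * t) \<le> real (card E)"
    using many by metis
  have n0: "0 < n" using n by simp
  have m_small: "real m * both_bound \<le> \<zeta> / 2 * real n"
  proof -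
    have "real m * both_bound / (\<zeta> / 2) \<le> real n" using N1 n by linarith
    then show ?thesis using \<zeta>0 by (simp add: field_simps)
  qed
  have P_small: "ln (real P) \<le> (h - h1) * (real n * rmin)"
  proof -
    have "ln (real P) / ((h - h1) * rmin) \<le> real n" using N2 n by linarith
    then show ?thesis using h1 rmin_pos by (simp add: divide_le_eq mult_ac)
  qed
  have D: "real n * \<eta> + real m * both_bound + real n * \<eta> \<le> \<zeta> * real n"
    using m_small by (simp add: \<eta>_def algebra_simps)
  obtain E' where E': "E' \<subseteq> E" "card E \<le> P * card E'"
      "\<And>x y. x \<in> E' \<Longrightarrow> y \<in> E' \<Longrightarrow> \<bar>bsum \<phi> n x - bsum \<phi> n y\<bar> \<le> real n * \<eta>"
      "\<And>x y. x \<in> E' \<Longrightarrow> y \<in> E' \<Longrightarrow> \<bar>bsum \<rho> n x - bsum \<rho> n y\<bar> \<le> real n * \<eta>"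
    using homogeneous[OF n0 E(1)] by metis
  have finE': "finite E'" using E'(1) E(1) finite_subset by blast
  have "real (card E) \<le> real (P * card E')" using E'(2) of_nat_le_iff by blast
  then have expht: "exp (h * t) \<le> real P * real (card E')" using E(4) by simp
  then have "0 < real P * real (card E')" using exp_gt_zero[of "h * t"] by linarith
  then have "card E' \<noteq> 0" by (metis less_irrefl mult_zero_right of_nat_0)
  then obtain e0 where e0: "e0 \<in> E'" by (metis card.empty ex_in_conv)
  define N where "N = real (card E')"
  have N: "1 \<le> N" using \<open>card E' \<noteq> 0\<close> by (simp add: N_def)
  have tn: "real n * rmin \<le> t" using bsum_roof_ge[of n e0] E(3)[of e0] e0 E'(1) by auto
  have t0: "0 < t" using tn n0 rmin_pos by (meson less_le_trans mult_pos_pos of_nat_0_less_iff)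
  have lnN: "h1 * t \<le> ln N"
  proof -
    have "h * t = ln (exp (h * t))" by simp
    also have "\<dots> \<le> ln (real P * N)" using expht P N by (subst ln_le_cancel_iff) (auto simp: N_def)
    also have "\<dots> = ln (real P) + ln N" using P N by (simp add: ln_mult)
    also have "ln (real P) \<le> (h - h1) * t"
      using P_small mult_left_mono[OF tn, of "h - h1"] h1 by linarith
    finally show ?thesis by (simp add: algebra_simps)
  qed
  obtain x1 where x1: "bsum \<phi> n x1 \<le> c1 * bsum \<rho> n x1 + \<gamma> * rmin / 8 * real n"
    using ex_low_average[OF \<mu>(1), of "\<gamma> * rmin / 8" n] \<gamma>(1) rmin_pos n0 unfolding c1_def by auto
  obtain x2 where x2: "c2 * bsum \<rho> n x2 - \<gamma> * rmin / 8 * real n \<le> bsum \<phi> n x2"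
    using ex_high_average[OF \<mu>(2), of "\<gamma> * rmin / 8" n] \<gamma>(1) rmin_pos n0 unfolding c2_def by auto
  have "(1 + obs_bound) * \<zeta> \<le> \<gamma> * rmin / 8"
    using mult_right_mono[OF A(2), of \<zeta>] \<zeta>0 A\<zeta> by linarith
  moreover have "2 * real K * (1 + obs_bound) * \<zeta> \<le> \<gamma> * rmin / 4"
    using A\<zeta> by (simp add: A_def mult_ac)
  ultimately obtain c where c: "\<And>L. \<lbrakk>\<bar>bsum \<phi> n e0 - L * bsum \<rho> n e0\<bar> \<le> (1 + obs_bound) * \<zeta> * real n;
      \<bar>bsum \<phi> n c - L * bsum \<rho> n c\<bar> \<le> 2 * real K * (1 + obs_bound) * \<zeta> * real n\<rbrakk> \<Longrightarrow> False"
    using ex_incompatible_block[OF x1 x2 \<gamma>(2,1) n0] by blast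
  \<comment> \<open>The word prescribed at multiples of \<open>K\<close> depends on the stage alone;
    elsewhere it is the free coordinate of \<open>\<omega>\<close>.\<close>
  define w where "w \<omega> j = (if K dvd j then (if odd_stage (j div K) then c else e0) else \<omega> j)"
    for \<omega> :: "nat \<Rightarrow> 'a" and j
  define z where "z \<omega> = (SOME z. \<forall>j. \<forall>p<n. dist ((f ^^ (p + j * (n + m))) z) ((f ^^ p) (w \<omega> j)) \<le> e)" for \<omega>
  have z: "dist ((f ^^ (p + j * (n + m))) (z \<omega>)) ((f ^^ p) (w \<omega> j)) \<le> e" if "p < n" for \<omega> j p
    using someI_ex[OF shadowing[OF n0, of "w \<omega>"]] that unfolding z_def by blast
  define \<Omega> where "\<Omega> = (UNIV :: nat set) \<rightarrow>\<^sub>E E'"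
  have w_E': "w \<omega> j \<in> E'" if "\<omega> \<in> \<Omega>" "\<not> K dvd j" for \<omega> j
    using that by (auto simp: w_def \<Omega>_def)
  have w_K: "w \<omega> (q * K) = (if odd_stage q then c else e0)" for \<omega> q
    using K(1) by (simp add: w_def)
  have s\<phi>: "\<bar>bsum \<phi> n (w \<omega> j) - bsum \<phi> n e0\<bar> \<le> real n * \<eta>"
    and s\<rho>: "\<bar>bsum \<rho> n (w \<omega> j) - bsum \<rho> n e0\<bar> \<le> real n * \<eta>" if "\<omega> \<in> \<Omega>" "\<not> K dvd j" for \<omega> j
    using E'(3,4)[OF w_E'[OF that] e0] .
  have n\<eta>: "0 \<le> real n * \<eta>" using \<eta> by simp
  have irr: "proj (z \<omega>, 0) \<in> irregular_set S g \<Phi>" if "\<omega> \<in> \<Omega>" for \<omega>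
    by (rule irregular_pointI[OF K(1) n0 n\<eta> z var s\<phi>[OF that] s\<rho>[OF that] w_K D c])
  \<comment> \<open>An upper bound for the flow time of a superblock: the prescribed block has only
    the crude bound \<open>rmax\<close> per return, the free ones take at most about
    \<open>t\<close> each.\<close>
  define U where "U = real n * rmax + real K0 * t + real K * (\<zeta> * real n)"
  have U0: "0 < U"
    unfolding U_def using n0 rmax_pos t0 \<zeta>0 by (intro add_pos_nonneg) auto
  have U: "bsum \<rho> (Q * (K * (n + m))) (z \<omega>) \<le> real Q * U" if "\<omega> \<in> \<Omega>" for \<omega> Q
  proof -
    have "bsum \<rho> (K * (n + m)) ((f ^^ (q * (K * (n + m)))) (z \<omega>)) \<le> U" for q
    proof -
      have "\<bar>bsum \<rho> (K * (n + m)) ((f ^^ (q * (K * (n + m)))) (z \<omega>)) -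
          (bsum \<rho> n (w \<omega> (q * K)) + (real K - 1) * bsum \<rho> n e0)\<bar>
        \<le> real K * (real n * \<eta> + real m * both_bound + real n * \<eta>)"
        by (rule birkhoff_sum_superblock[OF z var(2) both_bound(2) s\<rho>[OF that] K(1) n\<eta>])
      also have "\<dots> \<le> real K * (\<zeta> * real n)" using D by (intro mult_left_mono) auto
      finally have "bsum \<rho> (K * (n + m)) ((f ^^ (q * (K * (n + m)))) (z \<omega>))
          \<le> bsum \<rho> n (w \<omega> (q * K)) + real K0 * bsum \<rho> n e0 + real K * (\<zeta> * real n)"
        unfolding K(2) by linarith
      moreover have "bsum \<rho> n (w \<omega> (q * K)) \<le> real n * rmax" by (rule bsum_roof_le)
      moreover have "real K0 * bsum \<rho> n e0 \<le> real K0 * t"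
        using E(3)[of e0] e0 E'(1) by (intro mult_left_mono) auto
      ultimately show ?thesis unfolding U_def by linarith
    qed
    then have "(\<Sum>q<Q. bsum \<rho> (K * (n + m)) ((f ^^ (q * (K * (n + m)))) (z \<omega>))) \<le> real (card {..<Q}) * U"
      by (intro sum_bounded_above) auto
    then show ?thesis unfolding birkhoff_sum_mult[of f \<rho> Q] by simp
  qed
  have rate: "\<alpha> * U < real K0 * (h1 * t)" if "0 \<le> \<alpha>"
  proof -
    have n_le: "real n \<le> t / rmin" using tn rmin_pos by (simp add: le_divide_eq)
    have "real n * rmax \<le> t / rmin * rmax" using n_le rmax_pos by (intro mult_right_mono) auto
    moreover have "real K * (\<zeta> * real n) \<le> t"
      using mult_right_mono[OF K\<zeta>, of "real n"] tn by (simp add: mult_ac)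
    ultimately have "U \<le> t * (rmax / rmin + 1) + real K0 * t"
      unfolding U_def by (simp add: algebra_simps)
    then have "\<alpha> * U \<le> \<alpha> * (t * (rmax / rmin + 1) + real K0 * t)" using that by (rule mult_left_mono)
    also have "\<dots> = t * (\<bar>\<alpha>\<bar> * (rmax / rmin + 1)) + real K0 * \<alpha> * t" using that by (simp add: algebra_simps)
    also have "\<dots> < t * (real K0 * (h1 - \<alpha>)) + real K0 * \<alpha> * t"
      using K0 t0 by simp
    also have "\<dots> = real K0 * (h1 * t)" by (simp add: algebra_simps)
    finally show ?thesis .
  qed
  obtain T0 where T0: "\<And>T. T0 \<le> T \<Longrightarrow> \<exists>Q::nat. real Q * U \<le> T \<and> \<alpha> * T \<le> real Q * (real K0 * (h1 * t))"
    using ex_block_number[OF U0 rate] by blast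
  \<comment> \<open>The number of superblocks surely completed by time \<open>T\<close>; their free
    positions form the set \<open>F T\<close> below.\<close>
  define Q where "Q T = (SOME Q::nat. real Q * U \<le> T \<and> \<alpha> * T \<le> real Q * (real K0 * (h1 * t)))" for T
  have Q: "real (Q T) * U \<le> T" "\<alpha> * T \<le> real (Q T) * (real K0 * (h1 * t))" if "T0 \<le> T" for T
    using someI_ex[OF T0[OF that]] unfolding Q_def by auto
  define F where "F T = {j. j < Q T * K \<and> \<not> K dvd j}" for T
  have finF: "finite (F T)" for T by (simp add: F_def)
  have weight: "1 / N ^ card (F T) \<le> exp (- \<alpha> * T)" if "T0 \<le> T" for T
  proof -
    have "\<alpha> * T \<le> real (Q T) * (real K0 * (h1 * t))" by (rule Q(2)[OF that])
    also have "\<dots> \<le> real (Q T) * (real K0 * ln N)" using lnN by (intro mult_left_mono) auto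
    also have "\<dots> = real (Q T * K0) * ln N" by simp
    finally have "exp (\<alpha> * T) \<le> exp (real (Q T * K0) * ln N)" by simp
    also have "\<dots> = N ^ (Q T * K0)" unfolding exp_of_nat_mult using N by simp
    also have "\<dots> \<le> N ^ card (F T)"
      using card_non_multiples_ge[OF K(1), of "Q T"] N unfolding F_def
      by (intro power_increasing) (auto simp: K_def)
    finally have "1 / N ^ card (F T) \<le> 1 / exp (\<alpha> * T)" by (intro divide_left_mono) (use N in auto)
    then show ?thesis by (simp add: exp_minus inverse_eq_divide)
  qed
  obtain e' where e': "0 < e'" and base_close: "\<And>x y t k. \<lbrakk>\<And>u. 0 \<le> u \<Longrightarrow> u < t \<Longrightarrow> d (proj (x, u)) (proj (y, u)) < e';
      bsum \<rho> k x < t\<rbrakk> \<Longrightarrow> dist ((f ^^ k) x) ((f ^^ k) y) < es / 2"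
    using flow_close_imp_base_close[of "es / 2"] es by auto
  \<comment> \<open>Words that differ at a completed free position are separated by
    \<open>es\<close> at some moment of that block. Lying in one Bowen ball keeps the shadowing
    orbits within \<open>es / 2\<close> then, and the two shadowing errors add at most
    \<open>es / 4\<close>.\<close>
  have agree: "\<omega> j = \<omega>' j" if T: "T0 \<le> T" and \<omega>: "\<omega> \<in> \<Omega>" "\<omega>' \<in> \<Omega>" and q: "q \<in> S"
      and ball: "proj (z \<omega>, 0) \<in> bowen_ball S d g T q (e' / 2)" "proj (z \<omega>', 0) \<in> bowen_ball S d g T q (e' / 2)"
      and j: "j \<in> F T" for \<omega> \<omega>' T q j
  proof (rule ccontr)
    assume ne: "\<omega> j \<noteq> \<omega>' j"
    have cl: "d (proj (z \<omega>, u)) (proj (z \<omega>', u)) < e'" if u: "0 \<le> u" "u < T" for u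
    proof -
      have "d (g u q) (proj (z \<omega>, u)) < e' / 2" "d (g u q) (proj (z \<omega>', u)) < e' / 2"
        using ball u by (auto simp: bowen_ball_def flow_proj)
      then show ?thesis
        using d_triangle[of "proj (z \<omega>, u)" "g u q" "proj (z \<omega>', u)"] d_sym[of "g u q" "proj (z \<omega>, u)"]
          flow_in_S[OF u(1) q] u by simp
    qed
    have jK: "j < Q T * K" "\<not> K dvd j" using j by (auto simp: F_def)
    have "w \<omega> j \<in> E" "w \<omega>' j \<in> E" "w \<omega> j \<noteq> w \<omega>' j"
      using w_E' \<omega> jK E'(1) ne by (auto simp: w_def)
    then obtain p where p: "p < n" "es \<le> dist ((f ^^ p) (w \<omega> j)) ((f ^^ p) (w \<omega>' j))"
      using E(2) unfolding separated_def by blast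
    let ?k = "p + j * (n + m)"
    have "?k < Suc j * (n + m)" using p(1) by simp
    also have "\<dots> \<le> Q T * K * (n + m)" using jK(1) by (intro mult_le_mono1) simp
    finally have "?k < Q T * (K * (n + m))" by (simp add: mult.assoc)
    then have "bsum \<rho> ?k (z \<omega>) < bsum \<rho> (Q T * (K * (n + m))) (z \<omega>)" by (rule bsum_roof_strict_mono)
    also have "\<dots> \<le> T" using U[OF \<omega>(1), of "Q T"] Q(1)[OF T] by linarith
    finally have "dist ((f ^^ ?k) (z \<omega>)) ((f ^^ ?k) (z \<omega>')) < es / 2" using base_close[OF cl] by blast
    moreover have "dist ((f ^^ ?k) (z \<omega>)) ((f ^^ p) (w \<omega> j)) \<le> e" "dist ((f ^^ ?k) (z \<omega>')) ((f ^^ p) (w \<omega>' j)) \<le> e"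
      using z[OF p(1)] by blast+
    moreover have "dist ((f ^^ p) (w \<omega> j)) ((f ^^ p) (w \<omega>' j)) \<le> dist ((f ^^ p) (w \<omega> j)) ((f ^^ ?k) (z \<omega>))
        + dist ((f ^^ ?k) (z \<omega>)) ((f ^^ ?k) (z \<omega>')) + dist ((f ^^ ?k) (z \<omega>')) ((f ^^ p) (w \<omega>' j))"
      using dist_triangle[of "(f ^^ p) (w \<omega> j)" "(f ^^ p) (w \<omega>' j)" "(f ^^ ?k) (z \<omega>)"]
        dist_triangle[of "(f ^^ ?k) (z \<omega>)" "(f ^^ p) (w \<omega>' j)" "(f ^^ ?k) (z \<omega>')"] by linarith
    ultimately show False using p(2) e(1,4) dist_commute[of "(f ^^ p) (w \<omega> j)" "(f ^^ ?k) (z \<omega>)"] by linarith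
  qed
  show ?thesis
  proof (rule set_entropy_ge)
    show "0 < e' / 2" using e' by simp
    fix \<Gamma> assume \<Gamma>: "\<Gamma> \<in> bowen_covers S d g (irregular_set S g \<Phi>) (e' / 2) T0"
    \<comment> \<open>A cover of the irregular set thus covers the whole sequence space by sets on
      which the coordinates in \<open>F T\<close> are constant.\<close>
    define W where "W = (\<lambda>(q, T). {\<omega> \<in> \<Omega>. proj (z \<omega>, 0) \<in> bowen_ball S d g T q (e' / 2)})"
    show "1 \<le> entropy_Q \<alpha> \<Gamma>"
      unfolding entropy_Q_def
    proof (rule cylinder_cover_sum_ge_1[where E = E' and W = W and F = "\<lambda>(q, T). F T"])
      show "finite E'" "E' \<noteq> {}" using finE' e0 by auto
      show "countable \<Gamma>" using \<Gamma> by (simp add: bowen_covers_def)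
      show "UNIV \<rightarrow>\<^sub>E E' \<subseteq> (\<Union>\<gamma>\<in>\<Gamma>. W \<gamma>)"
      proof
        fix \<omega> :: "nat \<Rightarrow> 'a" assume "\<omega> \<in> UNIV \<rightarrow>\<^sub>E E'"
        then have "\<omega> \<in> \<Omega>" by (simp add: \<Omega>_def)
        moreover obtain q T where "(q, T) \<in> \<Gamma>" "proj (z \<omega>, 0) \<in> bowen_ball S d g T q (e' / 2)"
          using irr[OF \<open>\<omega> \<in> \<Omega>\<close>] \<Gamma> by (fastforce simp: bowen_covers_def)
        ultimately show "\<omega> \<in> (\<Union>\<gamma>\<in>\<Gamma>. W \<gamma>)" by (intro UN_I[of "(q, T)"]) (auto simp: W_def)
      qed
      fix \<gamma> assume "\<gamma> \<in> \<Gamma>"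
      then obtain q T where qT: "\<gamma> = (q, T)" "q \<in> S" "T0 \<le> T"
        using \<Gamma> by (cases \<gamma>) (auto simp: bowen_covers_def)
      show "finite (case \<gamma> of (q, T) \<Rightarrow> F T)" using qT finF by simp
      show "ennreal (1 / real (card E') ^ card (case \<gamma> of (q, T) \<Rightarrow> F T)) \<le> (case \<gamma> of (x, t) \<Rightarrow> ennreal (exp (- \<alpha> * t)))"
        using weight[OF qT(3)] qT(1) by (simp add: N_def ennreal_leI)
      fix \<omega> \<omega>' j assume "\<omega> \<in> W \<gamma>" "\<omega>' \<in> W \<gamma>" "j \<in> (case \<gamma> of (q, T) \<Rightarrow> F T)"
      then show "\<omega> j = \<omega>' j" using agree[OF qT(3) _ _ qT(2)] qT(1) by (simp add: W_def)
    qed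
  qed
qed

lemma irregular_set_entropy:
  assumes "specification_property f"
    and "\<mu>1 \<in> invariant_prob_measures (susp_topology f \<rho>) g"
      "\<mu>2 \<in> invariant_prob_measures (susp_topology f \<rho>) g" "integral\<^sup>L \<mu>1 \<Phi> < integral\<^sup>L \<mu>2 \<Phi>"
  shows "set_entropy S d g (irregular_set S g \<Phi>) = flow_entropy S d g"
proof (rule antisym)
  show "set_entropy S d g (irregular_set S g \<Phi>) \<le> flow_entropy S d g"
    by (rule set_entropy_le_flow_entropy) (auto simp: irregular_set_def)
  show "flow_entropy S d g \<le> set_entropy S d g (irregular_set S g \<Phi>)"
  proof (rule ccontr)
    assume "\<not> ?thesis"
    then have "set_entropy S d g (irregular_set S g \<Phi>) < flow_entropy S d g" by (simp only: not_le)
    from ereal_dense2[OF this] obtain \<alpha> where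
      \<alpha>: "set_entropy S d g (irregular_set S g \<Phi>) < ereal \<alpha>" "ereal \<alpha> < flow_entropy S d g"
      by blast
    from leD[OF irregular_set_entropy_ge[OF assms \<alpha>(2)]] \<alpha>(1) show False by (rule notE)
  qed
qed

end

theorem theorem5p1:
  fixes f :: "'a::metric_space \<Rightarrow> 'a"
    and \<rho> :: "'a \<Rightarrow> real"
    and \<Phi> :: "('a \<times> real) set \<Rightarrow> real"
    and d :: "('a \<times> real) set \<Rightarrow> ('a \<times> real) set \<Rightarrow> real"
  assumes "compact (UNIV :: 'a set)"
    and "homeomorphic_map euclidean euclidean f"
    and "specification_property f"
    and "continuous_on UNIV \<rho>" and "\<And>x. 0 < \<rho> x"
    and "Metric_space (susp_space f \<rho>) d"
    and "Metric_space.mtopology (susp_space f \<rho>) d = susp_topology f \<rho>"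
    and "continuous_map (susp_topology f \<rho>) euclideanreal \<Phi>"
    and "(INF \<mu>\<in>invariant_prob_measures (susp_topology f \<rho>) (susp_flow f \<rho>). ereal (integral\<^sup>L \<mu> \<Phi>))
       < (SUP \<mu>\<in>invariant_prob_measures (susp_topology f \<rho>) (susp_flow f \<rho>). ereal (integral\<^sup>L \<mu> \<Phi>))"
  shows "set_entropy (susp_space f \<rho>) d (susp_flow f \<rho>)
           (irregular_set (susp_space f \<rho>) (susp_flow f \<rho>) \<Phi>)
       = flow_entropy (susp_space f \<rho>) d (susp_flow f \<rho>)"
proof -
  have "continuous_on UNIV f"
    using homeomorphic_imp_continuous_map[OF assms(2)] by simp
  then interpret observed_metric_suspension f \<rho> d \<Phi>
    by (intro observed_metric_suspension.intro metric_suspension.intro suspension.intro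
        metric_suspension_axioms.intro observed_suspension.intro observed_suspension_axioms.intro assms)
  obtain \<mu>1 \<mu>2 where "\<mu>1 \<in> invariant_prob_measures (susp_topology f \<rho>) (susp_flow f \<rho>)"
      "\<mu>2 \<in> invariant_prob_measures (susp_topology f \<rho>) (susp_flow f \<rho>)"
      "ereal (integral\<^sup>L \<mu>1 \<Phi>) < ereal (integral\<^sup>L \<mu>2 \<Phi>)"
    using assms(9) unfolding INF_less_iff less_SUP_iff by blast
  then show ?thesis using irregular_set_entropy[OF assms(3)] by simp
qed

end
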